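(* Let $(M,g)$ be a space-time with a continuous Lorentzian metric $g$, and let $h$ be some smooth background Riemannian metric on $M$. Then for any $\varepsilon>0$ there exist smooth Lorentzian metrics $\check g_\varepsilon$ and $\hat g_\varepsilon$ on $M$ such that $\check g_\varepsilon\prec g\prec\hat g_\varepsilon$ and $d_h(\check g_\varepsilon,g)+d_h(\hat g_\varepsilon,g)<\varepsilon$, where $$d_h(g_1,g_2):=\sup_{0\neq X,Y\in TM}\frac{|g_1(X,Y)-g_2(X,Y)|}{\|X\|_h\,\|Y\|_h}.$$ Moreover, $\hat g_\varepsilon$ and $\check g_\varepsilon$ depend smoothly on $\varepsilon$, and if $g\in C^{1,1}$ then $\check g_\varepsilon$ and $\hat g_\varepsilon$ additionally satisfy: (i) $\check g_\varepsilon$ and $\hat g_\varepsilon$ converge to $g$ in the $C^1$-topology as $\varepsilon\to 0$; and (ii) the second derivatives of $\check g_\varepsilon$ and of $\hat g_\varepsilon$ are bounded, uniformly in $\varepsilon$, on compact sets.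
   Context: $M$ is a smooth manifold. A space-time is a time-oriented Lorentzian manifold (of signature $(-+\cdots+)$), with time-orientation determined by some continuous timelike vector field. For two Lorentzian metrics $g_1,g_2$ we write $g_1\prec g_2$ ($g_2$ has strictly larger light cones than $g_1$) if for any tangent vector $X\neq 0$, $g_1(X,X)\le 0$ implies $g_2(X,X)<0$. In the supremum defining $d_h$, $X$ and $Y$ range over nonzero vectors in the same tangent space $T_pM$, $p\in M$. Smooth dependence on $\varepsilon$ means that $(\varepsilon,p)\mapsto\hat g_\varepsilon(p)$ and $(\varepsilon,p)\mapsto\check g_\varepsilon(p)$ are smooth on $(0,\infty)\times M$. $C^{1,1}$ means continuously differentiable with locally Lipschitz first order derivatives. Convergence in the $C^1$-topology means uniform convergence on compact sets of the coefficients and their first derivatives in local charts; second derivatives are those of the coefficients in local charts. *)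

theory Defs
  imports "HOL-Analysis.Analysis"
begin

section \<open>Differentiability classes on open subsets of Euclidean spaces\<close>

definition partial_deriv ::
  "'e \<Rightarrow> ('e::euclidean_space \<Rightarrow> 'f::real_normed_vector) \<Rightarrow> 'e \<Rightarrow> 'f" where
  "partial_deriv v f x = frechet_derivative f (at x) v"

text \<open>These notions are meant for open \<open>S\<close>; then they depend only on the values of \<open>f\<close> on \<open>S\<close>.\<close>

primrec Ck_on ::
  "nat \<Rightarrow> 'e set \<Rightarrow> ('e::euclidean_space \<Rightarrow> 'f::real_normed_vector) \<Rightarrow> bool" where
  "Ck_on 0 S f \<longleftrightarrow> continuous_on S f"
| "Ck_on (Suc k) S f \<longleftrightarrow>
     (\<forall>x\<in>S. f differentiable (at x)) \<and> (\<forall>v\<in>Basis. Ck_on k S (partial_deriv v f))"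

definition smooth_on ::
  "'e set \<Rightarrow> ('e::euclidean_space \<Rightarrow> 'f::real_normed_vector) \<Rightarrow> bool" where
  "smooth_on S f \<longleftrightarrow> (\<forall>k. Ck_on k S f)"

definition locally_lipschitz_on ::
  "'e set \<Rightarrow> ('e::euclidean_space \<Rightarrow> 'f::real_normed_vector) \<Rightarrow> bool" where
  "locally_lipschitz_on S f \<longleftrightarrow> (\<forall>x\<in>S. \<exists>r>0. \<exists>L. L-lipschitz_on (ball x r \<inter> S) f)"

definition C11_on ::
  "'e set \<Rightarrow> ('e::euclidean_space \<Rightarrow> 'f::real_normed_vector) \<Rightarrow> bool" where
  "C11_on S f \<longleftrightarrow> Ck_on 1 S f \<and> (\<forall>v\<in>Basis. locally_lipschitz_on S (partial_deriv v f))"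


section \<open>Smooth manifolds\<close>

text \<open>A chart is a pair \<open>(U, \<phi>)\<close>; the values of \<open>\<phi>\<close> outside \<open>U\<close> are irrelevant.\<close>

type_synonym ('a, 'e) chart = "'a set \<times> ('a \<Rightarrow> 'e)"

definition chart_image :: "('a, 'e) chart \<Rightarrow> 'e set" where
  "chart_image c = snd c ` fst c"

definition chart_inv :: "('a, 'e) chart \<Rightarrow> 'e \<Rightarrow> 'a" where
  "chart_inv c = inv_into (fst c) (snd c)"

definition transition :: "('a, 'e) chart \<Rightarrow> ('a, 'e) chart \<Rightarrow> 'e \<Rightarrow> 'e" where
  "transition c d = snd d \<circ> chart_inv c"

text \<open>
  The manifold is \<open>topspace M\<close>, of dimension \<open>DIM('e)\<close>, and need not be connected. The smooth
  atlas \<open>A\<close> is arbitrary; taking it to be maximal makes statements about all charts in \<open>A\<close>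
  statements about all charts of the smooth structure.
\<close>

definition smooth_manifold :: "'a topology \<Rightarrow> ('a, 'e::euclidean_space) chart set \<Rightarrow> bool" where
  "smooth_manifold M A \<longleftrightarrow>
     Hausdorff_space M \<and> second_countable M \<and>
     (\<Union>c\<in>A. fst c) = topspace M \<and>
     (\<forall>c\<in>A. openin M (fst c) \<and> open (chart_image c) \<and>
        homeomorphic_map (subtopology M (fst c)) (top_of_set (chart_image c)) (snd c)) \<and>
     (\<forall>c\<in>A. \<forall>d\<in>A. smooth_on (snd c ` (fst c \<inter> fst d)) (transition c d))"


section \<open>Tangent vectors\<close>

text \<open>
  A tangent vector at \<open>p\<close> assigns to every chart around \<open>p\<close> its coordinate vector, subject to
  the transformation law under changes of coordinates; the value at all other charts is fixed
  to be \<open>0\<close>. The vector space operations are pointwise, so that for each chart \<open>c\<close> around \<open>p\<close>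
  the map \<open>X \<mapsto> X c\<close> is a linear isomorphism from the tangent space onto \<open>'e\<close>. Its inverse is
  \<open>tangent_vec A c p\<close>, see the two lemmas below.
\<close>

type_synonym ('a, 'e) tvec = "('a, 'e) chart \<Rightarrow> 'e"

definition charts_at :: "('a, 'e) chart set \<Rightarrow> 'a \<Rightarrow> ('a, 'e) chart set" where
  "charts_at A p = {c \<in> A. p \<in> fst c}"

definition tangent_space ::
  "('a, 'e::euclidean_space) chart set \<Rightarrow> 'a \<Rightarrow> ('a, 'e) tvec set" where
  "tangent_space A p = {X.
     (\<forall>c. c \<notin> charts_at A p \<longrightarrow> X c = 0) \<and>
     (\<forall>c\<in>charts_at A p. \<forall>d\<in>charts_at A p.
        X d = frechet_derivative (transition c d) (at (snd c p)) (X c))}"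

definition tangent_vec ::
  "('a, 'e::euclidean_space) chart set \<Rightarrow> ('a, 'e) chart \<Rightarrow> 'a \<Rightarrow> 'e \<Rightarrow> ('a, 'e) tvec" where
  "tangent_vec A c p v = (\<lambda>d. if d \<in> charts_at A p
     then frechet_derivative (transition c d) (at (snd c p)) v else 0)"

definition nonzero_tangent ::
  "('a, 'e::euclidean_space) chart set \<Rightarrow> 'a \<Rightarrow> ('a, 'e) tvec set" where
  "nonzero_tangent A p = tangent_space A p - {\<lambda>c. 0}"

definition continuous_vector_field ::
  "('a, 'e::euclidean_space) chart set \<Rightarrow> ('a \<Rightarrow> ('a, 'e) tvec) \<Rightarrow> bool" where
  "continuous_vector_field A T \<longleftrightarrow>
     (\<forall>p \<in> (\<Union>c\<in>A. fst c). T p \<in> tangent_space A p) \<and>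
     (\<forall>c\<in>A. continuous_on (chart_image c) (\<lambda>x. T (chart_inv c x) c))"

lemma tangent_vec_coord:
  assumes "X \<in> tangent_space A p" "c \<in> charts_at A p"
  shows "tangent_vec A c p (X c) = X"
proof
  fix d
  show "tangent_vec A c p (X c) d = X d"
  proof (cases "d \<in> charts_at A p")
    case True
    then have "X d = frechet_derivative (transition c d) (at (snd c p)) (X c)"
      using assms unfolding tangent_space_def by blast
    with True show ?thesis by (simp only: tangent_vec_def if_True)
  next
    case False
    then have "X d = 0"
      using assms unfolding tangent_space_def by blast
    with False show ?thesis by (simp only: tangent_vec_def if_False)
  qed
qed

lemma tangent_vec_in_tangent_space:
  fixes A :: "('a, 'e::euclidean_space) chart set"
  assumes M: "smooth_manifold M A" and c: "c \<in> charts_at A p"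
  shows "tangent_vec A c p v \<in> tangent_space A p" "tangent_vec A c p v c = v"
proof -
  have inj: "inj_on (snd e) (fst e)" if "e \<in> A" for e
  proof -
    have "openin M (fst e)"
      and h: "homeomorphic_map (subtopology M (fst e)) (top_of_set (chart_image e)) (snd e)"
      using M that by (auto simp: smooth_manifold_def)
    then have "topspace (subtopology M (fst e)) = fst e"
      using openin_subset topspace_subtopology_subset by metis
    with h show ?thesis
      by (simp add: homeomorphic_map_def)
  qed
  have inv: "chart_inv e (snd e q) = q" if "e \<in> A" "q \<in> fst e" for e q
    using inj that by (simp add: chart_inv_def)
  have op: "open (snd e ` (fst e \<inter> fst d))" if "e \<in> A" "d \<in> A" for e d
  proof -
    have o: "openin M (fst e)" "openin M (fst d)" "open (chart_image e)"
      and h: "homeomorphic_map (subtopology M (fst e)) (top_of_set (chart_image e)) (snd e)"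
      using M that by (auto simp: smooth_manifold_def)
    have "openin (subtopology M (fst e)) (fst e \<inter> fst d)"
      using o by (simp add: openin_Int openin_open_subtopology)
    then have "openin (top_of_set (chart_image e)) (snd e ` (fst e \<inter> fst d))"
      using homeomorphic_map_openness_eq[OF h] by simp
    then show ?thesis
      using openin_open_trans[OF _ o(3)] by simp
  qed
  have diff: "transition e d differentiable (at (snd e p))"
    if "e \<in> charts_at A p" "d \<in> charts_at A p" for e d
  proof -
    have "smooth_on (snd e ` (fst e \<inter> fst d)) (transition e d)"
      using M that by (auto simp: smooth_manifold_def charts_at_def)
    then have "Ck_on (Suc 0) (snd e ` (fst e \<inter> fst d)) (transition e d)"
      unfolding smooth_on_def by blast
    then show ?thesis
      unfolding Ck_on.simps using that by (simp add: charts_at_def)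
  qed
  have fd: "(transition e d has_derivative
      frechet_derivative (transition e d) (at (snd e p))) (at (snd e p))"
    if "e \<in> charts_at A p" "d \<in> charts_at A p" for e d
    using diff[OF that] by (simp only: frechet_derivative_works)
  have cocycle: "frechet_derivative (transition c e) (at (snd c p)) v =
      frechet_derivative (transition d e) (at (snd d p))
        (frechet_derivative (transition c d) (at (snd c p)) v)"
    if d: "d \<in> charts_at A p" and e: "e \<in> charts_at A p" for d e
  proof -
    have A: "c \<in> A" "d \<in> A" "e \<in> A" and p: "p \<in> fst c" "p \<in> fst d" "p \<in> fst e"
      using c d e by (auto simp: charts_at_def)
    have at: "transition c d (snd c p) = snd d p"
      using A p inv by (simp add: transition_def)
    have "(transition d e has_derivative frechet_derivative (transition d e) (at (snd d p)))
        (at (transition c d (snd c p)))"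
      using fd[OF d e] by (simp add: at)
    then have comp: "(transition d e \<circ> transition c d has_derivative
        frechet_derivative (transition d e) (at (snd d p)) \<circ>
        frechet_derivative (transition c d) (at (snd c p))) (at (snd c p))"
      by (rule diff_chain_at[OF fd[OF c d]])
    have "(transition c e has_derivative
        frechet_derivative (transition d e) (at (snd d p)) \<circ>
        frechet_derivative (transition c d) (at (snd c p))) (at (snd c p))"
    proof (rule has_derivative_transform_within_open[OF comp])
      show "open (snd c ` (fst c \<inter> fst d))" using op A by blast
      show "snd c p \<in> snd c ` (fst c \<inter> fst d)" using p by blast
      show "(transition d e \<circ> transition c d) y = transition c e y"
        if "y \<in> snd c ` (fst c \<inter> fst d)" for y
        using that inv[OF A(1)] inv[OF A(2)] by (auto simp: transition_def)
    qed
    from frechet_derivative_at[OF this] show ?thesis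
      by (simp only: fun_eq_iff comp_apply)
  qed
  have id: "frechet_derivative (transition c c) (at (snd c p)) v = v"
  proof -
    have A: "c \<in> A" "p \<in> fst c" using c by (auto simp: charts_at_def)
    have "(transition c c has_derivative (\<lambda>v. v)) (at (snd c p))"
    proof (rule has_derivative_transform_within_open[OF has_derivative_ident])
      show "open (snd c ` (fst c \<inter> fst c))" using op A by blast
      show "snd c p \<in> snd c ` (fst c \<inter> fst c)" using A by blast
      show "y = transition c c y" if "y \<in> snd c ` (fst c \<inter> fst c)" for y
        using that inv[OF A(1)] by (auto simp: transition_def)
    qed
    from frechet_derivative_at[OF this] show ?thesis
      by (simp only: fun_eq_iff)
  qed
  show "tangent_vec A c p v \<in> tangent_space A p"
    unfolding tangent_space_def mem_Collect_eq
  proof (intro conjI allI impI ballI)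
    show "tangent_vec A c p v d = 0" if "d \<notin> charts_at A p" for d
      using that by (simp add: tangent_vec_def)
    show "tangent_vec A c p v e =
        frechet_derivative (transition d e) (at (snd d p)) (tangent_vec A c p v d)"
      if "d \<in> charts_at A p" "e \<in> charts_at A p" for d e
      using cocycle[OF that] that by (simp only: tangent_vec_def if_True)
  qed
  show "tangent_vec A c p v c = v"
    using c id by (simp add: tangent_vec_def)
qed


section \<open>Fields of bilinear forms\<close>

text \<open>Only the values of \<open>g p\<close> on \<open>tangent_space A p\<close>, with \<open>p\<close> in the manifold, matter.\<close>

type_synonym ('a, 'e) tensor2 = "'a \<Rightarrow> ('a, 'e) tvec \<Rightarrow> ('a, 'e) tvec \<Rightarrow> real"

text \<open>
  For \<open>i\<close> and \<open>j\<close> in \<open>Basis\<close>, \<open>coeff A c g i j\<close> is the coefficient \<open>g\<^sub>i\<^sub>j\<close> in the chart \<open>c\<close>, as a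
  function on \<open>chart_image c\<close>.
\<close>

definition coeff ::
  "('a, 'e::euclidean_space) chart set \<Rightarrow> ('a, 'e) chart \<Rightarrow> ('a, 'e) tensor2 \<Rightarrow>
     'e \<Rightarrow> 'e \<Rightarrow> 'e \<Rightarrow> real" where
  "coeff A c g v w x = g (chart_inv c x)
     (tangent_vec A c (chart_inv c x) v) (tangent_vec A c (chart_inv c x) w)"

definition continuous_tensor ::
  "('a, 'e::euclidean_space) chart set \<Rightarrow> ('a, 'e) tensor2 \<Rightarrow> bool" where
  "continuous_tensor A g \<longleftrightarrow>
     (\<forall>c\<in>A. \<forall>i\<in>Basis. \<forall>j\<in>Basis. continuous_on (chart_image c) (coeff A c g i j))"

definition smooth_tensor ::
  "('a, 'e::euclidean_space) chart set \<Rightarrow> ('a, 'e) tensor2 \<Rightarrow> bool" where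
  "smooth_tensor A g \<longleftrightarrow>
     (\<forall>c\<in>A. \<forall>i\<in>Basis. \<forall>j\<in>Basis. smooth_on (chart_image c) (coeff A c g i j))"

definition C11_tensor ::
  "('a, 'e::euclidean_space) chart set \<Rightarrow> ('a, 'e) tensor2 \<Rightarrow> bool" where
  "C11_tensor A g \<longleftrightarrow>
     (\<forall>c\<in>A. \<forall>i\<in>Basis. \<forall>j\<in>Basis. C11_on (chart_image c) (coeff A c g i j))"

definition smooth_family ::
  "('a, 'e::euclidean_space) chart set \<Rightarrow> (real \<Rightarrow> ('a, 'e) tensor2) \<Rightarrow> bool" where
  "smooth_family A G \<longleftrightarrow> (\<forall>c\<in>A. \<forall>i\<in>Basis. \<forall>j\<in>Basis.
     smooth_on ({0<..} \<times> chart_image c) (\<lambda>(\<epsilon>, x). coeff A c (G \<epsilon>) i j x))"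

definition C1_convergent ::
  "('a, 'e::euclidean_space) chart set \<Rightarrow> (real \<Rightarrow> ('a, 'e) tensor2) \<Rightarrow>
     ('a, 'e) tensor2 \<Rightarrow> bool" where
  "C1_convergent A G g \<longleftrightarrow> (\<forall>c\<in>A. \<forall>K. compact K \<and> K \<subseteq> chart_image c \<longrightarrow>
     (\<forall>i\<in>Basis. \<forall>j\<in>Basis.
        uniform_limit K (\<lambda>\<epsilon>. coeff A c (G \<epsilon>) i j) (coeff A c g i j) (at_right 0) \<and>
        (\<forall>k\<in>Basis. uniform_limit K (\<lambda>\<epsilon>. partial_deriv k (coeff A c (G \<epsilon>) i j))
           (partial_deriv k (coeff A c g i j)) (at_right 0))))"

text \<open>The bound \<open>C\<close> is uniform over all parameters \<open>\<epsilon> > 0\<close>, not only over small ones.\<close>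

definition second_derivs_bounded ::
  "('a, 'e::euclidean_space) chart set \<Rightarrow> (real \<Rightarrow> ('a, 'e) tensor2) \<Rightarrow> bool" where
  "second_derivs_bounded A G \<longleftrightarrow> (\<forall>c\<in>A. \<forall>K. compact K \<and> K \<subseteq> chart_image c \<longrightarrow>
     (\<exists>C. \<forall>\<epsilon>>0. \<forall>x\<in>K. \<forall>i\<in>Basis. \<forall>j\<in>Basis. \<forall>k\<in>Basis. \<forall>l\<in>Basis.
        \<bar>partial_deriv l (partial_deriv k (coeff A c (G \<epsilon>) i j)) x\<bar> \<le> C))"


section \<open>Lorentzian and Riemannian metrics\<close>

text \<open>
  Bilinearity, symmetry, signature and definiteness on the tangent spaces are expressed through
  the isomorphisms \<open>X \<mapsto> X c\<close> with the model space \<open>'e\<close>.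
\<close>

definition symmetric_bilinear :: "('e::euclidean_space \<Rightarrow> 'e \<Rightarrow> real) \<Rightarrow> bool" where
  "symmetric_bilinear b \<longleftrightarrow> bilinear b \<and> (\<forall>v w. b v w = b w v)"

text \<open>Signature \<open>(- + \<dots> +)\<close>: there is a basis \<open>B\<close> in which the form is \<open>diag(-1, 1, \<dots>, 1)\<close>.\<close>

definition lorentz_form :: "('e::euclidean_space \<Rightarrow> 'e \<Rightarrow> real) \<Rightarrow> bool" where
  "lorentz_form b \<longleftrightarrow> symmetric_bilinear b \<and>
     (\<exists>B e0. independent B \<and> span B = UNIV \<and> e0 \<in> B \<and> b e0 e0 = -1 \<and>
        (\<forall>e\<in>B - {e0}. b e e = 1) \<and> (\<forall>e\<in>B. \<forall>f\<in>B. e \<noteq> f \<longrightarrow> b e f = 0))"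

definition positive_form :: "('e::euclidean_space \<Rightarrow> 'e \<Rightarrow> real) \<Rightarrow> bool" where
  "positive_form b \<longleftrightarrow> symmetric_bilinear b \<and> (\<forall>v. v \<noteq> 0 \<longrightarrow> b v v > 0)"

definition lorentzian_metric ::
  "('a, 'e::euclidean_space) chart set \<Rightarrow> ('a, 'e) tensor2 \<Rightarrow> bool" where
  "lorentzian_metric A g \<longleftrightarrow>
     (\<forall>c\<in>A. \<forall>x\<in>chart_image c. lorentz_form (\<lambda>v w. coeff A c g v w x))"

definition riemannian_metric ::
  "('a, 'e::euclidean_space) chart set \<Rightarrow> ('a, 'e) tensor2 \<Rightarrow> bool" where
  "riemannian_metric A h \<longleftrightarrow>
     (\<forall>c\<in>A. \<forall>x\<in>chart_image c. positive_form (\<lambda>v w. coeff A c h v w x))"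

text \<open>The timelike vector field \<open>T\<close> determines the time orientation.\<close>

definition continuous_spacetime ::
  "'a topology \<Rightarrow> ('a, 'e::euclidean_space) chart set \<Rightarrow> ('a, 'e) tensor2 \<Rightarrow>
     ('a \<Rightarrow> ('a, 'e) tvec) \<Rightarrow> bool" where
  "continuous_spacetime M A g T \<longleftrightarrow>
     smooth_manifold M A \<and> lorentzian_metric A g \<and> continuous_tensor A g \<and>
     continuous_vector_field A T \<and> (\<forall>p\<in>topspace M. g p (T p) (T p) < 0)"

text \<open>\<open>g1 \<prec> g2\<close>, that is, \<open>g2\<close> has the larger cones.\<close>

definition strictly_larger_cones ::
  "'a topology \<Rightarrow> ('a, 'e::euclidean_space) chart set \<Rightarrow>
     ('a, 'e) tensor2 \<Rightarrow> ('a, 'e) tensor2 \<Rightarrow> bool" where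
  "strictly_larger_cones M A g1 g2 \<longleftrightarrow>
     (\<forall>p\<in>topspace M. \<forall>X\<in>nonzero_tangent A p. g1 p X X \<le> 0 \<longrightarrow> g2 p X X < 0)"

text \<open>
  The supremum is taken in \<open>[0, \<infinity>]\<close>: it is \<open>\<infinity>\<close> when the quotients are unbounded and \<open>0\<close> when the
  manifold is empty.
\<close>

definition metric_dist ::
  "'a topology \<Rightarrow> ('a, 'e::euclidean_space) chart set \<Rightarrow> ('a, 'e) tensor2 \<Rightarrow>
     ('a, 'e) tensor2 \<Rightarrow> ('a, 'e) tensor2 \<Rightarrow> ennreal" where
  "metric_dist M A h g1 g2 =
     (SUP p\<in>topspace M. SUP X\<in>nonzero_tangent A p. SUP Y\<in>nonzero_tangent A p.
        ennreal (\<bar>g1 p X Y - g2 p X Y\<bar> / (sqrt (h p X X) * sqrt (h p Y Y))))"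

end

theory Submission
  imports Defs
begin

text \<open>
  Let \<open>G\<close> be a smooth approximation of \<open>g\<close> whose error, as a quadratic form, is at most half of
  \<open>\<lambda> h\<close> for a small positive function \<open>\<lambda>\<close>. Then \<open>G - \<lambda> h\<close> and \<open>G + \<lambda> h\<close> have strictly larger
  and strictly smaller cones than \<open>g\<close>, and polarization turns the quadratic estimate into the
  bound on the distance.

  In a chart, \<open>G\<close> comes from mollification: the second derivatives of a mollified \<open>C\<^sup>1\<^sup>,\<^sup>1\<close>
  function are bounded by the Lipschitz constants of its first derivatives. Instead of making the
  mollification width a smooth function of \<open>\<epsilon>\<close>, a sequence of mollifications of prescribed
  accuracies is interpolated by a partition of unity in \<open>1 / \<epsilon>\<close>. All estimates survive convex
  combinations, hence also the gluing by a partition of unity on the manifold. For a countable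
  open cover and functions \<open>\<beta>\<^sub>i\<close> equal to \<open>1\<close> on its members, the functions
  \<open>\<beta>\<^sub>i \<Prod>\<^sub>l\<^sub><\<^sub>i (1 - \<beta>\<^sub>l)\<close> are a locally finite one, so that no paracompactness is needed.
\<close>

section \<open>Calculus of differentiability classes\<close>

text \<open>Lorentzian forms are not closed under convex combinations, so gluing alone does not
  preserve the signature. What is glued is the convex condition that a form differs from
  \<open>g\<close> by at most a multiple of \<open>h\<close>; the signature is then recovered by
  openness. On a noncompact manifold the admissible multiple varies with the point, so \<lambda> is
  \<open>flat 0 \<epsilon> * \<kappa> p\<close>, where \<open>\<kappa>\<close> averages one constant
  \<open>kk i\<close> per ball. At each point \<open>\<kappa>\<close> is at most the constant of
  some ball active there, so a single chart decides the signature. The factor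
  \<open>flat 0 \<epsilon>\<close>, which is exp (-1/\<epsilon>), is smooth, positive, increasing,
  below 1 and below \<epsilon>, and tends to 0. Positivity leaves room for the error, monotonicity
  controls the interpolated accuracies, the bound 1 keeps the estimates uniform over all \<epsilon>
  > 0, and the bound \<epsilon> yields the distance.\<close>

lemma partial_deriv_eqI: "(f has_derivative D) (at x) \<Longrightarrow> partial_deriv v f x = D v"
  unfolding partial_deriv_def by (metis frechet_derivative_at)

lemma partial_deriv_has_derivative:
  "f differentiable (at x) \<Longrightarrow> (f has_derivative (\<lambda>v. partial_deriv v f x)) (at x)"
  unfolding partial_deriv_def by (simp add: frechet_derivative_works eta_contract_eq)

lemma has_derivative_cong_open:
  assumes "open S" "x \<in> S" "\<And>y. y \<in> S \<Longrightarrow> f y = g y"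
  shows "(f has_derivative D) (at x) \<longleftrightarrow> (g has_derivative D) (at x)"
  using has_derivative_transform_within_open[of f D x UNIV S g]
    has_derivative_transform_within_open[of g D x UNIV S f] assms by auto

text \<open>No differentiability is assumed: \<open>frechet_derivative\<close> chooses among all
  derivatives, and functions that agree near \<open>x\<close> have the same derivatives to choose
  from.\<close>

lemma partial_deriv_cong:
  assumes "open S" "x \<in> S" "\<And>y. y \<in> S \<Longrightarrow> f y = g y"
  shows "partial_deriv v f x = partial_deriv v g x"
proof -
  have "(f has_derivative D) (at x) \<longleftrightarrow> (g has_derivative D) (at x)" for D
    by (rule has_derivative_cong_open) (fact assms)+
  then show ?thesis by (simp add: partial_deriv_def frechet_derivative_def)
qed

lemma partial_deriv_expand:
  assumes "f differentiable (at x)"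
  shows "partial_deriv v f x = (\<Sum>b\<in>Basis. (v \<bullet> b) *\<^sub>R partial_deriv b f x)"
proof -
  have "linear (\<lambda>v. partial_deriv v f x)"
    using has_derivative_linear[OF partial_deriv_has_derivative[OF assms]] .
  then have "partial_deriv (\<Sum>b\<in>Basis. (v \<bullet> b) *\<^sub>R b) f x = (\<Sum>b\<in>Basis. (v \<bullet> b) *\<^sub>R partial_deriv b f x)"
    by (simp add: linear_sum[of "\<lambda>v. partial_deriv v f x"] linear_cmul[of "\<lambda>v. partial_deriv v f x"])
  then show ?thesis by (simp add: euclidean_representation)
qed

lemma Ck_on_subset: "Ck_on k S f \<Longrightarrow> T \<subseteq> S \<Longrightarrow> Ck_on k T f"
  by (induction k arbitrary: f) (auto intro: continuous_on_subset)

text \<open>\<open>Ck_on\<close> takes derivatives in the full space, so it only depends on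
  neighbourhoods of the points of \<open>S\<close>. Smoothness of glued functions is later checked
  with a different description around each point.\<close>

lemma Ck_on_local:
  assumes "\<And>x. x \<in> S \<Longrightarrow> \<exists>U. open U \<and> x \<in> U \<and> Ck_on k U f"
  shows "Ck_on k S f"
  using assms
proof (induction k arbitrary: f)
  case 0
  have "continuous (at x) f" if "x \<in> S" for x
    using 0[OF that] by (auto simp: continuous_on_eq_continuous_at)
  then show ?case
    by (simp add: continuous_at_imp_continuous_on)
next
  case (Suc k)
  have "f differentiable (at x)" if "x \<in> S" for x
    using Suc.prems[OF that] by auto
  moreover have "Ck_on k S (partial_deriv v f)" if "v \<in> Basis" for v
    by (rule Suc.IH) (use Suc.prems that in fastforce)
  ultimately show ?case by simp
qed

lemma Ck_on_cong:
  assumes "open S" "\<And>y. y \<in> S \<Longrightarrow> f y = g y"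
  shows "Ck_on k S f \<longleftrightarrow> Ck_on k S g"
  using assms(2)
proof (induction k arbitrary: f g)
  case 0
  then show ?case by (simp cong: continuous_on_cong)
next
  case (Suc k)
  have "f differentiable (at x) \<longleftrightarrow> g differentiable (at x)" if "x \<in> S" for x
    unfolding differentiable_def using has_derivative_cong_open[OF assms(1) that Suc.prems] by simp
  moreover have "Ck_on k S (partial_deriv v f) = Ck_on k S (partial_deriv v g)" for v
    by (rule Suc.IH) (rule partial_deriv_cong[OF assms(1) _ Suc.prems])
  ultimately show ?case by simp
qed

lemma Ck_on_continuous: "Ck_on k S f \<Longrightarrow> continuous_on S f"
  by (cases k) (auto intro: continuous_at_imp_continuous_on differentiable_imp_continuous_within)

lemma Ck_on_Suc_imp: "Ck_on (Suc k) S f \<Longrightarrow> Ck_on k S f"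
proof (induction k arbitrary: f)
  case 0
  then show ?case using Ck_on_continuous[of "Suc 0"] by simp
next
  case (Suc k)
  then show ?case by (metis Ck_on.simps(2))
qed

lemma Ck_on_bounded_linear:
  assumes "bounded_linear L" "open S" "Ck_on k S f"
  shows "Ck_on k S (\<lambda>x. L (f x))"
  using assms(3)
proof (induction k arbitrary: f)
  case 0
  then show ?case using assms by (simp add: bounded_linear.continuous_on)
next
  case (Suc k)
  have D: "((\<lambda>x. L (f x)) has_derivative (\<lambda>v. L (partial_deriv v f x))) (at x)" if "x \<in> S" for x
    using that Suc.prems assms(1)
    by (auto intro!: bounded_linear.has_derivative[OF assms(1)] partial_deriv_has_derivative)
  have "Ck_on k S (partial_deriv v (\<lambda>x. L (f x)))" if "v \<in> Basis" for v
    using Suc.IH[of "partial_deriv v f"] Suc.prems that partial_deriv_eqI[OF D]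
    by (subst Ck_on_cong[OF assms(2), of _ "\<lambda>x. L (partial_deriv v f x)"]) auto
  then show ?case
    using differentiableI[OF D] by simp
qed

lemma Ck_on_add:
  assumes "open S" "Ck_on k S f" "Ck_on k S g"
  shows "Ck_on k S (\<lambda>x. f x + g x)"
  using assms(2,3)
proof (induction k arbitrary: f g)
  case 0
  then show ?case by (simp add: continuous_on_add)
next
  case (Suc k)
  have D: "((\<lambda>x. f x + g x) has_derivative (\<lambda>v. partial_deriv v f x + partial_deriv v g x)) (at x)" if "x \<in> S" for x
    using that Suc.prems
    by (auto intro!: has_derivative_add partial_deriv_has_derivative)
  have "Ck_on k S (partial_deriv v (\<lambda>x. f x + g x))" if "v \<in> Basis" for v
    using Suc.IH[of "partial_deriv v f" "partial_deriv v g"] Suc.prems that partial_deriv_eqI[OF D]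
    by (subst Ck_on_cong[OF assms(1), of _ "\<lambda>x. partial_deriv v f x + partial_deriv v g x"]) auto
  then show ?case
    using differentiableI[OF D] by simp
qed

lemma partial_deriv_const: "partial_deriv v (\<lambda>x. c) = (\<lambda>x. 0)"
  by (rule ext) (rule partial_deriv_eqI, rule has_derivative_const)

lemma Ck_on_const: "Ck_on k S (\<lambda>x. c)"
  by (induction k arbitrary: c) (auto simp: partial_deriv_const continuous_on_const)

lemma Ck_on_ident: "Ck_on k S (\<lambda>x. x)"
proof (cases k)
  case (Suc j)
  have "partial_deriv v (\<lambda>x::'a. x) = (\<lambda>x. v)" for v
    by (rule ext) (rule partial_deriv_eqI, rule has_derivative_ident)
  then show ?thesis using Suc by (simp add: Ck_on_const)
qed (simp add: continuous_on_id)

lemma Ck_on_mult: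
  fixes f g :: "'e::euclidean_space \<Rightarrow> real"
  assumes "open S" "Ck_on k S f" "Ck_on k S g"
  shows "Ck_on k S (\<lambda>x. f x * g x)"
  using assms(2,3)
proof (induction k arbitrary: f g)
  case 0
  then show ?case by (simp add: continuous_on_mult)
next
  case (Suc k)
  have D: "((\<lambda>x. f x * g x) has_derivative (\<lambda>v. f x * partial_deriv v g x + partial_deriv v f x * g x)) (at x)" if "x \<in> S" for x
    using that Suc.prems
    by (auto intro!: has_derivative_mult partial_deriv_has_derivative)
  have "Ck_on k S (partial_deriv v (\<lambda>x. f x * g x))" if "v \<in> Basis" for v
  proof -
    have "Ck_on k S (\<lambda>x. f x * partial_deriv v g x + partial_deriv v f x * g x)"
      using Suc.prems that Ck_on_Suc_imp[OF Suc.prems(1)] Ck_on_Suc_imp[OF Suc.prems(2)]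
      by (intro Ck_on_add Suc.IH assms(1)) auto
    then show ?thesis
      using partial_deriv_eqI[OF D]
      by (subst Ck_on_cong[OF assms(1), of _ "\<lambda>x. f x * partial_deriv v g x + partial_deriv v f x * g x"]) auto
  qed
  then show ?case
    using differentiableI[OF D] by simp
qed

lemma Ck_on_sum:
  assumes "open S" "\<And>i. i \<in> I \<Longrightarrow> Ck_on k S (f i)"
  shows "Ck_on k S (\<lambda>x. \<Sum>i\<in>I. f i x)"
  using assms(2)
  by (induction I rule: infinite_finite_induct) (auto simp: Ck_on_const intro!: Ck_on_add assms(1))

text \<open>Expanding the outer derivative in coordinates turns the chain rule into a sum of
  products, so that closure under composition follows by induction from closure under sums and
  products.\<close>

lemma has_derivative_compose_partial:
  fixes f :: "'d::euclidean_space \<Rightarrow> real" and g :: "'e::euclidean_space \<Rightarrow> 'd"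
  assumes "f differentiable (at (g x))" "g differentiable (at x)"
  shows "((\<lambda>x. f (g x)) has_derivative
     (\<lambda>v. \<Sum>b\<in>Basis. (partial_deriv v g x \<bullet> b) * partial_deriv b f (g x))) (at x)"
proof -
  have "((\<lambda>x. f (g x)) has_derivative (\<lambda>v. partial_deriv (partial_deriv v g x) f (g x))) (at x)"
    using diff_chain_at[OF partial_deriv_has_derivative[OF assms(2)] partial_deriv_has_derivative[OF assms(1)]]
    by (simp add: o_def)
  moreover have "partial_deriv (partial_deriv v g x) f (g x) =
      (\<Sum>b\<in>Basis. (partial_deriv v g x \<bullet> b) * partial_deriv b f (g x))" for v
    using partial_deriv_expand[OF assms(1), of "partial_deriv v g x"] by simp
  ultimately show ?thesis by simp
qed

lemma Ck_on_compose:
  fixes f :: "'d::euclidean_space \<Rightarrow> real" and g :: "'e::euclidean_space \<Rightarrow> 'd"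
  assumes "open S" "open T" "Ck_on k T f" "Ck_on k S g" "g ` S \<subseteq> T"
  shows "Ck_on k S (\<lambda>x. f (g x))"
  using assms(3,4)
proof (induction k arbitrary: f)
  case 0
  then show ?case using assms(5) by (auto intro: continuous_on_compose2)
next
  case (Suc k)
  have D: "((\<lambda>x. f (g x)) has_derivative (\<lambda>v. \<Sum>b\<in>Basis. (partial_deriv v g x \<bullet> b) * partial_deriv b f (g x))) (at x)" if "x \<in> S" for x
    using that Suc.prems assms(5)
    by (auto intro!: has_derivative_compose_partial)
  have "Ck_on k S (partial_deriv v (\<lambda>x. f (g x)))" if "v \<in> Basis" for v
  proof -
    have "Ck_on k S (\<lambda>x. partial_deriv b f (g x))" if "b \<in> Basis" for b
      using Suc that Ck_on_Suc_imp[of k S g] by simp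
    then have "Ck_on k S (\<lambda>x. \<Sum>b\<in>Basis. (partial_deriv v g x \<bullet> b) * partial_deriv b f (g x))"
      using Suc.prems that assms(1)
      by (intro Ck_on_sum Ck_on_mult Ck_on_bounded_linear[OF bounded_linear_inner_left]) auto
    then show ?thesis
      using partial_deriv_eqI[OF D]
      by (subst Ck_on_cong[OF assms(1), of _ "\<lambda>x. \<Sum>b\<in>Basis. (partial_deriv v g x \<bullet> b) * partial_deriv b f (g x)"]) auto
  qed
  then show ?case
    using differentiableI[OF D] by simp
qed

lemma Ck_on_inverse:
  fixes f :: "'e::euclidean_space \<Rightarrow> real"
  assumes "open S" "Ck_on k S f" and nz: "\<And>x. x \<in> S \<Longrightarrow> f x \<noteq> 0"
  shows "Ck_on k S (\<lambda>x. inverse (f x))"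
  using assms(2)
proof (induction k)
  case 0
  then show ?case using nz by (simp add: continuous_on_inverse)
next
  case (Suc k)
  have D: "((\<lambda>x. inverse (f x)) has_derivative (\<lambda>v. -1 * (inverse (f x) * partial_deriv v f x * inverse (f x)))) (at x)" if "x \<in> S" for x
    using that Suc.prems nz Deriv.has_derivative_inverse[OF nz[OF that] partial_deriv_has_derivative[of f x]]
    by (auto simp: mult_ac)
  have "Ck_on k S (partial_deriv v (\<lambda>x. inverse (f x)))" if "v \<in> Basis" for v
  proof -
    \<comment> \<open>The derivative of the reciprocal contains the reciprocal again, whose
      regularity of order \<open>k\<close> is the induction hypothesis.\<close>
    have i: "Ck_on k S (\<lambda>x. inverse (f x))"
      using Suc Ck_on_Suc_imp by blast
    then have "Ck_on k S (\<lambda>x. -1 * (inverse (f x) * partial_deriv v f x * inverse (f x)))"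
      using Suc.prems that by (intro Ck_on_mult assms(1) Ck_on_const) auto
    then show ?thesis
      using partial_deriv_eqI[OF D]
      by (subst Ck_on_cong[OF assms(1), of _ "\<lambda>x. -1 * (inverse (f x) * partial_deriv v f x * inverse (f x))"]) auto
  qed
  then show ?case
    using differentiableI[OF D] by simp
qed

section \<open>Closure properties of smooth functions\<close>

lemma smooth_on_subset: "smooth_on S f \<Longrightarrow> T \<subseteq> S \<Longrightarrow> smooth_on T f"
  unfolding smooth_on_def using Ck_on_subset by blast

lemma smooth_on_cong:
  assumes "open S" "\<And>y. y \<in> S \<Longrightarrow> f y = g y"
  shows "smooth_on S f \<longleftrightarrow> smooth_on S g"
  unfolding smooth_on_def using Ck_on_cong[OF assms(1), of f g] assms(2) by simp

lemma smooth_on_local: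
  assumes "\<And>x. x \<in> S \<Longrightarrow> \<exists>U. open U \<and> x \<in> U \<and> smooth_on U f"
  shows "smooth_on S f"
  unfolding smooth_on_def by (intro allI Ck_on_local) (use assms in \<open>auto simp: smooth_on_def\<close>)

lemma smooth_on_const: "smooth_on S (\<lambda>x. c)"
  by (simp add: smooth_on_def Ck_on_const)

lemma smooth_on_ident: "smooth_on S (\<lambda>x. x)"
  by (simp add: smooth_on_def Ck_on_ident)

lemma smooth_on_bounded_linear:
  "bounded_linear L \<Longrightarrow> open S \<Longrightarrow> smooth_on S f \<Longrightarrow> smooth_on S (\<lambda>x. L (f x))"
  by (simp add: smooth_on_def Ck_on_bounded_linear)

lemma smooth_on_add:
  "open S \<Longrightarrow> smooth_on S f \<Longrightarrow> smooth_on S g \<Longrightarrow> smooth_on S (\<lambda>x. f x + g x)"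
  by (simp add: smooth_on_def Ck_on_add)

lemma smooth_on_sum:
  "open S \<Longrightarrow> (\<And>i. i \<in> I \<Longrightarrow> smooth_on S (f i)) \<Longrightarrow> smooth_on S (\<lambda>x. \<Sum>i\<in>I. f i x)"
  by (simp add: smooth_on_def Ck_on_sum)

lemma smooth_on_mult:
  fixes f g :: "'e::euclidean_space \<Rightarrow> real"
  shows "open S \<Longrightarrow> smooth_on S f \<Longrightarrow> smooth_on S g \<Longrightarrow> smooth_on S (\<lambda>x. f x * g x)"
  by (simp add: smooth_on_def Ck_on_mult)

lemma smooth_on_minus:
  fixes f g :: "'e::euclidean_space \<Rightarrow> real"
  assumes "open S" "smooth_on S f" "smooth_on S g"
  shows "smooth_on S (\<lambda>x. f x - g x)"
  using smooth_on_add[OF assms(1,2) smooth_on_mult[OF assms(1) smooth_on_const assms(3)], of "-1"] by simp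

lemma smooth_on_prod:
  fixes f :: "'i \<Rightarrow> 'e::euclidean_space \<Rightarrow> real"
  assumes "open S" "\<And>i. i \<in> I \<Longrightarrow> smooth_on S (f i)"
  shows "smooth_on S (\<lambda>x. \<Prod>i\<in>I. f i x)"
  using assms(2)
  by (induction I rule: infinite_finite_induct) (auto simp: smooth_on_const intro!: smooth_on_mult assms(1))

lemma smooth_on_compose:
  fixes f :: "'d::euclidean_space \<Rightarrow> real" and g :: "'e::euclidean_space \<Rightarrow> 'd"
  assumes "open S" "open T" "smooth_on T f" "smooth_on S g" "g ` S \<subseteq> T"
  shows "smooth_on S (\<lambda>x. f (g x))"
  using assms unfolding smooth_on_def by (blast intro: Ck_on_compose)

lemma smooth_on_inverse:
  fixes f :: "'e::euclidean_space \<Rightarrow> real"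
  assumes "open S" "smooth_on S f" "\<And>x. x \<in> S \<Longrightarrow> f x \<noteq> 0"
  shows "smooth_on S (\<lambda>x. inverse (f x))"
  using assms unfolding smooth_on_def by (blast intro: Ck_on_inverse)

lemma smooth_on_continuous: "smooth_on S f \<Longrightarrow> continuous_on S f"
  unfolding smooth_on_def using Ck_on_continuous by blast

lemma smooth_on_partial: "smooth_on S f \<Longrightarrow> v \<in> Basis \<Longrightarrow> smooth_on S (partial_deriv v f)"
  unfolding smooth_on_def by (meson Ck_on.simps(2))

lemma smooth_on_differentiable: "smooth_on S f \<Longrightarrow> x \<in> S \<Longrightarrow> f differentiable (at x)"
  unfolding smooth_on_def by (meson Ck_on.simps(2))

section \<open>A flat function, cutoffs and convolution\<close>

text \<open>The function of interest is \<open>flat 0\<close>, that is exp (-1/t) extended by 0. The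
  powers are carried along because the derivative of \<open>flat j\<close> is a linear combination
  of \<open>flat (j + 2)\<close> and \<open>flat (j + 1)\<close>, so one induction proves smoothness
  of the whole family.\<close>

definition flat :: "nat \<Rightarrow> real \<Rightarrow> real" where
  "flat j t = (if t > 0 then inverse t ^ j * exp (- inverse t) else 0)"

lemma flat_tendsto_0: "(flat j \<longlongrightarrow> 0) (at 0)"
proof (rule filterlim_split_at)
  show "(flat j \<longlongrightarrow> 0) (at_left 0)"
    by (rule tendsto_eventually) (auto simp: eventually_at_filter flat_def)
  have "((\<lambda>t. inverse t ^ j / exp (inverse t)) \<longlongrightarrow> (0::real)) (at_right 0)"
    using filterlim_compose[OF tendsto_power_div_exp_0 filterlim_inverse_at_top_right] .
  then show "(flat j \<longlongrightarrow> 0) (at_right 0)"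
    by (rule Lim_transform_eventually) (auto simp: eventually_at_filter flat_def exp_minus field_simps)
qed

lemma flat_has_derivative:
  "(flat j has_real_derivative flat (j + 2) t - j * flat (j + 1) t) (at t)"
proof -
  consider "t > 0" | "t < 0" | "t = 0" by linarith
  then show ?thesis
  proof cases
    case 1
    let ?s = "inverse t"
    have "((\<lambda>t. inverse t ^ j * exp (- inverse t)) has_real_derivative
        real j * (?s ^ (j - 1) * - (?s ^ 2)) * exp (- ?s) + ?s ^ j * (exp (- ?s) * ?s ^ 2)) (at t)"
      using 1
      by (auto intro!: derivative_eq_intros simp: power2_eq_square)
    also have "real j * (?s ^ (j - 1) * - (?s ^ 2)) = - real j * ?s ^ (j + 1)"
      by (cases j) (auto simp: power2_eq_square algebra_simps)
    also have "- real j * ?s ^ (j + 1) * exp (- ?s) + ?s ^ j * (exp (- ?s) * ?s ^ 2) =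
        flat (j + 2) t - j * flat (j + 1) t"
      using 1 by (simp add: flat_def power_add power2_eq_square)
    finally have "((\<lambda>t. inverse t ^ j * exp (- inverse t)) has_real_derivative
        flat (j + 2) t - j * flat (j + 1) t) (at t)" .
    then show ?thesis
      by (rule has_field_derivative_transform_within_open[where S = "{0<..}"])
        (use 1 in \<open>auto simp: flat_def\<close>)
  next
    case 2
    have "((\<lambda>t. 0) has_real_derivative flat (j + 2) t - j * flat (j + 1) t) (at t)"
      using 2 by (auto simp: flat_def)
    then show ?thesis
      by (rule has_field_derivative_transform_within_open[where S = "{..<0}"])
        (use 2 in \<open>auto simp: flat_def\<close>)
  next
    case 3
    \<comment> \<open>The difference quotient at 0 is exactly \<open>flat (j + 1)\<close>, whose
      limit at 0 is already known.\<close>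
    have "(\<lambda>h. (flat j (0 + h) - flat j 0) / h) = flat (j + 1)"
      by (auto simp: fun_eq_iff flat_def field_simps)
    then have "(flat j has_real_derivative 0) (at 0)"
      unfolding DERIV_def using flat_tendsto_0[of "j + 1"] by (simp del: add_0)
    then show ?thesis using 3 by (simp add: flat_def)
  qed
qed

lemma smooth_flat: "smooth_on UNIV (flat j)"
proof -
  have "Ck_on k UNIV (flat j)" for k
  proof (induction k arbitrary: j)
    case 0
    then show ?case
      using flat_has_derivative by (auto intro!: DERIV_continuous_on)
  next
    case (Suc k)
    have D: "(flat j has_derivative (\<lambda>v. (flat (j + 2) t + - real j * flat (j + 1) t) * v)) (at t)" for j t
      using flat_has_derivative[of j t] by (simp add: has_field_derivative_def)
    have "partial_deriv 1 (flat j) = (\<lambda>t. flat (j + 2) t + - real j * flat (j + 1) t)"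
    proof
      show "partial_deriv 1 (flat j) t = flat (j + 2) t + - real j * flat (j + 1) t" for t
        using partial_deriv_eqI[OF D[of j t], of 1] by simp
    qed
    moreover have "Ck_on k UNIV (\<lambda>t. flat (j + 2) t + - real j * flat (j + 1) t)"
      by (intro Ck_on_add Ck_on_mult Ck_on_const Suc.IH) auto
    ultimately show ?case using differentiableI[OF D] by simp
  qed
  then show ?thesis by (simp add: smooth_on_def)
qed

lemma flat_0_props: "flat 0 t \<ge> 0" "t > 0 \<Longrightarrow> flat 0 t > 0" "t \<le> 0 \<Longrightarrow> flat 0 t = 0"
   "flat 0 t \<le> 1" "s \<le> t \<Longrightarrow> flat 0 s \<le> flat 0 t" "t > 0 \<Longrightarrow> flat 0 t < t"
proof -
  show "flat 0 t < t" if "t > 0"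
  proof -
    have "inverse t < exp (inverse t)"
      using exp_ge_add_one_self[of "inverse t"] by linarith
    then show ?thesis using that by (simp add: flat_def exp_minus field_simps)
  qed
qed (auto simp: flat_def field_simps)

section \<open>Smooth steps and cutoffs\<close>

definition smooth_step :: "real \<Rightarrow> real" where
  "smooth_step t = flat 0 t * inverse (flat 0 t + flat 0 (1 - t))"

text \<open>The numbers \<open>t\<close> and \<open>1 - t\<close> are never both
  nonpositive.\<close>

lemma smooth_step_denom: "flat 0 t + flat 0 (1 - t) > 0"
  using flat_0_props(1)[of t] flat_0_props(1)[of "1 - t"] flat_0_props(2)[of t] flat_0_props(2)[of "1 - t"]
  by (cases "t > 0") (auto intro: add_pos_nonneg add_nonneg_pos)

lemma smooth_smooth_step: "smooth_on UNIV smooth_step"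
proof -
  have "smooth_on UNIV (\<lambda>t. flat 0 (1 - t))"
    by (rule smooth_on_compose[OF _ _ smooth_flat[of 0] smooth_on_minus[OF _ smooth_on_const smooth_on_ident]]) auto
  then have "smooth_on UNIV (\<lambda>t. flat 0 t * inverse (flat 0 t + flat 0 (1 - t)))"
    by (intro smooth_on_mult smooth_on_inverse smooth_on_add smooth_flat)
      (use smooth_step_denom in \<open>auto simp: less_imp_neq[THEN not_sym]\<close>)
  then show ?thesis unfolding smooth_step_def[abs_def] .
qed

lemma smooth_step_props: "0 \<le> smooth_step t" "smooth_step t \<le> 1" "t \<le> 0 \<Longrightarrow> smooth_step t = 0" "t \<ge> 1 \<Longrightarrow> smooth_step t = 1"
  using smooth_step_denom[of t] flat_0_props(1)[of t] flat_0_props(1)[of "1 - t"] flat_0_props(3)[of t] flat_0_props(3)[of "1 - t"]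
  by (auto simp: smooth_step_def field_simps)

lemma smooth_norm_sq: "smooth_on S (\<lambda>x::'e::euclidean_space. (x - a) \<bullet> (x - a))" if "open S"
proof -
  have "smooth_on S (\<lambda>x. \<Sum>b\<in>Basis. (x \<bullet> b - a \<bullet> b) * (x \<bullet> b - a \<bullet> b))"
    by (intro smooth_on_sum smooth_on_mult smooth_on_minus smooth_on_bounded_linear[OF bounded_linear_inner_left]
       smooth_on_ident smooth_on_const that)
  moreover have "(x - a) \<bullet> (x - a) = (\<Sum>b\<in>Basis. (x \<bullet> b - a \<bullet> b) * (x \<bullet> b - a \<bullet> b))" for x
    by (subst euclidean_inner) (simp add: inner_diff_left)
  ultimately show ?thesis
    by simp
qed

text \<open>The squared distance is smooth even at the centre. An affine rescaling sends the squared
  radii of the inner and outer ball to 1 and 0, where the smooth step becomes constant.\<close>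

lemma smooth_cutoff:
  fixes x0 :: "'e::euclidean_space"
  assumes "0 < r" "r < R"
  obtains b :: "'e \<Rightarrow> real" where "smooth_on UNIV b" "\<And>x. 0 \<le> b x" "\<And>x. b x \<le> 1"
     "\<And>x. x \<in> cball x0 r \<Longrightarrow> b x = 1" "\<And>x. x \<notin> ball x0 R \<Longrightarrow> b x = 0"
proof
  let ?u = "\<lambda>x. (R\<^sup>2 - (x - x0) \<bullet> (x - x0)) * inverse (R\<^sup>2 - r\<^sup>2)"
  have lt: "r\<^sup>2 < R\<^sup>2" using assms by (simp add: power_strict_mono)
  show "smooth_on UNIV (\<lambda>x. smooth_step (?u x))"
    by (rule smooth_on_compose[OF _ _ smooth_smooth_step])
      (auto intro!: smooth_on_mult smooth_on_minus smooth_norm_sq smooth_on_const)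
  show "smooth_step (?u x) = 1" if "x \<in> cball x0 r" for x
  proof (rule smooth_step_props(4))
    have "(norm (x - x0))\<^sup>2 \<le> r\<^sup>2"
      using that by (intro power_mono) (auto simp: dist_norm norm_minus_commute)
    then show "1 \<le> ?u x" using lt by (simp add: dot_square_norm field_simps)
  qed
  show "smooth_step (?u x) = 0" if "x \<notin> ball x0 R" for x
  proof (rule smooth_step_props(3))
    have "R\<^sup>2 \<le> (norm (x - x0))\<^sup>2"
      using that assms by (intro power_mono) (auto simp: dist_norm norm_minus_commute)
    then show "?u x \<le> 0" using lt by (simp add: dot_square_norm field_simps)
  qed
qed (auto simp: smooth_step_props)

text \<open>Differentiation under the integral, with the derivative falling on \<open>q\<close>. It
  is used in both roles: with the kernel as \<open>q\<close> for smoothness of a mollification, and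
  with the mollified function as \<open>q\<close> to let mollification commute with
  derivatives.\<close>

lemma convolution_partial:
  fixes p q :: "'e::euclidean_space \<Rightarrow> real"
  assumes U: "open U" "convex U" and p: "continuous_on (cbox a b) p" and q: "Ck_on (Suc 0) V q"
    and V: "\<And>x y. x \<in> U \<Longrightarrow> y \<in> cbox a b \<Longrightarrow> x - y \<in> V" and x: "x \<in> U"
  shows "((\<lambda>x. integral (cbox a b) (\<lambda>y. p y * q (x - y))) has_derivative
     (\<lambda>v. integral (cbox a b) (\<lambda>y. p y * partial_deriv v q (x - y)))) (at x)"
proof -
  \<comment> \<open>The gradient of \<open>q\<close>: the Leibniz rule asks for a jointly continuous
    operator-valued derivative, which is obtained from the continuous gradient through
    \<open>blinfun_inner_left\<close>.\<close>
  define G where "G z = (\<Sum>b\<in>Basis. partial_deriv b q z *\<^sub>R b)" for z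
  have G: "v \<bullet> G z = partial_deriv v q z" if "z \<in> V" for v z
    unfolding G_def using q that
    by (subst partial_deriv_expand) (auto simp: inner_sum_right mult_ac)
  have Gc: "continuous_on V G"
    unfolding G_def using q by (intro continuous_intros) auto
  have qc: "continuous_on V q" using q by (rule Ck_on_continuous)
  let ?fx = "\<lambda>x y. p y *\<^sub>R blinfun_inner_left (G (x - y))"
  have cfx: "continuous_on (U \<times> cbox a b) (\<lambda>(x, y). ?fx x y)"
    unfolding split_beta
    by (intro continuous_intros continuous_on_compose2[OF p]
      bounded_linear.continuous_on[OF bounded_linear_blinfun_inner_left]
      continuous_on_compose2[OF Gc]) (use V in auto)
  have "((\<lambda>x. integral (cbox a b) (\<lambda>y. p y * q (x - y))) has_derivative
      blinfun_apply (integral (cbox a b) (?fx x))) (at x within U)"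
  proof (rule leibniz_rule[OF _ _ cfx x U(2)])
    show "((\<lambda>x. p y * q (x - y)) has_derivative blinfun_apply (?fx x y)) (at x within U)"
      if "x \<in> U" "y \<in> cbox a b" for x y
    proof -
      have "(q has_derivative (\<lambda>v. partial_deriv v q (x - y))) (at (x - y))"
        using q V[OF that] by (intro partial_deriv_has_derivative) auto
      then have "((\<lambda>x. q (x - y)) has_derivative (\<lambda>v. partial_deriv v q (x - y))) (at x within U)"
        by (rule has_derivative_compose[OF has_derivative_diff[OF has_derivative_ident has_derivative_const], simplified])
      moreover have "blinfun_apply (?fx x y) = (\<lambda>v. p y * partial_deriv v q (x - y))"
        by (rule ext) (simp add: blinfun.scaleR_left G[OF V[OF that]])
      ultimately show ?thesis
        using has_derivative_mult_right[of _ _ _ "p y"] by simp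
    qed
    show "(\<lambda>y. p y * q (x - y)) integrable_on cbox a b" if "x \<in> U" for x
      by (intro integrable_continuous continuous_intros p continuous_on_compose2[OF qc]) (use V that in auto)
  qed
  moreover have "blinfun_apply (integral (cbox a b) (?fx x)) =
      (\<lambda>v. integral (cbox a b) (\<lambda>y. p y * partial_deriv v q (x - y)))"
  proof
    fix v
    have "?fx x integrable_on cbox a b"
      by (intro integrable_continuous continuous_on_compose2[OF cfx, where f = "\<lambda>y. (x, y)", simplified]
         continuous_intros) (use x in auto)
    then have "blinfun_apply (integral (cbox a b) (?fx x)) v = integral (cbox a b) (\<lambda>y. blinfun_apply (?fx x y) v)"
      by (rule blinfun_apply_integral)
    also have "\<dots> = integral (cbox a b) (\<lambda>y. p y * partial_deriv v q (x - y))"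
      by (rule integral_cong) (use G V x in \<open>auto simp: blinfun.scaleR_left\<close>)
    finally show "blinfun_apply (integral (cbox a b) (?fx x)) v =
      integral (cbox a b) (\<lambda>y. p y * partial_deriv v q (x - y))" .
  qed
  ultimately show ?thesis
    by (simp only: at_within_open[OF x U(1)])
qed

lemma convolution_Ck:
  fixes p q :: "'e::euclidean_space \<Rightarrow> real"
  assumes U: "open U" "convex U" and p: "continuous_on (cbox a b) p" and q: "Ck_on k V q"
    and V: "\<And>x y. x \<in> U \<Longrightarrow> y \<in> cbox a b \<Longrightarrow> x - y \<in> V"
  shows "Ck_on k U (\<lambda>x. integral (cbox a b) (\<lambda>y. p y * q (x - y)))"
  using q
proof (induction k arbitrary: q)
  case 0
  have "continuous_on (U \<times> cbox a b) (\<lambda>z. q (fst z - snd z))"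
 proof (rule continuous_on_compose2[of V q _ "\<lambda>z. fst z - snd z"])
    show "continuous_on V q" using 0 by simp
    show "continuous_on (U \<times> cbox a b) (\<lambda>z. fst z - snd z)" by (intro continuous_intros)
    show "(\<lambda>z. fst z - snd z) ` (U \<times> cbox a b) \<subseteq> V" using V by auto
  qed
  moreover have "continuous_on (U \<times> cbox a b) (\<lambda>z. p (snd z))"
    by (rule continuous_on_compose2[OF p]) (auto intro!: continuous_intros)
  ultimately have "continuous_on (U \<times> cbox a b) (\<lambda>(x, y). p y * q (x - y))"
    unfolding split_beta by (intro continuous_on_mult)
  then show ?case by (simp add: integral_continuous_on_param)
next
  case (Suc k)
  have "Ck_on (Suc 0) V q"
    using Suc.prems Ck_on_continuous[of k V] by auto
  note D = convolution_partial[OF U p this V]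
  have "Ck_on k U (partial_deriv v (\<lambda>x. integral (cbox a b) (\<lambda>y. p y * q (x - y))))" if "v \<in> Basis" for v
    using Suc.IH[of "partial_deriv v q"] Suc.prems that partial_deriv_eqI[OF D]
    by (subst Ck_on_cong[OF U(1), of _ "\<lambda>x. integral (cbox a b) (\<lambda>y. p y * partial_deriv v q (x - y))"]) auto
  then show ?case
    using differentiableI[OF D] by simp
qed

section \<open>Mollification\<close>

definition mkern :: "real \<Rightarrow> 'e::euclidean_space \<Rightarrow> real" where
  "mkern \<delta> y = flat 0 (\<delta>\<^sup>2 - y \<bullet> y)"

text \<open>Integrals are taken over boxes; this cube contains the closed ball of radius
  \<open>\<delta>\<close>, outside of which the kernel vanishes.\<close>

definition mbox :: "real \<Rightarrow> 'e::euclidean_space set" where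
  "mbox \<delta> = cbox (- (\<delta> *\<^sub>R One)) (\<delta> *\<^sub>R One)"

text \<open>Dividing by the total mass makes this an average without requiring a normalized
  kernel.\<close>

definition mollify :: "real \<Rightarrow> ('e::euclidean_space \<Rightarrow> real) \<Rightarrow> 'e \<Rightarrow> real" where
  "mollify \<delta> f x = integral (mbox \<delta>) (\<lambda>y. mkern \<delta> y * f (x - y)) / integral (mbox \<delta> :: 'e set) (mkern \<delta>)"

lemma smooth_mkern: "smooth_on UNIV (mkern \<delta> :: 'e::euclidean_space \<Rightarrow> real)"
proof -
  have "smooth_on UNIV (\<lambda>y::'e. flat 0 (\<delta>\<^sup>2 - (y - 0) \<bullet> (y - 0)))"
    by (rule smooth_on_compose[OF _ _ smooth_flat])
      (intro smooth_on_minus smooth_norm_sq smooth_on_const open_UNIV subset_UNIV)+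
  then show ?thesis by (simp add: mkern_def[abs_def])
qed

lemma continuous_mkern: "continuous_on S (mkern \<delta>)"
  using smooth_on_continuous[OF smooth_mkern] continuous_on_subset by blast

lemma mbox_iff: "y \<in> mbox \<delta> \<longleftrightarrow> (\<forall>b\<in>Basis. \<bar>y \<bullet> b\<bar> \<le> \<delta>)"
  by (auto simp: mbox_def mem_box abs_le_iff)

lemma mkern_eq_0:
  assumes "0 < \<delta>" "y \<notin> mbox \<delta>"
  shows "mkern \<delta> y = 0"
proof -
  obtain b where "b \<in> Basis" "\<delta> < \<bar>y \<bullet> b\<bar>" using assms by (auto simp: mbox_iff not_le)
  then have "\<delta> < norm y" using Basis_le_norm[of b y] by linarith
  then have "\<delta>\<^sup>2 < y \<bullet> y" using assms power_strict_mono[of \<delta> "norm y" 2] by (simp add: power2_norm_eq_inner)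
  then show ?thesis by (simp add: mkern_def flat_0_props)
qed

lemma mbox_norm:
  fixes y :: "'e::euclidean_space"
  assumes "y \<in> mbox \<delta>"
  shows "norm y \<le> \<delta> * DIM('e)"
proof -
  have "norm y \<le> (\<Sum>b\<in>Basis. \<bar>y \<bullet> b\<bar>)" by (rule norm_le_l1)
  also have "\<dots> \<le> (\<Sum>b\<in>(Basis :: 'e set). \<delta>)" using assms by (intro sum_mono) (auto simp: mbox_iff)
  finally show ?thesis by (simp add: mult.commute)
qed

text \<open>A continuous nonnegative function with vanishing integral is zero, whereas the kernel is
  positive at the origin.\<close>

lemma integral_mkern_pos:
  assumes "0 < \<delta>"
  shows "integral (mbox \<delta>) (mkern \<delta> :: 'e::euclidean_space \<Rightarrow> real) > 0"
proof -
  let ?k = "mkern \<delta> :: 'e \<Rightarrow> real"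
  have i: "?k integrable_on mbox \<delta>"
    unfolding mbox_def by (intro integrable_continuous continuous_mkern)
  have "integral (mbox \<delta>) ?k \<noteq> 0"
  proof
    assume "integral (mbox \<delta>) ?k = 0"
    then have "(?k has_integral 0) (mbox \<delta>)" using i by (metis integrable_integral)
    then have "?k 0 = 0"
      unfolding mbox_def
    proof (rule has_integral_0_cbox_imp_0[rotated 2])
      show "(0::'e) \<in> cbox (- (\<delta> *\<^sub>R One)) (\<delta> *\<^sub>R One)" using assms by (auto simp: mem_box)
      have "(0::'e) \<in> box (- (\<delta> *\<^sub>R One)) (\<delta> *\<^sub>R One)" using assms by (auto simp: mem_box)
      then show "box (- (\<delta> *\<^sub>R One)) (\<delta> *\<^sub>R (One::'e)) \<noteq> {}" by blast
    qed (rule continuous_mkern, simp add: mkern_def flat_0_props)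
    then show False using assms flat_0_props(2)[of "\<delta>\<^sup>2"] by (simp add: mkern_def)
  qed
  moreover have "integral (mbox \<delta>) ?k \<ge> 0"
    by (rule integral_nonneg[OF i]) (simp add: mkern_def flat_0_props)
  ultimately show ?thesis by simp
qed

text \<open>An average of values within \<open>e\<close> of \<open>a\<close> is within
  \<open>e\<close> of \<open>a\<close>. With \<open>a = \<phi> x\<close> this gives convergence,
  with \<open>a = 0\<close> uniform bounds and, for a difference of translates, Lipschitz
  estimates.\<close>

lemma mollify_bound:
  fixes \<phi> :: "'e::euclidean_space \<Rightarrow> real"
  assumes \<delta>: "0 < \<delta>" and c: "continuous_on (mbox \<delta>) (\<lambda>y. \<phi> (x - y))"
    and e: "\<And>y. y \<in> mbox \<delta> \<Longrightarrow> \<bar>\<phi> (x - y) - a\<bar> \<le> e"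
  shows "\<bar>mollify \<delta> \<phi> x - a\<bar> \<le> e"
proof -
  let ?k = "mkern \<delta> :: 'e \<Rightarrow> real" and ?I = "integral (mbox \<delta> :: 'e set)"
  have ik: "?k integrable_on mbox \<delta>"
    unfolding mbox_def by (intro integrable_continuous continuous_mkern)
  have ip: "(\<lambda>y. ?k y * \<phi> (x - y)) integrable_on mbox \<delta>"
    using c unfolding mbox_def by (intro integrable_continuous continuous_on_mult continuous_mkern)
  have "?I (\<lambda>y. ?k y * \<phi> (x - y)) - a * ?I ?k = ?I (\<lambda>y. ?k y * \<phi> (x - y)) - ?I (\<lambda>y. a * ?k y)"
    by simp
  also have "\<dots> = ?I (\<lambda>y. ?k y * \<phi> (x - y) - a * ?k y)"
    by (rule integral_diff[symmetric]) (use ik ip in \<open>auto intro: integrable_on_mult_right\<close>)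
  also have "norm \<dots> \<le> ?I (\<lambda>y. e * ?k y)"
  proof (rule integral_norm_bound_integral)
    show "(\<lambda>y. ?k y * \<phi> (x - y) - a * ?k y) integrable_on mbox \<delta>"
      by (intro integrable_diff ip integrable_on_mult_right ik)
    show "norm (?k y * \<phi> (x - y) - a * ?k y) \<le> e * ?k y" if "y \<in> mbox \<delta>" for y
    proof -
      have "?k y * \<phi> (x - y) - a * ?k y = (\<phi> (x - y) - a) * ?k y"
        by (simp add: algebra_simps)
      then have "norm (?k y * \<phi> (x - y) - a * ?k y) = \<bar>\<phi> (x - y) - a\<bar> * ?k y"
        by (simp only: real_norm_def abs_mult) (simp add: mkern_def flat_0_props)
      also have "\<dots> \<le> e * ?k y"
        using e[OF that] by (intro mult_right_mono) (auto simp: mkern_def flat_0_props)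
      finally show ?thesis .
    qed
  qed (use ik in \<open>auto intro: integrable_on_mult_right\<close>)
  finally have "\<bar>?I (\<lambda>y. ?k y * \<phi> (x - y)) - a * ?I ?k\<bar> \<le> e * ?I ?k" by simp
  moreover have "mollify \<delta> \<phi> x - a = (?I (\<lambda>y. ?k y * \<phi> (x - y)) - a * ?I ?k) / ?I ?k"
    using integral_mkern_pos[OF \<delta>, where 'e = 'e] by (simp add: mollify_def field_simps)
  ultimately show ?thesis
    using integral_mkern_pos[OF \<delta>, where 'e = 'e] by (simp add: abs_divide divide_le_eq)
qed

text \<open>The substitution \<open>z = x - y\<close> moves the dependence on \<open>x\<close> from
  \<open>f\<close>, which is only continuous, to the smooth kernel.\<close>

lemma smooth_mollify:
  fixes f :: "'e::euclidean_space \<Rightarrow> real"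
  assumes \<delta>: "0 < \<delta>" and f: "continuous_on UNIV f"
  shows "smooth_on UNIV (mollify \<delta> f)"
proof (rule smooth_on_local)
  fix x0 :: 'e
  define R where "R = norm x0 + 1"
  \<comment> \<open>The cube of half side \<open>c\<close> contains \<open>x - y\<close> for all
    \<open>x\<close> in \<open>ball 0 R\<close> and all \<open>y\<close> in
    \<open>mbox \<delta>\<close>, so the domain of integration no longer depends on
    \<open>x\<close>.\<close>
  define c where "c = R + \<delta>"
  have cpos: "c > 0" using \<delta> by (simp add: c_def R_def add_nonneg_pos)
  let ?J = "\<lambda>x. integral (cbox (- (c *\<^sub>R One)) (c *\<^sub>R One)) (\<lambda>z. f z * mkern \<delta> (x - z))"
  have eq: "mollify \<delta> f x = inverse (integral (mbox \<delta>) (mkern \<delta> :: 'e \<Rightarrow> real)) * ?J x" if "x \<in> ball 0 R" for x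
  proof -
    let ?g = "\<lambda>z. f z * mkern \<delta> (x - z)"
    let ?T = "(\<lambda>y. - y + x) ` cbox (- (c *\<^sub>R One)) (c *\<^sub>R One)"
    have "continuous_on (cbox (- (c *\<^sub>R One)) (c *\<^sub>R One)) ?g"
      by (intro continuous_on_mult continuous_on_subset[OF f]
        continuous_on_compose2[OF continuous_mkern[of UNIV]] continuous_intros) auto
    then have "(?g has_integral ?J x) (cbox (- (c *\<^sub>R One)) (c *\<^sub>R One))"
      using integrable_continuous integrable_integral by blast
    from has_integral_affinity[OF this, of "-1" x]
    have 1: "((\<lambda>y. ?g (- y + x)) has_integral ?J x) ?T"
      by (simp add: add.commute)
    have sub: "mbox \<delta> \<subseteq> ?T"
    proof
      fix y :: 'e assume y: "y \<in> mbox \<delta>"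
      have "\<bar>(x - y) \<bullet> b\<bar> \<le> c" if b: "b \<in> Basis" for b
      proof -
        have "\<bar>x \<bullet> b\<bar> \<le> R" using Basis_le_norm[OF b, of x] \<open>x \<in> ball 0 R\<close> by simp
        then show ?thesis using y b unfolding c_def by (fastforce simp: mbox_iff inner_diff_left)
      qed
      then have "x - y \<in> cbox (- (c *\<^sub>R One)) (c *\<^sub>R One)" using mbox_iff[of "x - y" c] by (simp add: mbox_def)
      then show "y \<in> ?T" by (intro image_eqI[of _ _ "x - y"]) auto
    qed
    \<comment> \<open>The kernel vanishes outside \<open>mbox \<delta>\<close>, so enlarging the
      domain does not change the integral.\<close>
    have "(\<lambda>y. if y \<in> mbox \<delta> then ?g (- y + x) else 0) = (\<lambda>y. ?g (- y + x))"
      using mkern_eq_0[OF \<delta>] by (auto simp: fun_eq_iff)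
    with 1 have "((\<lambda>y. ?g (- y + x)) has_integral ?J x) (mbox \<delta>)"
      using has_integral_restrict[OF sub, of "\<lambda>y. ?g (- y + x)" "?J x"] by simp
    then have "integral (mbox \<delta>) (\<lambda>y. mkern \<delta> y * f (x - y)) = ?J x"
      by (intro integral_unique) (simp add: mult.commute)
    then show ?thesis by (simp add: mollify_def field_simps)
  qed
  have "Ck_on k (ball 0 R) ?J" for k
    by (rule convolution_Ck[where V = UNIV])
      (use smooth_mkern[of \<delta>, where 'e = 'e] in \<open>auto simp: smooth_on_def intro: continuous_on_subset[OF f]\<close>)
  then have "smooth_on (ball 0 R) (\<lambda>x. inverse (integral (mbox \<delta>) (mkern \<delta> :: 'e \<Rightarrow> real)) * ?J x)"
    by (intro smooth_on_mult smooth_on_const) (auto simp: smooth_on_def)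
  then have "smooth_on (ball 0 R) (mollify \<delta> f)"
    by (subst smooth_on_cong[OF _ eq]) auto
  then show "\<exists>U. open U \<and> x0 \<in> U \<and> smooth_on U (mollify \<delta> f)"
    by (intro exI[of _ "ball 0 R"]) (auto simp: R_def)
qed

lemma mollify_cong:
  "(\<And>y. y \<in> mbox \<delta> \<Longrightarrow> f (x - y) = g (x - y)) \<Longrightarrow> mollify \<delta> f x = mollify \<delta> g x"
  unfolding mollify_def by (metis (mono_tags, lifting) integral_cong)

text \<open>Here the derivative falls on \<open>f\<close>, since a differentiated kernel would give
  no bounds that are uniform as \<open>\<delta>\<close> tends to 0.\<close>

lemma mollify_partial:
  fixes f :: "'e::euclidean_space \<Rightarrow> real"
  assumes U: "open U" "convex U" and f: "Ck_on (Suc 0) V f"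
    and V: "\<And>x y. x \<in> U \<Longrightarrow> y \<in> mbox \<delta> \<Longrightarrow> x - y \<in> V" and x: "x \<in> U"
  shows "partial_deriv v (mollify \<delta> f) x = mollify \<delta> (partial_deriv v f) x"
proof -
  have "((\<lambda>x. integral (mbox \<delta>) (\<lambda>y. mkern \<delta> y * f (x - y))) has_derivative
     (\<lambda>v. integral (mbox \<delta>) (\<lambda>y. mkern \<delta> y * partial_deriv v f (x - y)))) (at x)"
    using V unfolding mbox_def
    by (intro convolution_partial[OF U continuous_mkern f _ x]) auto
  from partial_deriv_eqI[OF has_derivative_mult_left[OF this,
      of "inverse (integral (mbox \<delta>) (mkern \<delta> :: 'e \<Rightarrow> real))"], of v]
  show ?thesis by (simp add: mollify_def[abs_def] divide_inverse)
qed

lemma continuous_on_reflect: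
  fixes \<phi> :: "'e::real_normed_vector \<Rightarrow> real"
  assumes "continuous_on V \<phi>" "\<And>y. y \<in> B \<Longrightarrow> x - y \<in> V"
  shows "continuous_on B (\<lambda>y. \<phi> (x - y))"
proof (rule continuous_on_compose2[OF assms(1)])
  show "continuous_on B (\<lambda>y. x - y)" by (intro continuous_on_diff continuous_on_const continuous_on_id)
  show "(\<lambda>y. x - y) ` B \<subseteq> V" using assms(2) by blast
qed

text \<open>The factor \<open>DIM('e)\<close> in \<open>\<delta>\<close> cancels the one in
  \<open>mbox_norm\<close>: the offsets have norm at most \<open>r / (n + 1)\<close>, so from the
  ball of radius \<open>2 * r\<close> they never leave the ball of radius \<open>3 * r\<close>.
  There uniform continuity gives the convergence.\<close>

lemma mollify_uniform_limit:
  fixes \<phi> :: "'e::euclidean_space \<Rightarrow> real"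
  assumes r: "0 < r" and c: "continuous_on (cball x0 (3 * r)) \<phi>"
  defines "\<delta> \<equiv> \<lambda>n::nat. r / (DIM('e) * (real n + 1))"
  shows "uniform_limit (ball x0 (2 * r)) (\<lambda>n. mollify (\<delta> n) \<phi>) \<phi> sequentially"
    "\<exists>C. \<forall>n. \<forall>x\<in>ball x0 (2 * r). \<bar>mollify (\<delta> n) \<phi> x\<bar> \<le> C"
    "0 < \<delta> n" "\<And>x y. x \<in> ball x0 (2 * r) \<Longrightarrow> y \<in> mbox (\<delta> n) \<Longrightarrow> x - y \<in> ball x0 (3 * r)"
proof -
  show pos: "0 < \<delta> n" for n using r by (simp add: \<delta>_def)
  have sm: "norm y \<le> r / (real n + 1)" if "y \<in> mbox (\<delta> n)" for y :: 'e and n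
    using mbox_norm[OF that] by (simp add: \<delta>_def)
  show inb: "x - y \<in> ball x0 (3 * r)" if "x \<in> ball x0 (2 * r)" "y \<in> mbox (\<delta> n)" for x y n
  proof -
    have "r / (real n + 1) \<le> r" using r by (simp add: field_simps)
    then have "norm y \<le> r" using sm[OF that(2)] by linarith
    moreover have "norm (x0 - (x - y)) \<le> norm (x0 - x) + norm y"
      using norm_triangle_ineq[of "x0 - x" y] by (simp add: algebra_simps)
    ultimately show ?thesis using that(1) by (simp add: dist_norm)
  qed
  have cont: "continuous_on (mbox (\<delta> n)) (\<lambda>y. \<phi> (x - y))" if "x \<in> ball x0 (2 * r)" for x n
    using inb[OF that, of _ n] by (intro continuous_on_reflect[OF c]) (simp add: less_imp_le)
  show "\<exists>C. \<forall>n. \<forall>x\<in>ball x0 (2 * r). \<bar>mollify (\<delta> n) \<phi> x\<bar> \<le> C"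
  proof -
    have "bounded (\<phi> ` cball x0 (3 * r))"
      by (intro compact_imp_bounded compact_continuous_image c) auto
    then obtain C where C: "\<And>z. z \<in> cball x0 (3 * r) \<Longrightarrow> \<bar>\<phi> z\<bar> \<le> C"
      unfolding bounded_iff real_norm_def by blast
    have "\<bar>mollify (\<delta> n) \<phi> x - 0\<bar> \<le> C" if "x \<in> ball x0 (2 * r)" for x n
      by (rule mollify_bound[OF pos cont[OF that]]) (use C inb[OF that, of _ n] in \<open>auto intro: less_imp_le\<close>)
    then show ?thesis unfolding diff_zero by blast
  qed
  show "uniform_limit (ball x0 (2 * r)) (\<lambda>n. mollify (\<delta> n) \<phi>) \<phi> sequentially"
  proof (rule uniform_limitI)
    fix e :: real assume e: "e > 0"
    have "uniformly_continuous_on (cball x0 (3 * r)) \<phi>"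
      by (intro compact_uniformly_continuous c) auto
    then obtain d where d: "d > 0"
      "\<And>z z'. z \<in> cball x0 (3 * r) \<Longrightarrow> z' \<in> cball x0 (3 * r) \<Longrightarrow> dist z' z < d \<Longrightarrow> dist (\<phi> z') (\<phi> z) < e / 2"
      unfolding uniformly_continuous_on_def using e half_gt_zero by metis
    obtain N :: nat where N: "r / d < real N" using reals_Archimedean2 by blast
    have "dist (mollify (\<delta> n) \<phi> x) (\<phi> x) < e" if n: "n \<ge> N" and x: "x \<in> ball x0 (2 * r)" for n x
    proof -
      have "r / (real n + 1) < d"
        using N n d(1) r by (simp add: field_simps) (smt (verit) mult_left_mono of_nat_le_iff)
      then have small: "norm y < d" if "y \<in> mbox (\<delta> n)" for y :: 'e using sm[OF that] by linarith
      have "\<bar>mollify (\<delta> n) \<phi> x - \<phi> x\<bar> \<le> e / 2"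
      proof (rule mollify_bound[OF pos cont[OF x]])
        fix y :: 'e assume y: "y \<in> mbox (\<delta> n)"
        have "dist (\<phi> (x - y)) (\<phi> x) < e / 2"
          using inb[OF x y] x r small[OF y] by (intro d(2)) (auto simp: dist_norm)
        then show "\<bar>\<phi> (x - y) - \<phi> x\<bar> \<le> e / 2" by (simp add: dist_real_def)
      qed
      then show ?thesis using e by (simp add: dist_real_def)
    qed
    then show "\<forall>\<^sub>F n in sequentially. \<forall>x\<in>ball x0 (2 * r). dist (mollify (\<delta> n) \<phi> x) (\<phi> x) < e"
      unfolding eventually_sequentially by blast
  qed
qed

text \<open>The partial derivative is a limit of difference quotients along a unit vector, each
  bounded by \<open>L\<close>.\<close>

lemma lipschitz_on_partial_bound:
  fixes f :: "'e::euclidean_space \<Rightarrow> real"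
  assumes "open U" "x \<in> U" "L-lipschitz_on U f" "f differentiable (at x)" "v \<in> Basis"
  shows "\<bar>partial_deriv v f x\<bar> \<le> L"
proof -
  have "((\<lambda>t. x + t *\<^sub>R v) has_derivative (\<lambda>t. t *\<^sub>R v)) (at 0)"
    by (auto intro!: derivative_eq_intros)
  moreover have "(f has_derivative (\<lambda>w. partial_deriv w f x)) (at (x + 0 *\<^sub>R v))"
    using partial_deriv_has_derivative[OF assms(4)] by simp
  ultimately have "((\<lambda>t. f (x + t *\<^sub>R v)) has_derivative (\<lambda>t. partial_deriv (t *\<^sub>R v) f x)) (at 0)"
    by (rule has_derivative_compose)
  moreover have "partial_deriv (t *\<^sub>R v) f x = partial_deriv v f x * t" for t
    using has_derivative_linear[OF partial_deriv_has_derivative[OF assms(4)]]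
    by (simp add: linear_cmul[of "\<lambda>v. partial_deriv v f x"])
  ultimately have "((\<lambda>t. f (x + t *\<^sub>R v)) has_real_derivative partial_deriv v f x) (at 0)"
    by (simp add: has_field_derivative_def)
  then have lim: "((\<lambda>h. (f (x + h *\<^sub>R v) - f x) / h) \<longlongrightarrow> partial_deriv v f x) (at 0)"
    by (simp add: DERIV_def)
  have "((\<lambda>h. x + h *\<^sub>R v) \<longlongrightarrow> x) (at (0::real))"
    by (auto intro!: tendsto_eq_intros)
  then have "\<forall>\<^sub>F h in at 0. x + h *\<^sub>R v \<in> U"
    using assms(1,2) by (rule topological_tendstoD)
  moreover have "\<forall>\<^sub>F h in at (0::real). h \<noteq> 0" by (simp add: eventually_at_filter)
  ultimately have "\<forall>\<^sub>F h in at 0. norm ((f (x + h *\<^sub>R v) - f x) / h) \<le> L"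
  proof eventually_elim
    case (elim h)
    then have "dist (f (x + h *\<^sub>R v)) (f x) \<le> L * dist (x + h *\<^sub>R v) x"
      using assms by (intro lipschitz_onD)
    then show ?case using elim assms(5) by (simp add: dist_norm divide_le_eq field_simps)
  qed
  then show ?thesis
    using Lim_norm_ubound[OF _ lim] by simp
qed

lemma mollification_sequence:
  fixes f :: "'e::euclidean_space \<Rightarrow> real"
  assumes r: "0 < r" and S: "open S" "cball x0 (3 * r) \<subseteq> S" and f: "continuous_on S f"
  obtains F where "\<And>n::nat. smooth_on (ball x0 (2 * r)) (F n)"
    "uniform_limit (ball x0 (2 * r)) F f sequentially"
    "\<exists>C. \<forall>n. \<forall>x\<in>ball x0 (2 * r). \<bar>F n x\<bar> \<le> C"
    "Ck_on (Suc 0) S f \<longrightarrow> (\<forall>v\<in>Basis.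
      uniform_limit (ball x0 (2 * r)) (\<lambda>n. partial_deriv v (F n)) (partial_deriv v f) sequentially \<and>
      (\<exists>C. \<forall>n. \<forall>x\<in>ball x0 (2 * r). \<bar>partial_deriv v (F n) x\<bar> \<le> C) \<and>
      (\<forall>w\<in>Basis. \<forall>L. L-lipschitz_on (cball x0 (3 * r)) (partial_deriv v f) \<longrightarrow>
        (\<forall>n. \<forall>x\<in>ball x0 (2 * r). \<bar>partial_deriv w (partial_deriv v (F n)) x\<bar> \<le> L)))"
proof
  define \<delta> where "\<delta> n = r / (DIM('e) * (real n + 1))" for n :: nat
  let ?F = "\<lambda>n. mollify (\<delta> n) f"
  have fc: "continuous_on (cball x0 (3 * r)) f" using f S continuous_on_subset by blast
  note L = mollify_uniform_limit[OF r, of x0, folded \<delta>_def]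
  have inb: "x - y \<in> ball x0 (3 * r)" if "x \<in> ball x0 (2 * r)" "y \<in> mbox (\<delta> n)" for x y n
    using L(4)[OF fc] that by blast
  have pos: "\<delta> n > 0" for n using L(3)[OF fc] .
  show sm: "smooth_on (ball x0 (2 * r)) (?F n)" for n
  proof -
    \<comment> \<open>\<open>smooth_mollify\<close> needs a function that is continuous everywhere.
      Composing with the nearest-point projection onto the closed ball extends \<open>f\<close>
      continuously, and the mollification on the smaller ball only sees values where nothing has
      changed.\<close>
    let ?f = "f \<circ> closest_point (cball x0 (3 * r))"
    have "continuous_on UNIV (closest_point (cball x0 (3 * r)))"
      using r by (intro continuous_on_closest_point) auto
    moreover have "range (closest_point (cball x0 (3 * r))) \<subseteq> cball x0 (3 * r)"
      using closest_point_in_set[of "cball x0 (3 * r)"] r by auto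
    ultimately have "continuous_on UNIV ?f"
      using fc by (metis continuous_on_compose continuous_on_subset)
    then have "smooth_on (ball x0 (2 * r)) (mollify (\<delta> n) ?f)"
      by (rule smooth_on_subset[OF smooth_mollify[OF pos]]) auto
    moreover have "mollify (\<delta> n) f x = mollify (\<delta> n) ?f x" if "x \<in> ball x0 (2 * r)" for x
      using inb[OF that] by (intro mollify_cong) (simp add: closest_point_self less_imp_le)
    ultimately show ?thesis by (subst smooth_on_cong) auto
  qed
  show "uniform_limit (ball x0 (2 * r)) ?F f sequentially"
    "\<exists>C. \<forall>n. \<forall>x\<in>ball x0 (2 * r). \<bar>?F n x\<bar> \<le> C"
    by (rule L[OF fc])+
  show "Ck_on (Suc 0) S f \<longrightarrow> (\<forall>v\<in>Basis.
      uniform_limit (ball x0 (2 * r)) (\<lambda>n. partial_deriv v (?F n)) (partial_deriv v f) sequentially \<and>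
      (\<exists>C. \<forall>n. \<forall>x\<in>ball x0 (2 * r). \<bar>partial_deriv v (?F n) x\<bar> \<le> C) \<and>
      (\<forall>w\<in>Basis. \<forall>L. L-lipschitz_on (cball x0 (3 * r)) (partial_deriv v f) \<longrightarrow>
        (\<forall>n. \<forall>x\<in>ball x0 (2 * r). \<bar>partial_deriv w (partial_deriv v (?F n)) x\<bar> \<le> L)))"
  proof (intro impI ballI conjI allI)
    fix v :: 'e assume v: "v \<in> Basis" and C1: "Ck_on (Suc 0) S f"
    have pc: "continuous_on (cball x0 (3 * r)) (partial_deriv v f)"
      using C1 v S(2) by (auto intro: continuous_on_subset)
    have pd: "partial_deriv v (?F n) x = mollify (\<delta> n) (partial_deriv v f) x" if "x \<in> ball x0 (2 * r)" for n x
      using that inb S(2) by (intro mollify_partial[OF _ _ C1, of "ball x0 (2 * r)"]) fastforce+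
    show "uniform_limit (ball x0 (2 * r)) (\<lambda>n. partial_deriv v (?F n)) (partial_deriv v f) sequentially"
      using L(1)[OF pc] by (subst uniform_limit_cong'[OF pd]) auto
    show "\<exists>C. \<forall>n. \<forall>x\<in>ball x0 (2 * r). \<bar>partial_deriv v (?F n) x\<bar> \<le> C"
      using L(2)[OF pc] pd by auto
    fix w :: 'e and L n x
    assume w: "w \<in> Basis" and lip: "L-lipschitz_on (cball x0 (3 * r)) (partial_deriv v f)" and x: "x \<in> ball x0 (2 * r)"
    have "L-lipschitz_on (ball x0 (2 * r)) (partial_deriv v (?F n))"
    proof (rule lipschitz_onI)
      show "0 \<le> L" using lip by (rule lipschitz_on_nonneg)
      fix x x' assume x: "x \<in> ball x0 (2 * r)" "x' \<in> ball x0 (2 * r)"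
      let ?p = "partial_deriv v f"
      have cont: "continuous_on (mbox (\<delta> n)) (\<lambda>y. ?p (z - y))" if "z \<in> ball x0 (2 * r)" for z
        using inb[OF that, of _ n] by (intro continuous_on_reflect[OF pc]) (simp add: less_imp_le)
      \<comment> \<open>The difference of the mollification at \<open>x\<close> and
        \<open>x'\<close> is the mollification at \<open>x\<close> of this difference of translates,
        which the Lipschitz condition bounds by \<open>L * dist x x'\<close>. The constant is thus
        inherited for every \<open>n\<close>.\<close>
      let ?q = "\<lambda>y. ?p y - ?p (y + (x' - x))"
      have "mollify (\<delta> n) ?p x - mollify (\<delta> n) ?p x' = mollify (\<delta> n) ?q x"
      proof -
        have "integral (mbox (\<delta> n)) (\<lambda>y. mkern (\<delta> n) y * ?q (x - y)) =
           integral (mbox (\<delta> n)) (\<lambda>y. mkern (\<delta> n) y * ?p (x - y) - mkern (\<delta> n) y * ?p (x' - y))"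
          by (rule integral_cong) (simp add: algebra_simps)
        also have "\<dots> = integral (mbox (\<delta> n)) (\<lambda>y. mkern (\<delta> n) y * ?p (x - y)) -
            integral (mbox (\<delta> n)) (\<lambda>y. mkern (\<delta> n) y * ?p (x' - y))"
          by (rule integral_diff) (use cont x in \<open>auto simp: mbox_def intro!: integrable_continuous continuous_on_mult continuous_mkern\<close>)
        finally show ?thesis by (simp add: mollify_def diff_divide_distrib)
      qed
      moreover have "\<bar>mollify (\<delta> n) ?q x - 0\<bar> \<le> L * dist x x'"
      proof (rule mollify_bound[OF pos])
        have e: "x - y + (x' - x) = x' - y" for y by simp
        show "continuous_on (mbox (\<delta> n)) (\<lambda>y. ?q (x - y))"
          unfolding e using cont x by (intro continuous_on_diff)
        show "\<bar>?q (x - y) - 0\<bar> \<le> L * dist x x'" if "y \<in> mbox (\<delta> n)" for y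
          using lipschitz_onD[OF lip, of "x - y" "x' - y"] inb[OF x(1) that] inb[OF x(2) that]
          unfolding e by (simp add: dist_norm)
      qed
      ultimately show "dist (partial_deriv v (?F n) x) (partial_deriv v (?F n) x') \<le> L * dist x x'"
        using pd x by (simp add: dist_real_def)
    qed
    moreover have "partial_deriv v (?F n) differentiable (at x)"
      using smooth_on_differentiable[OF smooth_on_partial[OF sm v] x] .
    ultimately show "\<bar>partial_deriv w (partial_deriv v (?F n)) x\<bar> \<le> L"
      using x w by (intro lipschitz_on_partial_bound[of "ball x0 (2 * r)"]) auto
  qed
qed

section \<open>Smooth families in the parameter\<close>

text \<open>Differences of consecutive steps, so that sums telescope; starting from the constant 1
  makes the sum over \<open>n < N\<close> equal to \<open>1 - smooth_step (t + 1 - N)\<close> for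
  positive \<open>N\<close>. For \<open>n > 0\<close> the function vanishes outside the interval
  from \<open>n - 1\<close> to \<open>n + 1\<close>.\<close>

definition theta :: "nat \<Rightarrow> real \<Rightarrow> real" where
  "theta n t = (if n = 0 then 1 else smooth_step (t + 1 - real n)) - smooth_step (t - real n)"

lemma smooth_theta: "smooth_on UNIV (theta n)"
proof -
  have s: "smooth_on UNIV (\<lambda>t. smooth_step (t - c))" for c
    by (rule smooth_on_compose[OF _ _ smooth_smooth_step smooth_on_minus[OF _ smooth_on_ident smooth_on_const]]) auto
  have "smooth_on UNIV (\<lambda>t. (if n = 0 then 1 else smooth_step (t - (real n - 1))) - smooth_step (t - real n))"
    by (cases n) (auto intro!: smooth_on_minus s smooth_on_const smooth_smooth_step)
  moreover have "theta n = (\<lambda>t. (if n = 0 then 1 else smooth_step (t - (real n - 1))) - smooth_step (t - real n))"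
    by (auto simp: theta_def fun_eq_iff algebra_simps)
  ultimately show ?thesis by simp
qed

lemma theta_nonneg: "0 \<le> theta n t"
  using smooth_step_props(2)[of "t - n"] smooth_step_props(1)[of "t + 1 - n"]
    smooth_step_props(3)[of "t - n"] smooth_step_props(4)[of "t + 1 - n"]
  by (cases "t \<le> n") (auto simp: theta_def)

lemma theta_nonzero:
  assumes "theta n t \<noteq> 0"
  shows "t < real n + 1" "real n < t + 1 \<or> n = 0"
  using assms smooth_step_props(3)[of "t - n"] smooth_step_props(3)[of "t + 1 - n"]
    smooth_step_props(4)[of "t - n"] smooth_step_props(4)[of "t + 1 - n"]
  by (force simp: theta_def split: if_splits)+

lemma sum_theta:
  assumes "t + 1 \<le> real N" "0 \<le> t"
  shows "(\<Sum>n<N. theta n t) = 1"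
proof -
  have "(\<Sum>n<N. theta n t) = 1 - (if N = 0 then 1 else smooth_step (t + 1 - real N))"
    by (induction N) (auto simp: theta_def algebra_simps)
  then show ?thesis using assms smooth_step_props(3)[of "t + 1 - N"] by auto
qed

text \<open>For 1/\<epsilon> between \<open>n\<close> and \<open>n + 1\<close> this moves smoothly
  from \<open>a n\<close> to \<open>a (n + 1)\<close>, so \<epsilon> tending to 0 corresponds to
  running through the sequence.\<close>

definition interp :: "(nat \<Rightarrow> real) \<Rightarrow> real \<Rightarrow> real" where
  "interp a \<epsilon> = (\<Sum>n<nat \<lceil>inverse \<epsilon>\<rceil> + 1. theta n (inverse \<epsilon>) * a n)"

text \<open>The number of terms in \<open>interp\<close> jumps with \<open>\<epsilon>\<close>.
  Padding with vanishing terms up to a common \<open>N\<close> gives a fixed finite sum near any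
  given parameter, which is what makes the family smooth in \<open>\<epsilon>\<close>.\<close>

lemma interp_eq:
  assumes "0 < \<epsilon>" "inverse \<epsilon> + 1 \<le> real N"
  shows "interp a \<epsilon> = (\<Sum>n<N. theta n (inverse \<epsilon>) * a n)"
proof -
  let ?N = "nat \<lceil>inverse \<epsilon>\<rceil> + 1"
  have "inverse \<epsilon> > 0" using assms(1) by simp
  then have "0 < real N" using assms(2) by linarith
  moreover have "inverse \<epsilon> \<le> of_int (int N - 1)" using assms(2) by simp
  ultimately have "\<lceil>inverse \<epsilon>\<rceil> \<le> int N - 1" "0 < N" by (simp_all only: ceiling_le_iff of_nat_0_less_iff)
  then have "?N \<le> N" by linarith
  moreover have "theta n (inverse \<epsilon>) = 0" if "n \<ge> ?N" for n
  proof -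
    have "inverse \<epsilon> + 1 \<le> real n" using that by linarith
    moreover have "n \<noteq> 0" using that by auto
    ultimately show ?thesis using theta_nonzero(2)[of n "inverse \<epsilon>"] by linarith
  qed
  ultimately show ?thesis
    unfolding interp_def by (intro sum.mono_neutral_left) auto
qed

text \<open>Only indices with \<open>inverse \<epsilon> < n + 1\<close> carry weight, and the
  weights are nonnegative with sum 1.\<close>

lemma interp_bound:
  assumes "0 < \<epsilon>" "\<And>n. inverse \<epsilon> < real n + 1 \<Longrightarrow> \<bar>a n - b\<bar> \<le> e"
  shows "\<bar>interp a \<epsilon> - b\<bar> \<le> e"
proof -
  let ?t = "inverse \<epsilon>" and ?N = "nat \<lceil>inverse \<epsilon>\<rceil> + 1"
  have s: "(\<Sum>n<?N. theta n ?t) = 1"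
    using assms(1) by (intro sum_theta) (linarith, simp)
  have "interp a \<epsilon> - b = (\<Sum>n<?N. theta n ?t * (a n - b))"
    using s by (simp add: interp_def algebra_simps sum_subtractf flip: sum_distrib_left)
  also have "\<bar>\<dots>\<bar> \<le> (\<Sum>n<?N. theta n ?t * e)"
  proof (rule order_trans[OF sum_abs sum_mono])
    show "\<bar>theta n ?t * (a n - b)\<bar> \<le> theta n ?t * e" for n
      using assms(2)[of n] theta_nonneg[of n ?t] theta_nonzero(1)[of n ?t]
      by (cases "theta n ?t = 0") (auto simp: abs_mult intro: mult_left_mono)
  qed
  also have "\<dots> = e" using s by (simp flip: sum_distrib_right)
  finally show ?thesis .
qed

lemma has_derivative_interp:
  assumes "\<And>n. a n differentiable (at x)"
  shows "((\<lambda>x. interp (\<lambda>n. a n x) \<epsilon>) has_derivative (\<lambda>v. interp (\<lambda>n. partial_deriv v (a n) x) \<epsilon>)) (at x)"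
  unfolding interp_def
  by (intro has_derivative_sum has_derivative_mult_right partial_deriv_has_derivative assms)

text \<open>
  Convergence along the product filter gives uniform convergence on compact sets when the limit
  is continuous. Unlike the latter it can be handled by the rules for \<open>tendsto\<close>.
\<close>

definition near_conv :: "(real \<Rightarrow> 'e::euclidean_space \<Rightarrow> real) \<Rightarrow> ('e \<Rightarrow> real) \<Rightarrow> 'e \<Rightarrow> bool" where
  "near_conv G f x \<longleftrightarrow> ((\<lambda>(\<epsilon>, y). G \<epsilon> y) \<longlongrightarrow> f x) (at_right 0 \<times>\<^sub>F nhds x)"

definition near_bdd :: "(real \<Rightarrow> 'e::euclidean_space \<Rightarrow> real) \<Rightarrow> 'e \<Rightarrow> bool" where
  "near_bdd G x \<longleftrightarrow> (\<exists>C U. open U \<and> x \<in> U \<and> (\<forall>\<epsilon>>0. \<forall>y\<in>U. \<bar>G \<epsilon> y\<bar> \<le> C))"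

primrec near_bdd_C :: "nat \<Rightarrow> (real \<Rightarrow> 'e::euclidean_space \<Rightarrow> real) \<Rightarrow> 'e \<Rightarrow> bool" where
  "near_bdd_C 0 G x \<longleftrightarrow> near_bdd G x"
| "near_bdd_C (Suc k) G x \<longleftrightarrow>
     near_bdd G x \<and> (\<forall>v\<in>Basis. near_bdd_C k (\<lambda>\<epsilon>. partial_deriv v (G \<epsilon>)) x)"

definition near_smooth :: "(real \<Rightarrow> 'e::euclidean_space \<Rightarrow> real) \<Rightarrow> 'e \<Rightarrow> bool" where
  "near_smooth G x \<longleftrightarrow> (\<exists>U. open U \<and> x \<in> U \<and> (\<forall>\<epsilon>>0. smooth_on U (G \<epsilon>)))"

text \<open>The local form of properties (i) and (ii), enlarged until it is stable under products
  and changes of coordinates: the Leibniz rule for second derivatives also involves bounds on the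
  functions and their first derivatives. The limit \<open>f\<close> only has to be of class
  C1.\<close>

definition C1_near :: "(real \<Rightarrow> 'e::euclidean_space \<Rightarrow> real) \<Rightarrow> ('e \<Rightarrow> real) \<Rightarrow> 'e \<Rightarrow> bool" where
  "C1_near G f x \<longleftrightarrow>
     near_smooth G x \<and> (\<exists>U. open U \<and> x \<in> U \<and> Ck_on (Suc 0) U f) \<and> near_conv G f x \<and>
     (\<forall>v\<in>Basis. near_conv (\<lambda>\<epsilon>. partial_deriv v (G \<epsilon>)) (partial_deriv v f) x) \<and>
     near_bdd_C (Suc (Suc 0)) G x"

lemma near_conv_cong:
  assumes "open U" "x \<in> U" "\<And>\<epsilon> y. 0 < \<epsilon> \<Longrightarrow> y \<in> U \<Longrightarrow> G \<epsilon> y = G' \<epsilon> y"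
  shows "near_conv G f x \<longleftrightarrow> near_conv G' f x"
proof -
  have "\<forall>\<^sub>F p in at_right 0 \<times>\<^sub>F nhds x. (case p of (\<epsilon>, y) \<Rightarrow> G \<epsilon> y) = (case p of (\<epsilon>, y) \<Rightarrow> G' \<epsilon> y)"
    unfolding eventually_prod_filter
    by (rule exI[of _ "\<lambda>\<epsilon>. 0 < \<epsilon>"], rule exI[of _ "\<lambda>y. y \<in> U"])
      (use assms in \<open>auto simp: eventually_nhds eventually_at_filter\<close>)
  then show ?thesis unfolding near_conv_def by (rule tendsto_cong)
qed

lemma near_bdd_cong:
  assumes "open U" "x \<in> U" "\<And>\<epsilon> y. 0 < \<epsilon> \<Longrightarrow> y \<in> U \<Longrightarrow> G \<epsilon> y = G' \<epsilon> y"
  shows "near_bdd G x \<longleftrightarrow> near_bdd G' x"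
proof -
  have *: "near_bdd H' x" if bH: "near_bdd H x" and e: "\<And>\<epsilon> y. 0 < \<epsilon> \<Longrightarrow> y \<in> U \<Longrightarrow> H \<epsilon> y = H' \<epsilon> y" for H H'
  proof -
    obtain C V where V: "open V" "x \<in> V" "\<forall>\<epsilon>>0. \<forall>y\<in>V. \<bar>H \<epsilon> y\<bar> \<le> C"
      using bH unfolding near_bdd_def by meson
    then have "\<forall>\<epsilon>>0. \<forall>y\<in>U \<inter> V. \<bar>H' \<epsilon> y\<bar> \<le> C"
      using e by (simp flip: e)
    then show ?thesis unfolding near_bdd_def using V assms(1,2)
      by (intro exI[of _ C] exI[of _ "U \<inter> V"]) auto
  qed
  show ?thesis
    by (rule iffI) (erule *, simp add: assms(3))+
qed

lemma near_conv_interp: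
  assumes "open U" "x \<in> U" "uniform_limit U a b sequentially" "continuous_on U b"
  shows "near_conv (\<lambda>\<epsilon> y. interp (\<lambda>n. a n y) \<epsilon>) b x"
  unfolding near_conv_def
proof (rule tendstoI)
  fix e :: real assume e: "0 < e"
  obtain N where N: "\<And>n y. N \<le> n \<Longrightarrow> y \<in> U \<Longrightarrow> dist (a n y) (b y) < e / 3"
    using uniform_limitD[OF assms(3), of "e / 3"] e by (auto simp: eventually_sequentially)
  have "isCont b x" using assms by (simp add: continuous_on_eq_continuous_at)
  then have "\<forall>\<^sub>F y in nhds x. dist (b y) (b x) < e / 3"
    unfolding isCont_def using e by (intro tendstoD) (simp_all add: tendsto_nhds_iff)
  then have ev: "\<forall>\<^sub>F y in nhds x. y \<in> U \<and> dist (b y) (b x) < e / 3"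
    using assms(1,2) by (intro eventually_conj) (auto simp: eventually_nhds)
  have ev2: "\<forall>\<^sub>F \<epsilon> in at_right 0. 0 < \<epsilon> \<and> \<epsilon> < inverse (real N + 1)"
    unfolding eventually_at_right_field by (intro exI[of _ "inverse (real N + 1)"]) auto
  show "\<forall>\<^sub>F p in at_right 0 \<times>\<^sub>F nhds x. dist (case p of (\<epsilon>, y) \<Rightarrow> interp (\<lambda>n. a n y) \<epsilon>) (b x) < e"
    unfolding eventually_prod_filter
  proof (intro exI conjI allI impI)
    show "\<forall>\<^sub>F y in nhds x. y \<in> U \<and> dist (b y) (b x) < e / 3" by (fact ev)
    show "\<forall>\<^sub>F \<epsilon> in at_right 0. 0 < \<epsilon> \<and> \<epsilon> < inverse (real N + 1)" by (fact ev2)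
    fix \<epsilon> y assume \<epsilon>: "0 < \<epsilon> \<and> \<epsilon> < inverse (real N + 1)" and y: "y \<in> U \<and> dist (b y) (b x) < e / 3"
    \<comment> \<open>For such \<epsilon> all indices that carry weight lie beyond
      \<open>N\<close>.\<close>
    have "real N + 1 < inverse \<epsilon>" using \<epsilon> by (simp add: field_simps)
    then have "\<bar>interp (\<lambda>n. a n y) \<epsilon> - b y\<bar> \<le> e / 3"
      using \<epsilon> y N by (intro interp_bound) (auto simp: dist_real_def less_imp_le)
    then have "dist (interp (\<lambda>n. a n y) \<epsilon>) (b x) < e"
      using y e unfolding dist_real_def by linarith
    then show "dist (case (\<epsilon>, y) of (\<epsilon>, y) \<Rightarrow> interp (\<lambda>n. a n y) \<epsilon>) (b x) < e" by simp
  qed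
qed

lemma near_bdd_interp:
  assumes "open U" "x \<in> U" "\<exists>C. \<forall>n. \<forall>y\<in>U. \<bar>a n y\<bar> \<le> C"
  shows "near_bdd (\<lambda>\<epsilon> y. interp (\<lambda>n. a n y) \<epsilon>) x"
proof -
  obtain C where "\<And>n y. y \<in> U \<Longrightarrow> \<bar>a n y\<bar> \<le> C" using assms(3) by blast
  then have "\<bar>interp (\<lambda>n. a n y) \<epsilon>\<bar> \<le> C" if "0 < \<epsilon>" "y \<in> U" for \<epsilon> y
    using interp_bound[OF that(1), of "\<lambda>n. a n y" 0 C] that(2) by simp
  then show ?thesis unfolding near_bdd_def using assms(1,2) by blast
qed

lemma smooth_approximating_family:
  fixes f :: "'e::euclidean_space \<Rightarrow> real"
  assumes r: "0 < r" and S: "open S" "cball x0 (3 * r) \<subseteq> S" and f: "continuous_on S f" and \<kappa>: "0 < \<kappa>"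
  obtains \<Phi> where "smooth_on ({0<..} \<times> ball x0 (2 * r)) (\<lambda>(\<epsilon>, x). \<Phi> \<epsilon> x)"
    "\<And>\<epsilon> x. 0 < \<epsilon> \<Longrightarrow> x \<in> ball x0 (2 * r) \<Longrightarrow> \<bar>\<Phi> \<epsilon> x - f x\<bar> \<le> \<kappa> * flat 0 \<epsilon>"
    "\<And>x. Ck_on (Suc 0) S f \<Longrightarrow> (\<And>v. v \<in> Basis \<Longrightarrow> \<exists>L. L-lipschitz_on (cball x0 (3 * r)) (partial_deriv v f)) \<Longrightarrow>
      x \<in> ball x0 (2 * r) \<Longrightarrow> C1_near \<Phi> f x"
proof -
  let ?B = "ball x0 (2 * r)"
  obtain F where F: "\<And>n::nat. smooth_on ?B (F n)"
    "uniform_limit ?B F f sequentially"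
    "\<exists>C. \<forall>n. \<forall>x\<in>?B. \<bar>F n x\<bar> \<le> C"
    "Ck_on (Suc 0) S f \<longrightarrow> (\<forall>v\<in>Basis.
      uniform_limit (?B) (\<lambda>n. partial_deriv v (F n)) (partial_deriv v f) sequentially \<and>
      (\<exists>C. \<forall>n. \<forall>x\<in>?B. \<bar>partial_deriv v (F n) x\<bar> \<le> C) \<and>
      (\<forall>w\<in>Basis. \<forall>L. L-lipschitz_on (cball x0 (3 * r)) (partial_deriv v f) \<longrightarrow>
        (\<forall>n. \<forall>x\<in>?B. \<bar>partial_deriv w (partial_deriv v (F n)) x\<bar> \<le> L)))"
  proof (rule mollification_sequence[OF r S f], goal_cases)
    case (1 F)
    show ?case by (rule 1(1)[OF 1(2-5)])
  qed
  \<comment> \<open>The accuracy at index \<open>n\<close> is measured at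
    \<open>1 / (n + 1)\<close>, since this index can carry weight for every \<epsilon> >
    \<open>1 / (n + 1)\<close>. As \<open>flat 0\<close> increases, the accuracy then suffices for
    all these \<epsilon>.\<close>
  have "\<exists>k\<ge>n. \<forall>x\<in>?B. \<bar>F k x - f x\<bar> \<le> \<kappa> * flat 0 (inverse (real n + 1))" for n
  proof -
    have "0 < \<kappa> * flat 0 (inverse (real n + 1))" using \<kappa> flat_0_props(2) by simp
    then have "\<forall>\<^sub>F k in sequentially. \<forall>x\<in>?B. dist (F k x) (f x) < \<kappa> * flat 0 (inverse (real n + 1))"
      by (rule uniform_limitD[OF F(2)])
    then obtain K where "\<forall>k\<ge>K. \<forall>x\<in>?B. dist (F k x) (f x) < \<kappa> * flat 0 (inverse (real n + 1))"
      unfolding eventually_sequentially by blast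
    then show ?thesis by (intro exI[of _ "max n K"]) (auto simp: dist_real_def less_imp_le)
  qed
  then obtain k where k: "\<And>n. n \<le> k n" "\<And>n x. x \<in> ?B \<Longrightarrow> \<bar>F (k n) x - f x\<bar> \<le> \<kappa> * flat 0 (inverse (real n + 1))"
    by metis
  \<comment> \<open>\<open>k\<close> need not be monotone: tending to infinity is enough to keep the
    limits, and bounds valid for all \<open>n\<close> persist.\<close>
  have kt: "filterlim k sequentially sequentially"
    unfolding filterlim_at_top eventually_sequentially using k(1) order_trans by blast
  define a where "a n = F (k n)" for n
  define \<Phi> where "\<Phi> \<epsilon> x = interp (\<lambda>n. a n x) \<epsilon>" for \<epsilon> x
  have a: "smooth_on ?B (a n)" for n by (simp add: a_def F)
  show thesis
  proof
    show "smooth_on ({0<..} \<times> ?B) (\<lambda>(\<epsilon>, x). \<Phi> \<epsilon> x)"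
    proof (rule smooth_on_local)
      fix p :: "real \<times> 'e" assume "p \<in> {0<..} \<times> ?B"
      then obtain \<epsilon>0 z where p: "p = (\<epsilon>0, z)" "0 < \<epsilon>0" "z \<in> ?B" by auto
      let ?U = "{\<epsilon>0 / 2<..} \<times> ?B"
      \<comment> \<open>On \<open>?U\<close> the reciprocal of the parameter stays below
        \<open>inverse (\<epsilon>0 / 2)\<close>, so this number of terms serves the whole
        neighbourhood.\<close>
      define N where "N = nat \<lceil>inverse (\<epsilon>0 / 2)\<rceil> + 1"
      have U: "open ?U" by (intro open_Times) auto
      have eq: "(case q of (\<epsilon>, x) \<Rightarrow> \<Phi> \<epsilon> x) = (\<Sum>n<N. theta n (inverse (fst q)) * a n (snd q))" if "q \<in> ?U" for q
      proof -
        have "inverse (fst q) \<le> inverse (\<epsilon>0 / 2)"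
          using that p by (intro le_imp_inverse_le) auto
        then have "inverse (fst q) + 1 \<le> real N" unfolding N_def by linarith
        then show ?thesis using that p interp_eq[of "fst q" N] by (auto simp: \<Phi>_def split_beta)
      qed
      have fst: "smooth_on ?U (\<lambda>q. fst q)" and snd: "smooth_on ?U (\<lambda>q. snd q)"
        by (intro smooth_on_bounded_linear[OF _ U smooth_on_ident] bounded_linear_fst bounded_linear_snd)+
      have "smooth_on ?U (\<lambda>q. \<Sum>n<N. theta n (inverse (fst q)) * a n (snd q))"
      proof (intro smooth_on_sum smooth_on_mult U)
        show "smooth_on ?U (\<lambda>q. theta n (inverse (fst q)))" for n
          by (rule smooth_on_compose[OF U open_UNIV smooth_theta smooth_on_inverse[OF U fst]]) (use p in auto)
        show "smooth_on ?U (\<lambda>q. a n (snd q))" for n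
          by (rule smooth_on_compose[OF U _ a snd]) auto
      qed
      then have "smooth_on ?U (\<lambda>(\<epsilon>, x). \<Phi> \<epsilon> x)"
        using smooth_on_cong[OF U eq] by simp
      then show "\<exists>U. open U \<and> p \<in> U \<and> smooth_on U (\<lambda>(\<epsilon>, x). \<Phi> \<epsilon> x)"
        using U p by (intro exI[of _ ?U]) auto
    qed
    show "\<bar>\<Phi> \<epsilon> x - f x\<bar> \<le> \<kappa> * flat 0 \<epsilon>" if \<epsilon>: "0 < \<epsilon>" and x: "x \<in> ?B" for \<epsilon> x
      unfolding \<Phi>_def
    proof (rule interp_bound[OF \<epsilon>])
      fix n assume "inverse \<epsilon> < real n + 1"
      then have "inverse (real n + 1) \<le> \<epsilon>" using \<epsilon> by (simp add: field_simps)
      then have "flat 0 (inverse (real n + 1)) \<le> flat 0 \<epsilon>" by (rule flat_0_props)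
      then have "\<kappa> * flat 0 (inverse (real n + 1)) \<le> \<kappa> * flat 0 \<epsilon>" using \<kappa> by simp
      then show "\<bar>a n x - f x\<bar> \<le> \<kappa> * flat 0 \<epsilon>" using k(2)[OF x, of n] unfolding a_def by linarith
    qed
    fix x assume C1: "Ck_on (Suc 0) S f"
      and L: "\<And>v. v \<in> Basis \<Longrightarrow> \<exists>L. L-lipschitz_on (cball x0 (3 * r)) (partial_deriv v f)" and x: "x \<in> ?B"
    note F4 = F(4)[rule_format, OF C1, THEN conjunct1] F(4)[rule_format, OF C1, THEN conjunct2, THEN conjunct1]
      F(4)[rule_format, OF C1, THEN conjunct2, THEN conjunct2, rule_format]
    have BS: "?B \<subseteq> S" using S(2) r by (force simp: subset_iff)
    have pc: "continuous_on ?B (partial_deriv v f)" if "v \<in> Basis" for v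
      using C1 that BS by (auto intro: continuous_on_subset)
    have p1: "partial_deriv v (\<Phi> \<epsilon>) y = interp (\<lambda>n. partial_deriv v (a n) y) \<epsilon>" if "y \<in> ?B" for v \<epsilon> y
      unfolding \<Phi>_def using partial_deriv_eqI[OF has_derivative_interp] smooth_on_differentiable[OF a that] by blast
    have p2: "partial_deriv w (partial_deriv v (\<Phi> \<epsilon>)) y = interp (\<lambda>n. partial_deriv w (partial_deriv v (a n)) y) \<epsilon>"
      if y: "y \<in> ?B" and v: "v \<in> Basis" for v w \<epsilon> y
    proof -
      have "partial_deriv w (partial_deriv v (\<Phi> \<epsilon>)) y = partial_deriv w (\<lambda>y. interp (\<lambda>n. partial_deriv v (a n) y) \<epsilon>) y"
        by (rule partial_deriv_cong[of ?B]) (use y p1 in auto)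
      then show ?thesis
        using partial_deriv_eqI[OF has_derivative_interp] smooth_on_differentiable[OF smooth_on_partial[OF a v] y] by metis
    qed
    have ul: "uniform_limit ?B (\<lambda>n. G (k n)) l sequentially" if "uniform_limit ?B G l sequentially" for G l
      using filterlim_compose[OF that kt] .
    show "C1_near \<Phi> f x"
      unfolding C1_near_def near_bdd_C.simps
    proof (intro conjI ballI)
      have "smooth_on ?B (\<Phi> \<epsilon>)" for \<epsilon>
        unfolding \<Phi>_def interp_def by (intro smooth_on_sum smooth_on_mult smooth_on_const a) auto
      then show "near_smooth \<Phi> x"
        unfolding near_smooth_def using x by (intro exI[of _ ?B]) auto
      show "\<exists>U. open U \<and> x \<in> U \<and> Ck_on (Suc 0) U f"
        using x Ck_on_subset[OF C1 BS] by (intro exI[of _ ?B] conjI) auto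
      show "near_conv \<Phi> f x"
        unfolding \<Phi>_def[abs_def] a_def
        by (rule near_conv_interp[OF _ x ul[OF F(2)]]) (use f BS in \<open>auto intro: continuous_on_subset\<close>)
      show "near_bdd \<Phi> x"
        unfolding \<Phi>_def[abs_def] a_def
        by (rule near_bdd_interp[OF _ x]) (use F(3) in auto)
      fix v :: 'e assume v: "v \<in> Basis"
      have "near_conv (\<lambda>\<epsilon>. partial_deriv v (\<Phi> \<epsilon>)) (partial_deriv v f) x \<longleftrightarrow>
          near_conv (\<lambda>\<epsilon> y. interp (\<lambda>n. partial_deriv v (a n) y) \<epsilon>) (partial_deriv v f) x"
        by (rule near_conv_cong[OF open_ball x]) (rule p1)
      then show "near_conv (\<lambda>\<epsilon>. partial_deriv v (\<Phi> \<epsilon>)) (partial_deriv v f) x"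
        using near_conv_interp[OF _ x ul[OF F4(1)[OF v]] pc[OF v]] by (simp add: a_def)
      have "near_bdd (\<lambda>\<epsilon>. partial_deriv v (\<Phi> \<epsilon>)) x \<longleftrightarrow>
          near_bdd (\<lambda>\<epsilon> y. interp (\<lambda>n. partial_deriv v (a n) y) \<epsilon>) x"
        by (rule near_bdd_cong[OF open_ball x]) (rule p1)
      moreover have "near_bdd (\<lambda>\<epsilon> y. interp (\<lambda>n. partial_deriv v (a n) y) \<epsilon>) x"
        by (rule near_bdd_interp[OF _ x]) (use F4(2)[OF v] in \<open>auto simp: a_def\<close>)
      ultimately show "near_bdd (\<lambda>\<epsilon>. partial_deriv v (\<Phi> \<epsilon>)) x" by simp
      fix w :: 'e assume w: "w \<in> Basis"
      obtain L' where "L'-lipschitz_on (cball x0 (3 * r)) (partial_deriv v f)" using L[OF v] by blast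
      then have "\<forall>n. \<forall>y\<in>?B. \<bar>partial_deriv w (partial_deriv v (F (k n))) y\<bar> \<le> L'"
        using F4(3)[OF v w] by simp
      then have "near_bdd (\<lambda>\<epsilon> y. interp (\<lambda>n. partial_deriv w (partial_deriv v (a n)) y) \<epsilon>) x"
        unfolding a_def by (intro near_bdd_interp[OF open_ball x] exI)
      moreover have "near_bdd (\<lambda>\<epsilon>. partial_deriv w (partial_deriv v (\<Phi> \<epsilon>))) x \<longleftrightarrow>
          near_bdd (\<lambda>\<epsilon> y. interp (\<lambda>n. partial_deriv w (partial_deriv v (a n)) y) \<epsilon>) x"
        by (rule near_bdd_cong[OF open_ball x]) (rule p2[OF _ v])
      ultimately show "near_bdd (\<lambda>\<epsilon>. partial_deriv w (partial_deriv v (\<Phi> \<epsilon>))) x" by simp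
    qed
  qed
qed

section \<open>Local convergence with bounded second derivatives\<close>

lemma near_conv_add: "near_conv G f x \<Longrightarrow> near_conv H g x \<Longrightarrow> near_conv (\<lambda>\<epsilon> y. G \<epsilon> y + H \<epsilon> y) (\<lambda>y. f y + g y) x"
  unfolding near_conv_def split_beta by (rule tendsto_add)

lemma near_conv_mult: "near_conv G f x \<Longrightarrow> near_conv H g x \<Longrightarrow> near_conv (\<lambda>\<epsilon> y. G \<epsilon> y * H \<epsilon> y) (\<lambda>y. f y * g y) x"
  unfolding near_conv_def split_beta by (rule tendsto_mult)

lemma near_conv_sum:
  "(\<And>i. i \<in> I \<Longrightarrow> near_conv (G i) (f i) x) \<Longrightarrow> near_conv (\<lambda>\<epsilon> y. \<Sum>i\<in>I. G i \<epsilon> y) (\<lambda>y. \<Sum>i\<in>I. f i y) x"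
  unfolding near_conv_def split_beta by (rule tendsto_sum)

lemma isCont_imp_filterlim_nhds: "isCont f x \<Longrightarrow> filterlim f (nhds (f x)) (nhds x)"
  by (simp add: isCont_def tendsto_at_iff_tendsto_nhds)

lemma near_conv_fixed:
  assumes "isCont a x"
  shows "near_conv (\<lambda>\<epsilon>. a) a x"
  unfolding near_conv_def split_beta
  by (rule filterlim_compose[OF isCont_imp_filterlim_nhds[OF assms] filterlim_snd])

lemma near_conv_compose:
  assumes "near_conv G f (\<tau> x)" "isCont \<tau> x"
  shows "near_conv (\<lambda>\<epsilon> y. G \<epsilon> (\<tau> y)) (\<lambda>y. f (\<tau> y)) x"
proof -
  have "filterlim (\<lambda>p. (fst p, \<tau> (snd p))) (at_right (0::real) \<times>\<^sub>F nhds (\<tau> x)) (at_right 0 \<times>\<^sub>F nhds x)"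
  proof (rule filterlim_Pair)
    show "filterlim fst (at_right 0) (at_right (0::real) \<times>\<^sub>F nhds x)" by (rule filterlim_fst)
    from isCont_imp_filterlim_nhds[OF assms(2)] show "filterlim (\<lambda>p. \<tau> (snd p)) (nhds (\<tau> x)) (at_right (0::real) \<times>\<^sub>F nhds x)"
      by (rule filterlim_compose) (rule filterlim_snd)
  qed
  from filterlim_compose[OF assms(1)[unfolded near_conv_def split_beta] this] show ?thesis
    unfolding near_conv_def split_beta by simp
qed

lemma near_bddI: "open U \<Longrightarrow> x \<in> U \<Longrightarrow> (\<And>\<epsilon> y. 0 < \<epsilon> \<Longrightarrow> y \<in> U \<Longrightarrow> \<bar>G \<epsilon> y\<bar> \<le> C) \<Longrightarrow> near_bdd G x"
  unfolding near_bdd_def by (intro exI[of _ C] exI[of _ U]) simp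

lemma near_bddE:
  assumes "near_bdd G x"
  obtains C U where "open U" "x \<in> U" "\<forall>\<epsilon>>0. \<forall>y\<in>U. \<bar>G \<epsilon> y\<bar> \<le> C"
  using assms unfolding near_bdd_def by meson

lemma near_bdd_add:
  assumes "near_bdd G x" "near_bdd H x"
  shows "near_bdd (\<lambda>\<epsilon> y. G \<epsilon> y + H \<epsilon> y) x"
proof -
  obtain C U where U: "open U" "x \<in> U" "\<forall>\<epsilon>>0. \<forall>y\<in>U. \<bar>G \<epsilon> y\<bar> \<le> C" using assms(1) by (rule near_bddE)
  obtain D V where V: "open V" "x \<in> V" "\<forall>\<epsilon>>0. \<forall>y\<in>V. \<bar>H \<epsilon> y\<bar> \<le> D" using assms(2) by (rule near_bddE)
  show ?thesis
    by (rule near_bddI[of "U \<inter> V" _ _ "C + D"])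
      (use U V in \<open>auto intro!: order_trans[OF abs_triangle_ineq] add_mono\<close>)
qed

lemma near_bdd_mult:
  assumes "near_bdd G x" "near_bdd H x"
  shows "near_bdd (\<lambda>\<epsilon> y. G \<epsilon> y * H \<epsilon> y) x"
proof -
  obtain C U where U: "open U" "x \<in> U" "\<forall>\<epsilon>>0. \<forall>y\<in>U. \<bar>G \<epsilon> y\<bar> \<le> C" using assms(1) by (rule near_bddE)
  obtain D V where V: "open V" "x \<in> V" "\<forall>\<epsilon>>0. \<forall>y\<in>V. \<bar>H \<epsilon> y\<bar> \<le> D" using assms(2) by (rule near_bddE)
  show ?thesis
  proof (rule near_bddI[of "U \<inter> V" _ _ "C * D"])
    fix \<epsilon> :: real and y assume "0 < \<epsilon>" "y \<in> U \<inter> V"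
    then have "\<bar>G \<epsilon> y\<bar> \<le> C" "\<bar>H \<epsilon> y\<bar> \<le> D" using U V by auto
    then show "\<bar>G \<epsilon> y * H \<epsilon> y\<bar> \<le> C * D" unfolding abs_mult by (intro mult_mono) auto
  qed (use U V in auto)
qed

lemma near_bdd_fixed:
  assumes "isCont a x"
  shows "near_bdd (\<lambda>\<epsilon>. a) x"
proof -
  have "\<forall>\<^sub>F y in nhds x. dist (a y) (a x) < 1"
    by (rule tendstoD[OF isCont_imp_filterlim_nhds[OF assms]]) simp
  then obtain U where U: "open U" "x \<in> U" "\<forall>y\<in>U. dist (a y) (a x) < 1"
    unfolding eventually_nhds by blast
  show ?thesis
    by (rule near_bddI[of U _ _ "\<bar>a x\<bar> + 1"]) (use U in \<open>auto simp: dist_real_def\<close>)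
qed

lemma near_bdd_compose:
  assumes "near_bdd G (\<tau> x)" "isCont \<tau> x"
  shows "near_bdd (\<lambda>\<epsilon> y. G \<epsilon> (\<tau> y)) x"
proof -
  obtain C U where U: "open U" "\<tau> x \<in> U" "\<forall>\<epsilon>>0. \<forall>y\<in>U. \<bar>G \<epsilon> y\<bar> \<le> C" using assms(1) by (rule near_bddE)
  have "\<forall>\<^sub>F y in nhds x. \<tau> y \<in> U"
    by (rule topological_tendstoD[OF isCont_imp_filterlim_nhds[OF assms(2)] U(1,2)])
  then obtain V where V: "open V" "x \<in> V" "\<forall>y\<in>V. \<tau> y \<in> U"
    unfolding eventually_nhds by blast
  show ?thesis by (rule near_bddI[of V _ _ C]) (use U V in auto)
qed

lemma near_smoothE:
  assumes "near_smooth G x"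
  obtains U where "open U" "x \<in> U" "\<forall>\<epsilon>>0. smooth_on U (G \<epsilon>)"
  using assms unfolding near_smooth_def by meson

lemma near_smooth_cong:
  assumes "near_smooth G x" "open U" "x \<in> U" "\<And>\<epsilon> y. 0 < \<epsilon> \<Longrightarrow> y \<in> U \<Longrightarrow> G \<epsilon> y = H \<epsilon> y"
  shows "near_smooth H x"
proof -
  obtain V where V: "open V" "x \<in> V" "\<forall>\<epsilon>>0. smooth_on V (G \<epsilon>)" using assms(1) by (rule near_smoothE)
  have "smooth_on (U \<inter> V) (H \<epsilon>)" if "0 < \<epsilon>" for \<epsilon>
  proof (subst smooth_on_cong[symmetric])
    show "smooth_on (U \<inter> V) (G \<epsilon>)" using V that by (blast intro: smooth_on_subset)
  qed (use assms V that in auto)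
  then show ?thesis using assms V unfolding near_smooth_def by (intro exI[of _ "U \<inter> V"]) auto
qed

lemma near_smooth_partial:
  assumes "near_smooth G x" "v \<in> Basis"
  shows "near_smooth (\<lambda>\<epsilon>. partial_deriv v (G \<epsilon>)) x"
  using near_smoothE[OF assms(1)] smooth_on_partial[OF _ assms(2)] unfolding near_smooth_def by metis

lemma near_smooth_add:
  assumes "near_smooth G x" "near_smooth H x"
  shows "near_smooth (\<lambda>\<epsilon> y. G \<epsilon> y + H \<epsilon> y) x"
proof -
  obtain U where U: "open U" "x \<in> U" "\<forall>\<epsilon>>0. smooth_on U (G \<epsilon>)" using assms(1) by (rule near_smoothE)
  obtain V where V: "open V" "x \<in> V" "\<forall>\<epsilon>>0. smooth_on V (H \<epsilon>)" using assms(2) by (rule near_smoothE)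
  have "smooth_on (U \<inter> V) (\<lambda>y. G \<epsilon> y + H \<epsilon> y)" if "0 < \<epsilon>" for \<epsilon>
    using U V that by (intro smooth_on_add) (auto intro: smooth_on_subset)
  then show ?thesis using U V unfolding near_smooth_def by (intro exI[of _ "U \<inter> V"]) auto
qed

lemma near_smooth_mult:
  assumes "near_smooth G x" "near_smooth H x"
  shows "near_smooth (\<lambda>\<epsilon> y. G \<epsilon> y * H \<epsilon> y) x"
proof -
  obtain U where U: "open U" "x \<in> U" "\<forall>\<epsilon>>0. smooth_on U (G \<epsilon>)" using assms(1) by (rule near_smoothE)
  obtain V where V: "open V" "x \<in> V" "\<forall>\<epsilon>>0. smooth_on V (H \<epsilon>)" using assms(2) by (rule near_smoothE)
  have "smooth_on (U \<inter> V) (\<lambda>y. G \<epsilon> y * H \<epsilon> y)" if "0 < \<epsilon>" for \<epsilon>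
    using U V that by (intro smooth_on_mult) (auto intro: smooth_on_subset)
  then show ?thesis using U V unfolding near_smooth_def by (intro exI[of _ "U \<inter> V"]) auto
qed

lemma near_smooth_fixed: "open U \<Longrightarrow> x \<in> U \<Longrightarrow> smooth_on U a \<Longrightarrow> near_smooth (\<lambda>\<epsilon>. a) x"
  unfolding near_smooth_def by blast

lemma near_smooth_sum:
  assumes "\<And>i. i \<in> I \<Longrightarrow> near_smooth (G i) x"
  shows "near_smooth (\<lambda>\<epsilon> y. \<Sum>i\<in>I. G i \<epsilon> y) x"
  using assms
  by (induction I rule: infinite_finite_induct)
    (auto intro: near_smooth_fixed[OF open_UNIV UNIV_I smooth_on_const] near_smooth_add)

lemma near_smooth_compose:
  assumes "near_smooth G (\<tau> x)" "open S" "x \<in> S" "smooth_on S \<tau>"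
  shows "near_smooth (\<lambda>\<epsilon> y. G \<epsilon> (\<tau> y)) x"
proof -
  obtain U where U: "open U" "\<tau> x \<in> U" "\<forall>\<epsilon>>0. smooth_on U (G \<epsilon>)" using assms(1) by (rule near_smoothE)
  have o: "open (S \<inter> \<tau> -` U)"
    using continuous_open_preimage[OF smooth_on_continuous[OF assms(4)] assms(2) U(1)] .
  have "smooth_on (S \<inter> \<tau> -` U) (\<lambda>y. G \<epsilon> (\<tau> y))" if "0 < \<epsilon>" for \<epsilon>
    using U that by (intro smooth_on_compose[OF o U(1)] smooth_on_subset[OF assms(4)]) auto
  then show ?thesis using U o assms(3) unfolding near_smooth_def by (intro exI[of _ "S \<inter> \<tau> -` U"]) auto
qed

lemma near_bdd_C_cong:
  assumes "open U" "x \<in> U" "\<And>\<epsilon> y. 0 < \<epsilon> \<Longrightarrow> y \<in> U \<Longrightarrow> G \<epsilon> y = H \<epsilon> y"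
  shows "near_bdd_C k G x \<longleftrightarrow> near_bdd_C k H x"
  using assms(3)
proof (induction k arbitrary: G H)
  case 0
  show ?case unfolding near_bdd_C.simps by (rule near_bdd_cong[OF assms(1,2)]) (rule 0)
next
  case (Suc k)
  have "near_bdd_C k (\<lambda>\<epsilon>. partial_deriv v (G \<epsilon>)) x = near_bdd_C k (\<lambda>\<epsilon>. partial_deriv v (H \<epsilon>)) x" for v
  proof (rule Suc.IH)
    fix \<epsilon> :: real and y assume "0 < \<epsilon>" "y \<in> U"
    then show "partial_deriv v (G \<epsilon>) y = partial_deriv v (H \<epsilon>) y"
      by (intro partial_deriv_cong[OF assms(1)] Suc.prems)
  qed
  moreover have "near_bdd G x \<longleftrightarrow> near_bdd H x" by (rule near_bdd_cong[OF assms(1,2)]) (rule Suc.prems)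
  ultimately show ?case unfolding near_bdd_C.simps by simp
qed

lemma near_bdd_C_Suc: "near_bdd_C (Suc k) G x \<Longrightarrow> near_bdd_C k G x"
proof (induction k arbitrary: G)
  case (Suc k)
  then show ?case by (simp only: near_bdd_C.simps) blast
qed simp

lemma partial_deriv_add:
  assumes "f differentiable (at x)" "g differentiable (at x)"
  shows "partial_deriv v (\<lambda>y. f y + g y) x = partial_deriv v f x + partial_deriv v g x"
  using has_derivative_add[OF assms[THEN partial_deriv_has_derivative]] by (rule partial_deriv_eqI)

lemma partial_deriv_mult:
  fixes f g :: "'e::euclidean_space \<Rightarrow> real"
  assumes "f differentiable (at x)" "g differentiable (at x)"
  shows "partial_deriv v (\<lambda>y. f y * g y) x = f x * partial_deriv v g x + partial_deriv v f x * g x"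
  using has_derivative_mult[OF assms[THEN partial_deriv_has_derivative]] by (rule partial_deriv_eqI)

lemma near_bdd_C_add:
  assumes "near_smooth G x" "near_smooth H x" "near_bdd_C k G x" "near_bdd_C k H x"
  shows "near_bdd_C k (\<lambda>\<epsilon> y. G \<epsilon> y + H \<epsilon> y) x"
  using assms
proof (induction k arbitrary: G H)
  case (Suc k)
  obtain U where U: "open U" "x \<in> U" "\<forall>\<epsilon>>0. smooth_on U (G \<epsilon>)" using Suc.prems(1) by (rule near_smoothE)
  obtain V where V: "open V" "x \<in> V" "\<forall>\<epsilon>>0. smooth_on V (H \<epsilon>)" using Suc.prems(2) by (rule near_smoothE)
  have "near_bdd_C k (\<lambda>\<epsilon>. partial_deriv v (\<lambda>y. G \<epsilon> y + H \<epsilon> y)) x" if v: "v \<in> Basis" for v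
  proof (subst near_bdd_C_cong[of "U \<inter> V"])
    show "near_bdd_C k (\<lambda>\<epsilon> y. partial_deriv v (G \<epsilon>) y + partial_deriv v (H \<epsilon>) y) x"
      using Suc.prems v by (intro Suc.IH near_smooth_partial) auto
    show "partial_deriv v (\<lambda>y. G \<epsilon> y + H \<epsilon> y) y = partial_deriv v (G \<epsilon>) y + partial_deriv v (H \<epsilon>) y"
      if "0 < \<epsilon>" "y \<in> U \<inter> V" for \<epsilon> y
      using U V that by (intro partial_deriv_add) (auto intro: smooth_on_differentiable)
  qed (use U V in auto)
  then show ?case using Suc.prems near_bdd_add by auto
qed (simp add: near_bdd_add)

lemma near_bdd_C_mult:
  assumes "near_smooth G x" "near_smooth H x" "near_bdd_C k G x" "near_bdd_C k H x"
  shows "near_bdd_C k (\<lambda>\<epsilon> y. G \<epsilon> y * H \<epsilon> y) x"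
  using assms
proof (induction k arbitrary: G H)
  case (Suc k)
  obtain U where U: "open U" "x \<in> U" "\<forall>\<epsilon>>0. smooth_on U (G \<epsilon>)" using Suc.prems(1) by (rule near_smoothE)
  obtain V where V: "open V" "x \<in> V" "\<forall>\<epsilon>>0. smooth_on V (H \<epsilon>)" using Suc.prems(2) by (rule near_smoothE)
  have "near_bdd_C k (\<lambda>\<epsilon>. partial_deriv v (\<lambda>y. G \<epsilon> y * H \<epsilon> y)) x" if v: "v \<in> Basis" for v
  proof (subst near_bdd_C_cong[of "U \<inter> V"])
    show "near_bdd_C k (\<lambda>\<epsilon> y. G \<epsilon> y * partial_deriv v (H \<epsilon>) y + partial_deriv v (G \<epsilon>) y * H \<epsilon> y) x"
      using Suc.prems v near_bdd_C_Suc[OF Suc.prems(3)] near_bdd_C_Suc[OF Suc.prems(4)]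
      by (intro near_bdd_C_add Suc.IH near_smooth_partial near_smooth_mult) auto
    show "partial_deriv v (\<lambda>y. G \<epsilon> y * H \<epsilon> y) y = G \<epsilon> y * partial_deriv v (H \<epsilon>) y + partial_deriv v (G \<epsilon>) y * H \<epsilon> y"
      if "0 < \<epsilon>" "y \<in> U \<inter> V" for \<epsilon> y
      using U V that by (intro partial_deriv_mult) (auto intro: smooth_on_differentiable)
  qed (use U V in auto)
  then show ?case using Suc.prems near_bdd_mult by auto
qed (simp add: near_bdd_mult)

lemma near_bdd_C_fixed:
  assumes "open U" "x \<in> U" "smooth_on U a"
  shows "near_bdd_C k (\<lambda>\<epsilon>. a) x"
  using assms(3)
proof (induction k arbitrary: a)
  case 0
  then show ?case using assms smooth_on_continuous near_bdd_fixed continuous_on_eq_continuous_at by fastforce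
next
  case (Suc k)
  moreover have "near_bdd (\<lambda>\<epsilon>. a) x"
    using assms Suc.prems smooth_on_continuous near_bdd_fixed continuous_on_eq_continuous_at by fastforce
  ultimately show ?case using smooth_on_partial by auto
qed

lemma near_bdd_C_sum:
  assumes "\<And>i. i \<in> I \<Longrightarrow> near_smooth (G i) x" "\<And>i. i \<in> I \<Longrightarrow> near_bdd_C k (G i) x"
  shows "near_bdd_C k (\<lambda>\<epsilon> y. \<Sum>i\<in>I. G i \<epsilon> y) x"
  using assms
proof (induction I rule: infinite_finite_induct)
  case (insert i I)
  then have "near_bdd_C k (\<lambda>\<epsilon> y. G i \<epsilon> y + (\<Sum>i\<in>I. G i \<epsilon> y)) x"
    by (intro near_bdd_C_add near_smooth_sum) auto
  then show ?case using insert by simp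
qed (auto intro: near_bdd_C_fixed[OF open_UNIV UNIV_I smooth_on_const])

lemma smooth_on_partial_coord:
  "open S \<Longrightarrow> smooth_on S \<tau> \<Longrightarrow> v \<in> Basis \<Longrightarrow> smooth_on S (\<lambda>y. partial_deriv v \<tau> y \<bullet> b)"
  by (intro smooth_on_bounded_linear[OF bounded_linear_inner_left] smooth_on_partial)

lemma partial_deriv_compose:
  fixes f :: "'d::euclidean_space \<Rightarrow> real" and g :: "'e::euclidean_space \<Rightarrow> 'd"
  assumes "f differentiable (at (g x))" "g differentiable (at x)"
  shows "partial_deriv v (\<lambda>x. f (g x)) x = (\<Sum>b\<in>Basis. (partial_deriv v g x \<bullet> b) * partial_deriv b f (g x))"
  using has_derivative_compose_partial[OF assms] by (rule partial_deriv_eqI)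

text \<open>One neighbourhood works for all \<open>v\<close> and all \<open>\<epsilon>\<close>, as
  the congruence rules for families require.\<close>

lemma near_partial_compose:
  fixes \<tau> :: "'e::euclidean_space \<Rightarrow> 'd::euclidean_space"
  assumes "near_smooth G (\<tau> x)" "open S" "x \<in> S" "smooth_on S \<tau>"
  obtains U where "open U" "x \<in> U" "\<And>v \<epsilon> y. 0 < \<epsilon> \<Longrightarrow> y \<in> U \<Longrightarrow>
    partial_deriv v (\<lambda>y. G \<epsilon> (\<tau> y)) y = (\<Sum>b\<in>Basis. (partial_deriv v \<tau> y \<bullet> b) * partial_deriv b (G \<epsilon>) (\<tau> y))"
proof -
  obtain U where U: "open U" "\<tau> x \<in> U" "\<forall>\<epsilon>>0. smooth_on U (G \<epsilon>)" using assms(1) by (rule near_smoothE)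
  have o: "open (S \<inter> \<tau> -` U)"
    using continuous_open_preimage[OF smooth_on_continuous[OF assms(4)] assms(2) U(1)] .
  show ?thesis
  proof (rule that[OF o])
    show "partial_deriv v (\<lambda>y. G \<epsilon> (\<tau> y)) y = (\<Sum>b\<in>Basis. (partial_deriv v \<tau> y \<bullet> b) * partial_deriv b (G \<epsilon>) (\<tau> y))"
      if "0 < \<epsilon>" "y \<in> S \<inter> \<tau> -` U" for v \<epsilon> y
      using that U assms(4) by (intro partial_deriv_compose) (auto intro: smooth_on_differentiable)
  qed (use U assms in auto)
qed

lemma near_bdd_C_compose:
  fixes \<tau> :: "'e::euclidean_space \<Rightarrow> 'd::euclidean_space"
  assumes S: "open S" "x \<in> S" "smooth_on S \<tau>" and "near_smooth G (\<tau> x)" "near_bdd_C k G (\<tau> x)"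
  shows "near_bdd_C k (\<lambda>\<epsilon> y. G \<epsilon> (\<tau> y)) x"
  using assms(4,5)
proof (induction k arbitrary: G)
  case 0
  have c: "isCont \<tau> x" using S smooth_on_continuous continuous_on_eq_continuous_at by blast
  show ?case using 0 near_bdd_compose[OF _ c] by simp
next
  case (Suc k)
  have c: "isCont \<tau> x" using S smooth_on_continuous continuous_on_eq_continuous_at by blast
  obtain U where U: "open U" "x \<in> U" "\<And>v \<epsilon> y. 0 < \<epsilon> \<Longrightarrow> y \<in> U \<Longrightarrow>
    partial_deriv v (\<lambda>y. G \<epsilon> (\<tau> y)) y = (\<Sum>b\<in>Basis. (partial_deriv v \<tau> y \<bullet> b) * partial_deriv b (G \<epsilon>) (\<tau> y))"
    using near_partial_compose[OF Suc.prems(1) S] by blast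
  have "near_bdd_C k (\<lambda>\<epsilon>. partial_deriv v (\<lambda>y. G \<epsilon> (\<tau> y))) x" if v: "v \<in> Basis" for v
  proof (subst near_bdd_C_cong[OF U(1,2) U(3)])
    show "near_bdd_C k (\<lambda>\<epsilon> y. \<Sum>b\<in>Basis. (partial_deriv v \<tau> y \<bullet> b) * partial_deriv b (G \<epsilon>) (\<tau> y)) x"
      using Suc.prems v S
      by (intro near_bdd_C_sum near_bdd_C_mult near_smooth_mult near_smooth_fixed[of S] near_bdd_C_fixed[of S]
          smooth_on_partial_coord near_smooth_compose[of _ _ _ S] Suc.IH near_smooth_partial) auto
  qed
  then show ?case using Suc.prems near_bdd_compose[OF _ c] by auto
qed

section \<open>Closure properties of local C1 convergence\<close>

lemma C1_near_cong:
  assumes "C1_near G f x" "open U" "x \<in> U" "\<And>\<epsilon> y. 0 < \<epsilon> \<Longrightarrow> y \<in> U \<Longrightarrow> G \<epsilon> y = G' \<epsilon> y" "\<And>y. y \<in> U \<Longrightarrow> f y = f' y"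
  shows "C1_near G' f' x"
  unfolding C1_near_def
proof (intro conjI ballI)
  show "near_smooth G' x" using assms near_smooth_cong unfolding C1_near_def by blast
  obtain V where V: "open V" "x \<in> V" "Ck_on (Suc 0) V f" using assms(1) unfolding C1_near_def by blast
  have "Ck_on (Suc 0) (U \<inter> V) f'"
    using Ck_on_subset[OF V(3), of "U \<inter> V"] Ck_on_cong[of "U \<inter> V" f f' "Suc 0"] assms V by blast
  then show "\<exists>U. open U \<and> x \<in> U \<and> Ck_on (Suc 0) U f'" using V assms by (intro exI[of _ "U \<inter> V"]) auto
  have "near_conv G f x \<longleftrightarrow> near_conv G' f x" by (rule near_conv_cong[OF assms(2,3)]) (rule assms(4))
  then have "near_conv G' f x" using assms(1) unfolding C1_near_def by blast
  then show "near_conv G' f' x" using assms(3,5) by (simp add: near_conv_def)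
  have "near_bdd_C (Suc (Suc 0)) G x \<longleftrightarrow> near_bdd_C (Suc (Suc 0)) G' x" by (rule near_bdd_C_cong[OF assms(2,3)]) (rule assms(4))
  then show "near_bdd_C (Suc (Suc 0)) G' x" using assms(1) unfolding C1_near_def by blast
  fix v :: 'a assume v: "v \<in> Basis"
  have "near_conv (\<lambda>\<epsilon>. partial_deriv v (G' \<epsilon>)) (partial_deriv v f) x \<longleftrightarrow> near_conv (\<lambda>\<epsilon>. partial_deriv v (G \<epsilon>)) (partial_deriv v f) x"
  proof (rule near_conv_cong[OF assms(2,3)])
    fix \<epsilon> :: real and y assume "0 < \<epsilon>" "y \<in> U"
    then show "partial_deriv v (G' \<epsilon>) y = partial_deriv v (G \<epsilon>) y"
      by (intro partial_deriv_cong[OF assms(2)] assms(4)[symmetric])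
  qed
  then have "near_conv (\<lambda>\<epsilon>. partial_deriv v (G' \<epsilon>)) (partial_deriv v f) x" using assms(1) v unfolding C1_near_def by blast
  moreover have "partial_deriv v f x = partial_deriv v f' x" by (rule partial_deriv_cong[OF assms(2,3,5)])
  ultimately show "near_conv (\<lambda>\<epsilon>. partial_deriv v (G' \<epsilon>)) (partial_deriv v f') x" by (simp add: near_conv_def)
qed

text \<open>Only the value of the limit at \<open>x\<close> enters \<open>near_conv\<close>, so the
  derivative of the limit function has to be computed at \<open>x\<close> alone.\<close>

lemma near_conv_value: "near_conv G f x \<Longrightarrow> f x = f' x \<Longrightarrow> near_conv G f' x"
  by (simp add: near_conv_def)

lemma C1_near_add:
  assumes G: "C1_near G f x" and H: "C1_near H g x"
  shows "C1_near (\<lambda>\<epsilon> y. G \<epsilon> y + H \<epsilon> y) (\<lambda>y. f y + g y) x"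
  unfolding C1_near_def
proof (intro conjI ballI)
  have s: "near_smooth G x" "near_smooth H x" using G H by (auto simp: C1_near_def)
  show "near_smooth (\<lambda>\<epsilon> y. G \<epsilon> y + H \<epsilon> y) x" by (rule near_smooth_add[OF s])
  show "near_conv (\<lambda>\<epsilon> y. G \<epsilon> y + H \<epsilon> y) (\<lambda>y. f y + g y) x"
    using G H by (intro near_conv_add) (auto simp: C1_near_def)
  show "near_bdd_C (Suc (Suc 0)) (\<lambda>\<epsilon> y. G \<epsilon> y + H \<epsilon> y) x"
    using G H by (intro near_bdd_C_add s) (auto simp: C1_near_def)
  obtain U where U: "open U" "x \<in> U" "Ck_on (Suc 0) U f" using G unfolding C1_near_def by blast
  obtain V where V: "open V" "x \<in> V" "Ck_on (Suc 0) V g" using H unfolding C1_near_def by blast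
  have "Ck_on (Suc 0) (U \<inter> V) (\<lambda>y. f y + g y)"
    using U V by (intro Ck_on_add) (blast intro: Ck_on_subset)+
  then show "\<exists>U. open U \<and> x \<in> U \<and> Ck_on (Suc 0) U (\<lambda>y. f y + g y)" using U V by (intro exI[of _ "U \<inter> V"]) auto
  fix v :: 'a assume v: "v \<in> Basis"
  obtain U' where U': "open U'" "x \<in> U'" "\<forall>\<epsilon>>0. smooth_on U' (G \<epsilon>)" using s(1) by (rule near_smoothE)
  obtain V' where V': "open V'" "x \<in> V'" "\<forall>\<epsilon>>0. smooth_on V' (H \<epsilon>)" using s(2) by (rule near_smoothE)
  have "near_conv (\<lambda>\<epsilon>. partial_deriv v (\<lambda>y. G \<epsilon> y + H \<epsilon> y)) (\<lambda>y. partial_deriv v f y + partial_deriv v g y) x"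
  proof (subst near_conv_cong[of "U' \<inter> V'"])
    show "partial_deriv v (\<lambda>y. G \<epsilon> y + H \<epsilon> y) y = partial_deriv v (G \<epsilon>) y + partial_deriv v (H \<epsilon>) y"
      if "0 < \<epsilon>" "y \<in> U' \<inter> V'" for \<epsilon> y
      using U' V' that by (intro partial_deriv_add) (auto intro: smooth_on_differentiable)
    show "near_conv (\<lambda>\<epsilon> y. partial_deriv v (G \<epsilon>) y + partial_deriv v (H \<epsilon>) y) (\<lambda>y. partial_deriv v f y + partial_deriv v g y) x"
      using G H v by (intro near_conv_add) (auto simp: C1_near_def)
  qed (use U' V' in auto)
  then show "near_conv (\<lambda>\<epsilon>. partial_deriv v (\<lambda>y. G \<epsilon> y + H \<epsilon> y)) (partial_deriv v (\<lambda>y. f y + g y)) x"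
    by (rule near_conv_value) (rule partial_deriv_add[symmetric], use U V in auto)
qed

lemma C1_near_mult:
  assumes G: "C1_near G f x" and H: "C1_near H g x"
  shows "C1_near (\<lambda>\<epsilon> y. G \<epsilon> y * H \<epsilon> y) (\<lambda>y. f y * g y) x"
  unfolding C1_near_def
proof (intro conjI ballI)
  have s: "near_smooth G x" "near_smooth H x" using G H by (auto simp: C1_near_def)
  show "near_smooth (\<lambda>\<epsilon> y. G \<epsilon> y * H \<epsilon> y) x" by (rule near_smooth_mult[OF s])
  show "near_conv (\<lambda>\<epsilon> y. G \<epsilon> y * H \<epsilon> y) (\<lambda>y. f y * g y) x"
    using G H by (intro near_conv_mult) (auto simp: C1_near_def)
  show "near_bdd_C (Suc (Suc 0)) (\<lambda>\<epsilon> y. G \<epsilon> y * H \<epsilon> y) x"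
    using G H by (intro near_bdd_C_mult s) (auto simp: C1_near_def)
  obtain U where U: "open U" "x \<in> U" "Ck_on (Suc 0) U f" using G unfolding C1_near_def by blast
  obtain V where V: "open V" "x \<in> V" "Ck_on (Suc 0) V g" using H unfolding C1_near_def by blast
  have "Ck_on (Suc 0) (U \<inter> V) (\<lambda>y. f y * g y)"
    using U V by (intro Ck_on_mult) (blast intro: Ck_on_subset)+
  then show "\<exists>U. open U \<and> x \<in> U \<and> Ck_on (Suc 0) U (\<lambda>y. f y * g y)" using U V by (intro exI[of _ "U \<inter> V"]) auto
  fix v :: 'a assume v: "v \<in> Basis"
  obtain U' where U': "open U'" "x \<in> U'" "\<forall>\<epsilon>>0. smooth_on U' (G \<epsilon>)" using s(1) by (rule near_smoothE)
  obtain V' where V': "open V'" "x \<in> V'" "\<forall>\<epsilon>>0. smooth_on V' (H \<epsilon>)" using s(2) by (rule near_smoothE)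
  have "near_conv (\<lambda>\<epsilon>. partial_deriv v (\<lambda>y. G \<epsilon> y * H \<epsilon> y)) (\<lambda>y. f y * partial_deriv v g y + partial_deriv v f y * g y) x"
  proof (subst near_conv_cong[of "U' \<inter> V'"])
    show "partial_deriv v (\<lambda>y. G \<epsilon> y * H \<epsilon> y) y = G \<epsilon> y * partial_deriv v (H \<epsilon>) y + partial_deriv v (G \<epsilon>) y * H \<epsilon> y"
      if "0 < \<epsilon>" "y \<in> U' \<inter> V'" for \<epsilon> y
      using U' V' that by (intro partial_deriv_mult) (auto intro: smooth_on_differentiable)
    show "near_conv (\<lambda>\<epsilon> y. G \<epsilon> y * partial_deriv v (H \<epsilon>) y + partial_deriv v (G \<epsilon>) y * H \<epsilon> y) (\<lambda>y. f y * partial_deriv v g y + partial_deriv v f y * g y) x"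
      using G H v by (intro near_conv_add near_conv_mult) (auto simp: C1_near_def)
  qed (use U' V' in auto)
  then show "near_conv (\<lambda>\<epsilon>. partial_deriv v (\<lambda>y. G \<epsilon> y * H \<epsilon> y)) (partial_deriv v (\<lambda>y. f y * g y)) x"
    by (rule near_conv_value) (rule partial_deriv_mult[symmetric], use U V in auto)
qed

lemma C1_near_fixed:
  assumes "open U" "x \<in> U" "smooth_on U a"
  shows "C1_near (\<lambda>\<epsilon>. a) a x"
proof -
  have c: "isCont b x" if "smooth_on U b" for b :: "'a \<Rightarrow> real"
    using assms smooth_on_continuous[OF that] continuous_on_eq_continuous_at by blast
  show ?thesis
    unfolding C1_near_def
  proof (intro conjI ballI)
    show "\<exists>U. open U \<and> x \<in> U \<and> Ck_on (Suc 0) U a" using assms unfolding smooth_on_def by blast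
    show "near_smooth (\<lambda>\<epsilon>. a) x" "near_bdd_C (Suc (Suc 0)) (\<lambda>\<epsilon>. a) x"
      by (rule near_smooth_fixed near_bdd_C_fixed, fact+)+
    show "near_conv (\<lambda>\<epsilon>. a) a x" by (rule near_conv_fixed[OF c[OF assms(3)]])
    show "near_conv (\<lambda>\<epsilon>. partial_deriv v a) (partial_deriv v a) x" if "v \<in> Basis" for v
      by (rule near_conv_fixed[OF c[OF smooth_on_partial[OF assms(3) that]]])
  qed
qed

lemma C1_near_sum:
  assumes "\<And>i. i \<in> I \<Longrightarrow> C1_near (G i) (f i) x"
  shows "C1_near (\<lambda>\<epsilon> y. \<Sum>i\<in>I. G i \<epsilon> y) (\<lambda>y. \<Sum>i\<in>I. f i y) x"
  using assms
  by (induction I rule: infinite_finite_induct)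
    (auto intro: C1_near_fixed[OF open_UNIV UNIV_I smooth_on_const] C1_near_add)

text \<open>This carries the estimates from the chart of a ball, where the mollification was done,
  to an arbitrary chart.\<close>

lemma C1_near_compose:
  fixes \<tau> :: "'e::euclidean_space \<Rightarrow> 'd::euclidean_space"
  assumes S: "open S" "x \<in> S" "smooth_on S \<tau>" and G: "C1_near G f (\<tau> x)"
  shows "C1_near (\<lambda>\<epsilon> y. G \<epsilon> (\<tau> y)) (\<lambda>y. f (\<tau> y)) x"
  unfolding C1_near_def
proof (intro conjI ballI)
  have c: "isCont b x" if "smooth_on S b" for b :: "'e \<Rightarrow> 'z::euclidean_space"
    using S smooth_on_continuous[OF that] continuous_on_eq_continuous_at by blast
  have s: "near_smooth G (\<tau> x)" using G by (simp add: C1_near_def)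
  show "near_smooth (\<lambda>\<epsilon> y. G \<epsilon> (\<tau> y)) x" by (rule near_smooth_compose[OF s S])
  show "near_conv (\<lambda>\<epsilon> y. G \<epsilon> (\<tau> y)) (\<lambda>y. f (\<tau> y)) x"
    using G by (intro near_conv_compose[OF _ c[OF S(3)]]) (simp add: C1_near_def)
  show "near_bdd_C (Suc (Suc 0)) (\<lambda>\<epsilon> y. G \<epsilon> (\<tau> y)) x"
    using G by (intro near_bdd_C_compose[OF S] s) (simp add: C1_near_def)
  obtain U where U: "open U" "\<tau> x \<in> U" "Ck_on (Suc 0) U f" using G unfolding C1_near_def by blast
  have o: "open (S \<inter> \<tau> -` U)"
    using continuous_open_preimage[OF smooth_on_continuous[OF S(3)] S(1) U(1)] .
  have "Ck_on (Suc 0) (S \<inter> \<tau> -` U) \<tau>"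
    using S(3) unfolding smooth_on_def by (blast intro: Ck_on_subset)
  then have "Ck_on (Suc 0) (S \<inter> \<tau> -` U) (\<lambda>y. f (\<tau> y))"
    using U by (intro Ck_on_compose[OF o U(1)]) auto
  then show "\<exists>U. open U \<and> x \<in> U \<and> Ck_on (Suc 0) U (\<lambda>y. f (\<tau> y))" using U S o by (intro exI[of _ "S \<inter> \<tau> -` U"]) auto
  fix v :: 'e assume v: "v \<in> Basis"
  obtain V where V: "open V" "x \<in> V" "\<And>v \<epsilon> y. 0 < \<epsilon> \<Longrightarrow> y \<in> V \<Longrightarrow>
    partial_deriv v (\<lambda>y. G \<epsilon> (\<tau> y)) y = (\<Sum>b\<in>Basis. (partial_deriv v \<tau> y \<bullet> b) * partial_deriv b (G \<epsilon>) (\<tau> y))"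
    using near_partial_compose[OF s S] by blast
  have "near_conv (\<lambda>\<epsilon>. partial_deriv v (\<lambda>y. G \<epsilon> (\<tau> y))) (\<lambda>y. \<Sum>b\<in>Basis. (partial_deriv v \<tau> y \<bullet> b) * partial_deriv b f (\<tau> y)) x"
  proof (subst near_conv_cong[OF V(1,2) V(3)])
    show "near_conv (\<lambda>\<epsilon> y. \<Sum>b\<in>Basis. (partial_deriv v \<tau> y \<bullet> b) * partial_deriv b (G \<epsilon>) (\<tau> y))
      (\<lambda>y. \<Sum>b\<in>Basis. (partial_deriv v \<tau> y \<bullet> b) * partial_deriv b f (\<tau> y)) x"
    proof (rule near_conv_sum, rule near_conv_mult)
      fix b :: 'd assume b: "b \<in> Basis"
      show "near_conv (\<lambda>\<epsilon> y. partial_deriv v \<tau> y \<bullet> b) (\<lambda>y. partial_deriv v \<tau> y \<bullet> b) x"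
        by (rule near_conv_fixed[OF c[OF smooth_on_partial_coord[OF S(1,3) v]]])
      show "near_conv (\<lambda>\<epsilon> y. partial_deriv b (G \<epsilon>) (\<tau> y)) (\<lambda>y. partial_deriv b f (\<tau> y)) x"
        by (rule near_conv_compose[OF _ c[OF S(3)]]) (use G b in \<open>simp add: C1_near_def\<close>)
    qed
  qed
  then show "near_conv (\<lambda>\<epsilon>. partial_deriv v (\<lambda>y. G \<epsilon> (\<tau> y))) (partial_deriv v (\<lambda>y. f (\<tau> y))) x"
    by (rule near_conv_value)
      (rule partial_deriv_compose[symmetric], use U S in \<open>auto intro: smooth_on_differentiable\<close>)
qed

text \<open>Each point has a neighbourhood and a range of parameters with the estimate, where
  continuity of \<open>f\<close> replaces \<open>f x\<close> by \<open>f y\<close>; finitely many of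
  these neighbourhoods cover \<open>K\<close>.\<close>

lemma uniform_limit_compact_near_conv:
  assumes K: "compact K" and G: "\<And>x. x \<in> K \<Longrightarrow> near_conv G f x" and f: "continuous_on K f"
  shows "uniform_limit K G f (at_right 0)"
proof (rule uniform_limitI)
  fix e :: real assume e: "0 < e"
  have "\<exists>U b. open U \<and> x \<in> U \<and> 0 < b \<and> (\<forall>\<epsilon> y. 0 < \<epsilon> \<longrightarrow> \<epsilon> < b \<longrightarrow> y \<in> U \<inter> K \<longrightarrow> dist (G \<epsilon> y) (f y) < e)" if x: "x \<in> K" for x
  proof -
    have "\<forall>\<^sub>F p in at_right 0 \<times>\<^sub>F nhds x. dist (case p of (\<epsilon>, y) \<Rightarrow> G \<epsilon> y) (f x) < e / 2"
      using G[OF x] e unfolding near_conv_def by (intro tendstoD) auto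
    then obtain P Q where P: "\<forall>\<^sub>F \<epsilon> in at_right 0. P \<epsilon>" and Q: "\<forall>\<^sub>F y in nhds x. Q y"
      and PQ: "\<And>\<epsilon> y. P \<epsilon> \<Longrightarrow> Q y \<Longrightarrow> dist (G \<epsilon> y) (f x) < e / 2"
      unfolding eventually_prod_filter by auto
    obtain b where b: "0 < b" "\<And>\<epsilon>. 0 < \<epsilon> \<Longrightarrow> \<epsilon> < b \<Longrightarrow> P \<epsilon>"
      using P unfolding eventually_at_right_field by blast
    obtain V where V: "open V" "x \<in> V" "\<And>y. y \<in> V \<Longrightarrow> Q y" using Q unfolding eventually_nhds by blast
    obtain W where W: "open W" "x \<in> W" "\<And>y. y \<in> W \<inter> K \<Longrightarrow> dist (f y) (f x) < e / 2"
      using f[unfolded continuous_on_topological, rule_format, OF x, of "ball (f x) (e / 2)"] e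
      by (auto simp: dist_commute)
    have "dist (G \<epsilon> y) (f y) < e" if "0 < \<epsilon>" "\<epsilon> < b" "y \<in> (V \<inter> W) \<inter> K" for \<epsilon> y
      using PQ[OF b(2)[OF that(1,2)] V(3), of y] W(3)[of y] that(3) dist_triangle_half_r[of "f x" "G \<epsilon> y" e "f y"]
      by (auto simp: dist_commute)
    then show ?thesis using b(1) V W by (intro exI[of _ "V \<inter> W"] exI[of _ b]) auto
  qed
  then obtain U b where U: "\<And>x. x \<in> K \<Longrightarrow> open (U x)" "\<And>x. x \<in> K \<Longrightarrow> x \<in> U x" "\<And>x. x \<in> K \<Longrightarrow> 0 < b x"
    and Ub: "\<And>x \<epsilon> y. x \<in> K \<Longrightarrow> 0 < \<epsilon> \<Longrightarrow> \<epsilon> < b x \<Longrightarrow> y \<in> U x \<inter> K \<Longrightarrow> dist (G \<epsilon> y) (f y) < e"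
    by metis
  obtain D where D: "D \<subseteq> K" "finite D" "K \<subseteq> (\<Union>x\<in>D. U x)"
    using compactE_image[OF K, of K U] U by blast
  have "\<forall>\<^sub>F \<epsilon> in at_right 0. 0 < \<epsilon> \<and> (\<forall>x\<in>D. \<epsilon> < b x)"
  proof (intro eventually_conj)
    show "\<forall>\<^sub>F \<epsilon> in at_right (0::real). 0 < \<epsilon>" by (simp add: eventually_at_filter)
    show "\<forall>\<^sub>F \<epsilon> in at_right 0. \<forall>x\<in>D. \<epsilon> < b x"
      using D U(3) by (intro eventually_ball_finite) (auto simp: eventually_at_right_field)
  qed
  then show "\<forall>\<^sub>F \<epsilon> in at_right 0. \<forall>x\<in>K. dist (G \<epsilon> x) (f x) < e"
    by eventually_elim (use D Ub in blast)
qed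

lemma compact_near_bdd:
  assumes K: "compact K" and G: "\<And>x. x \<in> K \<Longrightarrow> near_bdd G x"
  shows "\<exists>C. \<forall>\<epsilon>>0. \<forall>x\<in>K. \<bar>G \<epsilon> x\<bar> \<le> C"
proof -
  have "\<exists>U C. open U \<and> x \<in> U \<and> (\<forall>\<epsilon>>0. \<forall>y\<in>U. \<bar>G \<epsilon> y\<bar> \<le> C)" if "x \<in> K" for x
    using G[OF that] unfolding near_bdd_def by blast
  then obtain U C where U: "\<And>x. x \<in> K \<Longrightarrow> open (U x)" "\<And>x. x \<in> K \<Longrightarrow> x \<in> U x"
    and C: "\<And>x. x \<in> K \<Longrightarrow> \<forall>\<epsilon>>0. \<forall>y\<in>U x. \<bar>G \<epsilon> y\<bar> \<le> C x"
    by metis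
  obtain D where D: "D \<subseteq> K" "finite D" "K \<subseteq> (\<Union>x\<in>D. U x)"
  proof (rule compactE_image[OF K, of K U])
    show "open (U x)" if "x \<in> K" for x using U(1)[OF that] .
    show "K \<subseteq> (\<Union>x\<in>K. U x)" using U(2) by blast
  qed
  \<comment> \<open>The sum over the subcover stands in for a maximum and needs no separate case for
    empty \<open>D\<close>.\<close>
  have "\<bar>G \<epsilon> y\<bar> \<le> (\<Sum>x\<in>D. \<bar>C x\<bar>)" if pos: "0 < \<epsilon>" and y: "y \<in> K" for \<epsilon> y
  proof -
    obtain x where x: "x \<in> D" "y \<in> U x" using D y by blast
    then have "\<bar>G \<epsilon> y\<bar> \<le> C x" using C[of x] that D(1) by blast
    then have "\<bar>G \<epsilon> y\<bar> \<le> \<bar>C x\<bar>" by linarith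
    also have "\<dots> \<le> (\<Sum>x\<in>D. \<bar>C x\<bar>)" using x D by (intro member_le_sum) auto
    finally show ?thesis .
  qed
  then show ?thesis by blast
qed

section \<open>Stability of the Lorentzian signature\<close>

lemma symmetric_bilinear_facts:
  assumes "symmetric_bilinear b"
  shows "b (x + y) z = b x z + b y z" "b z (x + y) = b z x + b z y"
    "b (c *\<^sub>R x) z = c * b x z" "b z (c *\<^sub>R x) = c * b z x" "b x y = b y x"
    "b (x - y) z = b x z - b y z" "b z (x - y) = b z x - b z y" "b 0 z = 0" "b z 0 = 0"
    "bilinear b"
proof -
  have b: "bilinear b" and s: "\<And>v w. b v w = b w v" using assms by (auto simp: symmetric_bilinear_def)
  show "b (x + y) z = b x z + b y z" "b z (x + y) = b z x + b z y"
    "b (c *\<^sub>R x) z = c * b x z" "b z (c *\<^sub>R x) = c * b z x" "b x y = b y x"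
    "b (x - y) z = b x z - b y z" "b z (x - y) = b z x - b z y" "b 0 z = 0" "b z 0 = 0" "bilinear b"
    by (fact bilinear_ladd[OF b] bilinear_radd[OF b] bilinear_lmul[OF b, unfolded real_scaleR_def]
      bilinear_rmul[OF b, unfolded real_scaleR_def] s bilinear_lsub[OF b] bilinear_rsub[OF b]
      bilinear_lzero[OF b] bilinear_rzero[OF b] b)+
qed

text \<open>Polarization with the parallelogram law bounds \<open>E v w\<close> by
  \<open>c / 2 * (h v v + h w w)\<close>. Scaling both vectors to unit length first turns the sum
  into the product of the norms.\<close>

lemma polarization_bound:
  assumes E: "symmetric_bilinear E" and h: "positive_form h"
    and c: "\<And>v. \<bar>E v v\<bar> \<le> c * h v v"
  shows "\<bar>E v w\<bar> \<le> c * (sqrt (h v v) * sqrt (h w w))"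
proof (cases "v = 0 \<or> w = 0")
  case True
  then show ?thesis using symmetric_bilinear_facts(8,9)[OF E] symmetric_bilinear_facts(8,9)[of h] h
    by (auto simp: positive_form_def)
next
  case False
  have hs: "symmetric_bilinear h" using h by (simp add: positive_form_def)
  have pos: "h v v > 0" "h w w > 0" using False h by (auto simp: positive_form_def)
  define a where "a = inverse (sqrt (h v v))"
  define b where "b = inverse (sqrt (h w w))"
  have ab: "a > 0" "b > 0" "a * a * h v v = 1" "b * b * h w w = 1"
    using pos real_sqrt_mult_self[of "h v v"] real_sqrt_mult_self[of "h w w"]
    by (auto simp: a_def b_def field_simps)
  let ?v = "a *\<^sub>R v" and ?w = "b *\<^sub>R w"
  note fE = symmetric_bilinear_facts[OF E] and fh = symmetric_bilinear_facts[OF hs]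
  have un: "h ?v ?v = 1" "h ?w ?w = 1" using ab by (simp_all add: fh mult.assoc)
  have "4 * E ?v ?w = E (?v + ?w) (?v + ?w) - E (?v - ?w) (?v - ?w)"
    using fE(5)[of ?v ?w] by (simp add: fE(1,2,6,7))
  then have "4 * \<bar>E ?v ?w\<bar> \<le> c * h (?v + ?w) (?v + ?w) + c * h (?v - ?w) (?v - ?w)"
    using c[of "?v + ?w"] c[of "?v - ?w"] by linarith
  also have "\<dots> = c * (2 * h ?v ?v + 2 * h ?w ?w)"
    using fh(5)[of ?v ?w] by (simp add: fh(1,2,6,7) algebra_simps)
  finally have "\<bar>E ?v ?w\<bar> \<le> c" using un by simp
  then have "a * b * \<bar>E v w\<bar> \<le> c" using ab by (simp add: fE(3,4) abs_mult mult_ac)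
  then show ?thesis using pos by (simp add: a_def b_def field_simps)
qed

lemma orthogonal_sum_component:
  assumes q: "symmetric_bilinear q" and B: "finite B"
    and orth: "\<And>e f. e \<in> B \<Longrightarrow> f \<in> B \<Longrightarrow> e \<noteq> f \<Longrightarrow> q e f = 0" and f: "f \<in> B"
  shows "q (\<Sum>e\<in>B. u e *\<^sub>R e) f = u f * q f f"
proof -
  have "q (\<Sum>e\<in>B. u e *\<^sub>R e) f = (\<Sum>e\<in>B. u e * q e f)"
  proof -
    have "linear (\<lambda>x. q x f)" using symmetric_bilinear_facts(10)[OF q] by (simp add: bilinear_def)
    from linear_sum[OF this, of "\<lambda>e. u e *\<^sub>R e" B] show ?thesis
      by (simp add: symmetric_bilinear_facts(3)[OF q])
  qed
  also have "\<dots> = (\<Sum>e\<in>{f}. u e * q e f)"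
    using B f orth by (intro sum.mono_neutral_right) auto
  finally show ?thesis by simp
qed

lemma orthogonal_independent:
  assumes q: "symmetric_bilinear q" and nz: "\<And>e. e \<in> B \<Longrightarrow> q e e \<noteq> 0"
    and orth: "\<And>e f. e \<in> B \<Longrightarrow> f \<in> B \<Longrightarrow> e \<noteq> f \<Longrightarrow> q e f = 0"
  shows "independent B"
  unfolding independent_explicit_module
proof (intro allI impI)
  fix t u v assume t: "finite t" "t \<subseteq> B" "(\<Sum>v\<in>t. u v *\<^sub>R v) = 0" "v \<in> t"
  have "q (\<Sum>v\<in>t. u v *\<^sub>R v) v = u v * q v v"
    using t orth by (intro orthogonal_sum_component[OF q]) auto
  then show "u v = 0" using t nz symmetric_bilinear_facts(8)[OF q] by auto
qed

text \<open>Gram--Schmidt, in the form of a maximal orthonormal set through the given unit vector.\<close>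

lemma orthonormal_basis_extend:
  fixes q :: "'e::euclidean_space \<Rightarrow> 'e \<Rightarrow> real"
  assumes q: "positive_form q" and e0: "q e0 e0 = 1"
  obtains B where "e0 \<in> B" "independent B" "span B = UNIV" "\<And>e. e \<in> B \<Longrightarrow> q e e = 1"
    "\<And>e f. e \<in> B \<Longrightarrow> f \<in> B \<Longrightarrow> e \<noteq> f \<Longrightarrow> q e f = 0"
proof -
  have qs: "symmetric_bilinear q" using q by (simp add: positive_form_def)
  define ON where "ON B \<longleftrightarrow> e0 \<in> B \<and> (\<forall>e\<in>B. q e e = 1) \<and> (\<forall>e\<in>B. \<forall>f\<in>B. e \<noteq> f \<longrightarrow> q e f = 0)" for B
  have ind: "independent B" if "ON B" for B
    by (rule orthogonal_independent[OF qs]) (use that in \<open>auto simp: ON_def\<close>)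
  then have card: "finite B \<and> card B \<le> DIM('e)" if "ON B" for B
    using that independent_bound by blast
  have "ON {e0}" using e0 by (simp add: ON_def)
  \<comment> \<open>Independence bounds the cardinality, so an orthonormal set of greatest
    cardinality exists.\<close>
  moreover have "\<forall>C. ON C \<longrightarrow> card C < Suc DIM('e)" using card by (simp add: le_imp_less_Suc)
  ultimately obtain B where B: "ON B" "\<And>C. ON C \<Longrightarrow> card C \<le> card B"
    using ex_has_greatest_nat[of ON "{e0}" card "Suc DIM('e)"] by blast
  have fin: "finite B" using card[OF B(1)] by simp
  have "span B = UNIV"
  proof (rule ccontr)
    assume "span B \<noteq> UNIV"
    then obtain x where x: "x \<notin> span B" by blast
    define y where "y = x - (\<Sum>e\<in>B. q x e *\<^sub>R e)"
    have "y \<noteq> 0"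
    proof
      assume "y = 0"
      then have "x = (\<Sum>e\<in>B. q x e *\<^sub>R e)" by (simp add: y_def)
      also have "\<dots> \<in> span B" by (intro span_sum span_scale span_base)
      finally show False using x by blast
    qed
    then have qy: "q y y > 0" using q by (simp add: positive_form_def)
    have yB: "q y f = 0" if "f \<in> B" for f
      using orthogonal_sum_component[OF qs fin, of f "q x"] B(1) that
      by (auto simp: y_def ON_def symmetric_bilinear_facts(6)[OF qs])
    define z where "z = inverse (sqrt (q y y)) *\<^sub>R y"
    have z1: "q z z = 1"
      using qy real_sqrt_mult_self[of "q y y"] by (simp add: z_def symmetric_bilinear_facts[OF qs] field_simps)
    have zB: "q z f = 0" "q f z = 0" if "f \<in> B" for f
      using yB[OF that] symmetric_bilinear_facts(3,5)[OF qs] by (auto simp: z_def)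
    have "z \<notin> B" using z1 zB by force
    moreover have "ON (insert z B)" using B(1) z1 zB by (auto simp: ON_def)
    ultimately show False using B(2)[of "insert z B"] fin by simp
  qed
  then show ?thesis using that[of B] B(1) ind[OF B(1)] by (simp add: ON_def)
qed

text \<open>A criterion made of two strict inequalities, one vector of negative square and one
  hyperplane of positivity. Unlike a diagonalizing basis, these data can stay fixed while the form
  is perturbed.\<close>

lemma lorentz_formI:
  fixes b :: "'e::euclidean_space \<Rightarrow> 'e \<Rightarrow> real"
  assumes b: "symmetric_bilinear b" and v0: "b v0 v0 < 0" and l: "linear l"
    and pos: "\<And>w. l w = (0::real) \<Longrightarrow> w \<noteq> 0 \<Longrightarrow> b w w > 0"
  shows "lorentz_form b"
proof -
  note f = symmetric_bilinear_facts[OF b]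
  define e0 where "e0 = inverse (sqrt (- b v0 v0)) *\<^sub>R v0"
  have e0: "b e0 e0 = -1"
    using v0 real_sqrt_mult_self[of "- b v0 v0"] by (simp add: e0_def f(3,4) field_simps)
  have perp: "b w w > 0" if w: "b e0 w = 0" "w \<noteq> 0" for w
  proof (rule ccontr)
    assume n: "\<not> b w w > 0"
    \<comment> \<open>If \<open>b w w \<le> 0\<close>, then \<open>b\<close> is nonpositive on the
      plane spanned by \<open>e0\<close> and \<open>w\<close>, and this combination lies both in the
      plane and in the kernel of \<open>l\<close>.\<close>
    let ?u = "l e0 *\<^sub>R w - l w *\<^sub>R e0"
    have lu: "l ?u = 0" by (simp add: linear_diff[OF l] linear_cmul[OF l] mult.commute)
    have "b ?u ?u = l e0 * l e0 * b w w - l w * l w"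
      using w f(5)[of w e0] e0 by (simp add: f(3,4,6,7))
    also have "\<dots> \<le> 0"
    proof -
      have "l e0 * l e0 * b w w \<le> 0" using n by (intro mult_nonneg_nonpos) auto
      then show ?thesis using zero_le_square[of "l w"] by linarith
    qed
    finally have "?u = 0" using pos[OF lu] by force
    then have "b e0 ?u = 0" by (simp add: f(9))
    then have "l w = 0" using w e0 by (simp add: f(4,7))
    then show False using pos[of w] w n by simp
  qed
  \<comment> \<open>Reversing the sign of \<open>b\<close> in the direction \<open>e0\<close> yields
    a positive form. A \<open>q\<close>-orthonormal basis through \<open>e0\<close> then
    diagonalizes \<open>b\<close>.\<close>
  let ?q = "\<lambda>v w. b v w + 2 * (b e0 v * b e0 w)"
  have "bilinear ?q"
    unfolding bilinear_def by (auto intro!: linearI simp: f(1-4) algebra_simps)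
  moreover have "?q v v > 0" if "v \<noteq> 0" for v
  proof -
    \<comment> \<open>The component of \<open>v\<close> that is \<open>b\<close>-orthogonal to
      \<open>e0\<close>; the plus sign comes from \<open>b e0 e0 = -1\<close>.\<close>
    let ?w = "v + b e0 v *\<^sub>R e0"
    have "b e0 ?w = 0" using e0 by (simp add: f(2,4))
    moreover have "?q v v = b ?w ?w + b e0 v * b e0 v"
      using e0 f(5)[of v e0] by (simp add: f(1-4) algebra_simps)
    moreover have "b e0 v \<noteq> 0" if "?w = 0"
      using that \<open>v \<noteq> 0\<close> by auto
    moreover have "0 < b e0 v * b e0 v" if "b e0 v \<noteq> 0"
      using that by (metis not_real_square_gt_zero)
    moreover have "b ?w ?w = 0" if "?w = 0" using f(8) that by simp
    ultimately show ?thesis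
      using perp[of ?w] zero_le_square[of "b e0 v"] by (cases "?w = 0") linarith+
  qed
  ultimately have q: "positive_form ?q"
    by (auto simp: positive_form_def symmetric_bilinear_def f(5) mult.commute)
  obtain B where B: "e0 \<in> B" "independent B" "span B = UNIV" "\<And>e. e \<in> B \<Longrightarrow> ?q e e = 1"
    "\<And>e f. e \<in> B \<Longrightarrow> f \<in> B \<Longrightarrow> e \<noteq> f \<Longrightarrow> ?q e f = 0"
    using orthonormal_basis_extend[OF q, of e0] e0 by auto
  have be: "b e0 e = 0" if "e \<in> B - {e0}" for e
    using B(5)[of e0 e] B(1) that e0 by auto
  show ?thesis
    unfolding lorentz_form_def
  proof (intro conjI exI ballI impI b)
    show "b e e = 1" if "e \<in> B - {e0}" for e using B(4)[of e] be[OF that] that by simp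
    show "b e f = 0" if "e \<in> B" "f \<in> B" "e \<noteq> f" for e f
      using B(5)[OF that] be[of e] be[of f] that f(5)[of e f] f(5)[of e e0]
      by (cases "e = e0"; cases "f = e0") auto
  qed (use B e0 in auto)
qed

text \<open>The converse of \<open>lorentz_formI\<close> with \<open>l = b e0\<close>: a vector
  orthogonal to the negative basis vector is a combination of the others, on which the form is a sum
  of squares.\<close>

lemma lorentz_formD:
  fixes b :: "'e::euclidean_space \<Rightarrow> 'e \<Rightarrow> real"
  assumes "lorentz_form b"
  obtains e0 where "b e0 e0 = -1" "\<And>w. b e0 w = 0 \<Longrightarrow> w \<noteq> 0 \<Longrightarrow> b w w > 0"
proof -
  have b: "symmetric_bilinear b" using assms by (simp add: lorentz_form_def)
  note f = symmetric_bilinear_facts[OF b]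
  obtain B e0 where B: "independent B" "span B = UNIV" "e0 \<in> B" "b e0 e0 = -1"
      "\<And>e. e \<in> B - {e0} \<Longrightarrow> b e e = 1" "\<And>e f. e \<in> B \<Longrightarrow> f \<in> B \<Longrightarrow> e \<noteq> f \<Longrightarrow> b e f = 0"
    using assms unfolding lorentz_form_def by metis
  have fin: "finite B" using B(1) independent_bound by blast
  have "b w w > 0" if w: "b e0 w = 0" "w \<noteq> 0" for w
  proof -
    obtain u where u: "w = (\<Sum>e\<in>B. u e *\<^sub>R e)"
      using B(2) fin span_finite[of B] by (metis (no_types, lifting) UNIV_I image_iff)
    have we: "b w e = u e * b e e" if "e \<in> B" for e
      unfolding u using B(6) by (intro orthogonal_sum_component[OF b fin _ that]) auto
    have u0: "u e0 = 0" using we[OF B(3)] w B(4) f(5)[of w e0] by simp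
    have "b w w = (\<Sum>e\<in>B. u e * b w e)"
    proof -
      have "linear (\<lambda>x. b w x)" using f(10) by (simp add: bilinear_def)
      from linear_sum[OF this, of "\<lambda>e. u e *\<^sub>R e" B] show ?thesis
        by (simp add: f(4) flip: u)
    qed
    also have "\<dots> = (\<Sum>e\<in>B. (u e)\<^sup>2)"
      using we u0 B(5) by (intro sum.cong) (auto simp: power2_eq_square)
    finally have *: "b w w = (\<Sum>e\<in>B. (u e)\<^sup>2)" .
    moreover have "(\<Sum>e\<in>B. (u e)\<^sup>2) \<noteq> 0"
    proof
      assume "(\<Sum>e\<in>B. (u e)\<^sup>2) = 0"
      then have "\<forall>e\<in>B. u e = 0" using fin by (simp add: sum_nonneg_eq_0_iff)
      then show False using u w(2) by simp
    qed
    ultimately show ?thesis using sum_nonneg[of B "\<lambda>e. (u e)\<^sup>2"] by (simp add: less_le)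
  qed
  then show ?thesis using that[of e0] B(4) by blast
qed

section \<open>Openness of the Lorentz condition\<close>

lemma linear_real_continuous_on:
  fixes l :: "'e::euclidean_space \<Rightarrow> real"
  assumes "linear l"
  shows "continuous_on S l"
  using assms by (simp add: linear_continuous_on linear_conv_bounded_linear)

lemma bilinear_expand:
  fixes b :: "'e::euclidean_space \<Rightarrow> 'e \<Rightarrow> real"
  assumes "bilinear b"
  shows "b v w = (\<Sum>j\<in>Basis. \<Sum>k\<in>Basis. (v \<bullet> j) * (w \<bullet> k) * b j k)"
proof -
  have "b v w = b (\<Sum>i\<in>Basis. (v \<bullet> i) *\<^sub>R i) (\<Sum>j\<in>Basis. (w \<bullet> j) *\<^sub>R j)" by (simp add: euclidean_representation)
  also have "\<dots> = (\<Sum>(i, j)\<in>Basis \<times> Basis. (v \<bullet> i) * (w \<bullet> j) * b i j)"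
    by (subst bilinear_sum[OF assms]) (simp add: bilinear_lmul[OF assms] bilinear_rmul[OF assms] split_beta mult_ac)
  finally show ?thesis by (simp add: sum.cartesian_product)
qed

lemma bilinear_form_bound:
  fixes E :: "'e::euclidean_space \<Rightarrow> 'e \<Rightarrow> real"
  assumes "bilinear E" "\<And>i j. i \<in> Basis \<Longrightarrow> j \<in> Basis \<Longrightarrow> \<bar>E i j\<bar> \<le> d"
  shows "\<bar>E v w\<bar> \<le> d * (real DIM('e))\<^sup>2 * (norm v * norm w)"
proof -
  have "E v w = (\<Sum>(i, j)\<in>Basis \<times> Basis. (v \<bullet> i) * ((w \<bullet> j) * E i j))"
    unfolding bilinear_expand[OF assms(1), of v w] sum.cartesian_product by (simp add: mult.assoc)
  also have "\<bar>\<dots>\<bar> \<le> (\<Sum>(i, j)\<in>(Basis :: 'e set) \<times> (Basis :: 'e set). norm v * (norm w * d))"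
  proof (rule order_trans[OF sum_abs sum_mono])
    fix p :: "'e \<times> 'e" assume "p \<in> Basis \<times> Basis"
    then obtain i j where p: "p = (i, j)" "i \<in> Basis" "j \<in> Basis" by auto
    have "\<bar>v \<bullet> i\<bar> * (\<bar>w \<bullet> j\<bar> * \<bar>E i j\<bar>) \<le> norm v * (norm w * d)"
      using p assms(2)[of i j] by (intro mult_mono Basis_le_norm) auto
    then show "\<bar>case p of (i, j) \<Rightarrow> (v \<bullet> i) * ((w \<bullet> j) * E i j)\<bar> \<le> (case p of (i, j) \<Rightarrow> norm v * (norm w * d))"
      by (simp add: p abs_mult)
  qed
  also have "\<dots> = d * (real DIM('e))\<^sup>2 * (norm v * norm w)"
    by (simp add: power2_eq_square)
  finally show ?thesis .
qed

lemma bilinear_continuous_diag: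
  fixes b :: "'e::euclidean_space \<Rightarrow> 'e \<Rightarrow> real"
  assumes "bilinear b"
  shows "continuous_on S (\<lambda>v. b v v)"
  using bilinear_continuous_on_compose[OF continuous_on_id continuous_on_id assms] .

text \<open>The form attains a positive minimum on the compact unit sphere of the kernel, and
  homogeneity does the rest. With \<open>l = 0\<close> this covers a positive definite form on the
  whole space.\<close>

lemma positive_on_kernel_lower_bound:
  fixes b :: "'e::euclidean_space \<Rightarrow> 'e \<Rightarrow> real"
  assumes b: "bilinear b" and l: "linear l" and pos: "\<And>w. l w = (0::real) \<Longrightarrow> w \<noteq> 0 \<Longrightarrow> b w w > 0"
  obtains m where "m > 0" "\<And>w. l w = 0 \<Longrightarrow> m * (norm w)\<^sup>2 \<le> b w w"
proof -
  let ?K = "sphere 0 1 \<inter> {w. l w = 0}"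
  have K: "compact ?K"
    using linear_real_continuous_on[OF l, of UNIV]
    by (intro compact_Int_closed closed_Collect_eq) (auto simp: continuous_on_const)
  obtain m where m: "m > 0" "\<And>w. w \<in> ?K \<Longrightarrow> m \<le> b w w"
  proof (cases "?K = {}")
    \<comment> \<open>The kernel is trivial, which can happen in dimension one; any positive
      constant serves.\<close>
    case True
    then show ?thesis using that[of 1] by auto
  next
    case False
    obtain w0 where w0: "w0 \<in> ?K" "\<And>w. w \<in> ?K \<Longrightarrow> b w0 w0 \<le> b w w"
      using continuous_attains_inf[OF K False bilinear_continuous_diag[OF b]] by blast
    then show ?thesis using that[of "b w0 w0"] pos[of w0] by force
  qed
  show ?thesis
  proof (rule that[OF m(1)])
    fix w assume w: "l w = 0"
    show "m * (norm w)\<^sup>2 \<le> b w w"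
    proof (cases "w = 0")
      case True
      then show ?thesis using bilinear_lzero[OF b] by simp
    next
      case False
      let ?u = "inverse (norm w) *\<^sub>R w"
      have "?u \<in> ?K" using w False by (simp add: linear_cmul[OF l])
      from m(2)[OF this] show ?thesis
        using False by (simp add: bilinear_lmul[OF b] bilinear_rmul[OF b] field_simps power2_eq_square)
    qed
  qed
qed

text \<open>The negative vector and the hyperplane found at \<open>x0\<close> serve for all nearby
  points and all forms close to \<open>g x\<close>. Closeness is measured by \<open>h\<close>, since
  this is the quantity that survives gluing across charts.\<close>

lemma lorentz_form_stable:
  fixes g h :: "'x::t2_space \<Rightarrow> 'e::euclidean_space \<Rightarrow> 'e \<Rightarrow> real"
  assumes S: "open S" "x0 \<in> S"
    and g: "\<And>x. x \<in> S \<Longrightarrow> lorentz_form (g x)" and h: "\<And>x. x \<in> S \<Longrightarrow> positive_form (h x)"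
    and gc: "\<And>i j. i \<in> Basis \<Longrightarrow> j \<in> Basis \<Longrightarrow> continuous_on S (\<lambda>x. g x i j)"
    and hc: "\<And>i j. i \<in> Basis \<Longrightarrow> j \<in> Basis \<Longrightarrow> continuous_on S (\<lambda>x. h x i j)"
  obtains U c m where "open U" "x0 \<in> U" "U \<subseteq> S" "c > 0" "m > 0"
    "\<And>x v. x \<in> U \<Longrightarrow> m * (norm v)\<^sup>2 \<le> h x v v"
    "\<And>x b. x \<in> U \<Longrightarrow> symmetric_bilinear b \<Longrightarrow> (\<And>v. \<bar>b v v - g x v v\<bar> \<le> c * h x v v) \<Longrightarrow> lorentz_form b"
proof -
  let ?N = "(real DIM('e))\<^sup>2"
  have N: "?N > 0" by simp
  have bg: "bilinear (g x)" if "x \<in> S" for x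
    using g[OF that] by (simp add: lorentz_form_def symmetric_bilinear_def)
  have bh: "bilinear (h x)" if "x \<in> S" for x
    using h[OF that] by (simp add: positive_form_def symmetric_bilinear_def)
  have diff: "bilinear (\<lambda>v w. b v w - b' v w)" if "bilinear b" "bilinear b'" for b b' :: "'e \<Rightarrow> 'e \<Rightarrow> real"
    using that unfolding bilinear_def by (auto intro: linear_compose_sub)
  have near: "\<forall>\<^sub>F x in nhds x0. x \<in> S \<and> (\<forall>v. \<bar>k x v v - k x0 v v\<bar> \<le> d * (norm v)\<^sup>2)"
    if d: "d > 0" and kb: "\<And>x. x \<in> S \<Longrightarrow> bilinear (k x)" and
      kc: "\<And>i j. i \<in> Basis \<Longrightarrow> j \<in> Basis \<Longrightarrow> continuous_on S (\<lambda>x. k x i j)"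
    for d and k :: "'x \<Rightarrow> 'e \<Rightarrow> 'e \<Rightarrow> real"
  proof -
    have "\<forall>\<^sub>F x in nhds x0. dist (k x i j) (k x0 i j) < d / ?N" if ij: "i \<in> Basis" "j \<in> Basis" for i j
    proof -
      have "isCont (\<lambda>x. k x i j) x0" using kc[OF ij] S by (simp add: continuous_on_eq_continuous_at)
      from tendstoD[OF isCont_imp_filterlim_nhds[OF this]] show ?thesis using d N by simp
    qed
    then have "\<forall>\<^sub>F x in nhds x0. \<forall>i\<in>Basis. \<forall>j\<in>Basis. dist (k x i j) (k x0 i j) < d / ?N"
      by (simp add: eventually_ball_finite_distrib)
    moreover have "\<forall>\<^sub>F x in nhds x0. x \<in> S" using S by (auto simp: eventually_nhds)
    ultimately show ?thesis
    proof eventually_elim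
      case (elim x)
      have "\<bar>k x i j - k x0 i j\<bar> \<le> d / ?N" if "i \<in> Basis" "j \<in> Basis" for i j
        using elim(1) that by (force simp: dist_real_def)
      then have "\<bar>k x v v - k x0 v v\<bar> \<le> d / ?N * ?N * (norm v * norm v)" for v
        using bilinear_form_bound[OF diff[OF kb[OF elim(2)] kb[OF S(2)]], of "d / ?N"] by blast
      then show ?case using elim(2) N by (simp add: power2_eq_square)
    qed
  qed
  obtain e0 where e0: "g x0 e0 e0 = -1" "\<And>w. g x0 e0 w = 0 \<Longrightarrow> w \<noteq> 0 \<Longrightarrow> g x0 w w > 0"
    using lorentz_formD[OF g[OF S(2)]] by blast
  have l: "linear (g x0 e0)" using bg[OF S(2)] by (simp add: bilinear_def)
  obtain m1 where m1: "m1 > 0" "\<And>w. g x0 e0 w = 0 \<Longrightarrow> m1 * (norm w)\<^sup>2 \<le> g x0 w w"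
    using positive_on_kernel_lower_bound[OF bg[OF S(2)] l e0(2)] by blast
  obtain m2 where m2: "m2 > 0" "\<And>w. m2 * (norm w)\<^sup>2 \<le> h x0 w w"
    using positive_on_kernel_lower_bound[OF bh[OF S(2)], of "\<lambda>w. 0"] h[OF S(2)]
    by (auto simp: positive_form_def linear_zero)
  have h0: "\<bar>h x0 v v\<bar> \<le> (\<Sum>i\<in>Basis. \<Sum>j\<in>Basis. \<bar>h x0 i j\<bar>) * ?N * (norm v * norm v)" for v
  proof (rule bilinear_form_bound[OF bh[OF S(2)]])
    fix i j :: 'e assume ij: "i \<in> Basis" "j \<in> Basis"
    have "\<bar>h x0 i j\<bar> \<le> (\<Sum>j\<in>Basis. \<bar>h x0 i j\<bar>)" using ij by (intro member_le_sum) auto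
    also have "\<dots> \<le> (\<Sum>i\<in>Basis. \<Sum>j\<in>Basis. \<bar>h x0 i j\<bar>)"
      using ij by (intro member_le_sum[of i _ "\<lambda>i. \<Sum>j\<in>Basis. \<bar>h x0 i j\<bar>"]) (auto intro: sum_nonneg)
    finally show "\<bar>h x0 i j\<bar> \<le> (\<Sum>i\<in>Basis. \<Sum>j\<in>Basis. \<bar>h x0 i j\<bar>)" .
  qed
  \<comment> \<open>The first summand bounds \<open>h x0\<close>; the second absorbs the variation
    of \<open>h\<close> over the neighbourhood, which is at most \<open>m2 / 2\<close>, and makes
    \<open>H\<close> positive.\<close>
  define H where "H = (\<Sum>i\<in>Basis. \<Sum>j\<in>Basis. \<bar>h x0 i j\<bar>) * ?N + m2"
  have H: "H > 0" unfolding H_def using m2 by (intro add_nonneg_pos mult_nonneg_nonneg sum_nonneg) auto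
  \<comment> \<open>The forms will deviate from \<open>g x0\<close> by at most \<open>2 * d\<close>
    times the squared norm. The two entries keep this below \<open>m1\<close> on the hyperplane and
    below 1 at \<open>e0\<close>; the summand 1 makes the latter estimate strict.\<close>
  define d where "d = min (m1 / 4) (1 / (4 * ((norm e0)\<^sup>2 + 1)))"
  have d: "d > 0" "4 * d \<le> m1" "4 * d * (norm e0)\<^sup>2 < 1"
  proof -
    have p: "(norm e0)\<^sup>2 + 1 > 0" by (simp add: add_nonneg_pos)
    show "d > 0" "4 * d \<le> m1" using m1 p by (auto simp: d_def)
    have "4 * d * ((norm e0)\<^sup>2 + 1) \<le> 1" using p by (simp add: d_def min_def field_simps)
    then show "4 * d * (norm e0)\<^sup>2 < 1" using \<open>d > 0\<close> by (simp add: algebra_simps)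
  qed
  have "\<forall>\<^sub>F x in nhds x0. (x \<in> S \<and> (\<forall>v. \<bar>g x v v - g x0 v v\<bar> \<le> d * (norm v)\<^sup>2)) \<and>
      (x \<in> S \<and> (\<forall>v. \<bar>h x v v - h x0 v v\<bar> \<le> m2 / 2 * (norm v)\<^sup>2))"
    using m2(1) by (intro eventually_conj[OF near[OF d(1) bg gc] near[OF _ bh hc]]) auto
  then obtain U where U: "open U" "x0 \<in> U" "\<And>x. x \<in> U \<Longrightarrow> x \<in> S"
    "\<And>x v. x \<in> U \<Longrightarrow> \<bar>g x v v - g x0 v v\<bar> \<le> d * (norm v)\<^sup>2"
    "\<And>x v. x \<in> U \<Longrightarrow> \<bar>h x v v - h x0 v v\<bar> \<le> m2 / 2 * (norm v)\<^sup>2"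
    unfolding eventually_nhds by blast
  show ?thesis
  proof (rule that[of U "d / H" "m2 / 2"])
    show "m2 / 2 * (norm v)\<^sup>2 \<le> h x v v" if "x \<in> U" for x v
      using U(5)[OF that, of v] m2(2)[of v] by linarith
    fix x b assume x: "x \<in> U" and b: "symmetric_bilinear b" and close: "\<And>v. \<bar>b v v - g x v v\<bar> \<le> d / H * h x v v"
    have hH: "h x v v \<le> H * (norm v)\<^sup>2" for v
    proof -
      have "0 \<le> m2 * (norm v)\<^sup>2" using m2(1) by simp
      then show ?thesis
        using h0[of v] U(5)[OF x, of v]
        unfolding H_def distrib_right power2_eq_square[of "norm v", symmetric] by linarith
    qed
    \<comment> \<open>One \<open>d\<close> comes from moving from \<open>x0\<close> to
      \<open>x\<close>, the other from the deviation of \<open>b\<close> from \<open>g x\<close>,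
      because \<open>d / H * h x v v\<close> is at most \<open>d\<close> times the squared
      norm.\<close>
    have b0: "\<bar>b v v - g x0 v v\<bar> \<le> 2 * d * (norm v)\<^sup>2" for v
    proof -
      have "d / H * h x v v \<le> d / H * (H * (norm v)\<^sup>2)"
        using hH d H by (intro mult_left_mono) auto
      then show ?thesis using close[of v] U(4)[OF x, of v] H by simp
    qed
    show "lorentz_form b"
    proof (rule lorentz_formI[OF b _ l])
      have "d * (norm e0)\<^sup>2 \<ge> 0" using d by simp
      then show "b e0 e0 < 0" using b0[of e0] e0(1) d(3) by linarith
      show "b w w > 0" if w: "g x0 e0 w = 0" "w \<noteq> 0" for w
      proof -
        have "d * (norm w)\<^sup>2 > 0" using d w by simp
        moreover have "4 * d * (norm w)\<^sup>2 \<le> m1 * (norm w)\<^sup>2" using d by (intro mult_right_mono) auto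
        ultimately show ?thesis using b0[of w] m1(2)[OF w(1)] by linarith
      qed
    qed
  qed (use U d H m2 in auto)
qed

section \<open>Charts\<close>

lemma smooth_on_compose_euclidean:
  fixes f :: "'d::euclidean_space \<Rightarrow> 'f::euclidean_space" and g :: "'e::euclidean_space \<Rightarrow> 'd"
  assumes "open S" "open T" "smooth_on T f" "smooth_on S g" "g ` S \<subseteq> T"
  shows "smooth_on S (\<lambda>x. f (g x))"
proof -
  have "smooth_on S (\<lambda>x. \<Sum>b\<in>Basis. (f (g x) \<bullet> b) *\<^sub>R b)"
    by (intro smooth_on_sum assms(1) smooth_on_bounded_linear[OF bounded_linear_scaleR_left]
        smooth_on_compose[OF assms(1,2) smooth_on_bounded_linear[OF bounded_linear_inner_left assms(2,3)] assms(4,5)])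
  then show ?thesis by (simp add: euclidean_representation)
qed

lemma smooth_on_Pair:
  fixes f :: "'e::euclidean_space \<Rightarrow> 'a::euclidean_space" and g :: "'e \<Rightarrow> 'b::euclidean_space"
  assumes "open S" "smooth_on S f" "smooth_on S g"
  shows "smooth_on S (\<lambda>x. (f x, g x))"
proof -
  have "bounded_linear (\<lambda>u::'a. (u, 0::'b))" "bounded_linear (\<lambda>u::'b. (0::'a, u))"
    by (simp_all add: bounded_linear_Pair bounded_linear_ident bounded_linear_zero)
  then have "smooth_on S (\<lambda>x. (f x, 0) + (0, g x))"
    using assms by (intro smooth_on_add smooth_on_bounded_linear[of "\<lambda>u. (u, 0)"] smooth_on_bounded_linear[of "\<lambda>u. (0, u)"])
  then show ?thesis by simp
qed

locale smooth_mfd =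
  fixes M :: "'a topology" and A :: "('a, 'e::euclidean_space) chart set"
  assumes mfd: "smooth_manifold M A"
begin

lemma chart_open:
  assumes "c \<in> A"
  shows "openin M (fst c)" "open (chart_image c)" "fst c \<subseteq> topspace M"
    "homeomorphic_map (subtopology M (fst c)) (top_of_set (chart_image c)) (snd c)"
  using mfd assms openin_subset by (auto simp: smooth_manifold_def)

lemma chart_inj: "c \<in> A \<Longrightarrow> inj_on (snd c) (fst c)"
  using homeomorphic_imp_injective_map[OF chart_open(4)] topspace_subtopology_subset[OF chart_open(3)] by simp

lemma chart_inv_left [simp]: "c \<in> A \<Longrightarrow> p \<in> fst c \<Longrightarrow> chart_inv c (snd c p) = p"
  using chart_inj by (simp add: chart_inv_def)

lemma chart_inv_mem: "x \<in> chart_image c \<Longrightarrow> chart_inv c x \<in> fst c"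
  unfolding chart_inv_def chart_image_def by (rule inv_into_into)

lemma chart_inv_right [simp]: "x \<in> chart_image c \<Longrightarrow> snd c (chart_inv c x) = x"
  unfolding chart_inv_def chart_image_def by (rule f_inv_into_f)

lemma chart_image_mem: "p \<in> fst c \<Longrightarrow> snd c p \<in> chart_image c"
  by (simp add: chart_image_def)

lemma chart_inv_space: "c \<in> A \<Longrightarrow> x \<in> chart_image c \<Longrightarrow> chart_inv c x \<in> topspace M"
  by (rule subsetD[OF chart_open(3) chart_inv_mem])

lemma chart_inv_image:
  assumes "c \<in> A" "V \<subseteq> chart_image c"
  shows "chart_inv c ` V = {p \<in> fst c. snd c p \<in> V}"
proof (intro set_eqI iffI)
  fix p assume "p \<in> chart_inv c ` V"
  then obtain x where x: "x \<in> V" "p = chart_inv c x" by blast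
  then have "x \<in> chart_image c" using assms(2) by blast
  then show "p \<in> {p \<in> fst c. snd c p \<in> V}" using x chart_inv_mem[of x c] by simp
next
  fix p assume "p \<in> {p \<in> fst c. snd c p \<in> V}"
  then show "p \<in> chart_inv c ` V" using assms(1) by (intro image_eqI[of _ _ "snd c p"]) simp_all
qed

lemma chart_image_restrict:
  assumes "c \<in> A"
  shows "snd c ` (fst c \<inter> W) = {x \<in> chart_image c. chart_inv c x \<in> W}"
proof (intro set_eqI iffI)
  fix x assume "x \<in> snd c ` (fst c \<inter> W)"
  then show "x \<in> {x \<in> chart_image c. chart_inv c x \<in> W}" using assms by (auto simp: chart_image_mem)
next
  fix x assume "x \<in> {x \<in> chart_image c. chart_inv c x \<in> W}"
  then show "x \<in> snd c ` (fst c \<inter> W)"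
    using chart_inv_mem[of x c] by (intro image_eqI[of _ _ "chart_inv c x"]) simp_all
qed

lemma chart_preimage_open:
  assumes "c \<in> A" "openin M W"
  shows "open {x \<in> chart_image c. chart_inv c x \<in> W}"
proof -
  have "{x \<in> chart_image c. chart_inv c x \<in> W} = snd c ` (fst c \<inter> W)"
    using chart_image_restrict[OF assms(1)] by simp
  moreover have "openin (subtopology M (fst c)) (fst c \<inter> W)"
    using assms chart_open by (simp add: openin_Int openin_open_subtopology)
  then have "openin (top_of_set (chart_image c)) (snd c ` (fst c \<inter> W))"
    using homeomorphic_map_openness_eq[OF chart_open(4)[OF assms(1)]] by simp
  ultimately show ?thesis
    using openin_open_trans chart_open(2)[OF assms(1)] by metis
qed

lemma chart_inv_continuous: "c \<in> A \<Longrightarrow> continuous_map (top_of_set (chart_image c)) M (chart_inv c)"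
proof -
  assume c: "c \<in> A"
  have "openin (top_of_set (chart_image c)) {x \<in> chart_image c. chart_inv c x \<in> W}" if "openin M W" for W
    using chart_preimage_open[OF c that] by (intro open_subset) auto
  moreover have "chart_inv c \<in> chart_image c \<rightarrow> topspace M" using chart_inv_space[OF c] by blast
  ultimately show ?thesis by (simp add: continuous_map_def)
qed

lemma chart_inv_image_open:
  assumes "c \<in> A" "open V" "V \<subseteq> chart_image c"
  shows "openin M (chart_inv c ` V)"
proof -
  have top: "topspace (subtopology M (fst c)) = fst c"
    using topspace_subtopology_subset[OF chart_open(3)[OF assms(1)]] .
  have "continuous_map (subtopology M (fst c)) (top_of_set (chart_image c)) (snd c)"
    using chart_open(4)[OF assms(1)] homeomorphic_imp_continuous_map by blast
  moreover have "openin (top_of_set (chart_image c)) V"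
    using assms(2,3) chart_open(2)[OF assms(1)] by (simp add: openin_open_eq)
  ultimately have "openin (subtopology M (fst c)) {p \<in> fst c. snd c p \<in> V}"
    using openin_continuous_map_preimage top by fastforce
  moreover have "{p \<in> fst c. snd c p \<in> V} = chart_inv c ` V"
    using chart_inv_image[OF assms(1,3)] by simp
  ultimately show ?thesis
    using openin_trans_full chart_open(1)[OF assms(1)] by metis
qed

text \<open>The Hausdorff property enters here: a compact set in a chart is closed in the whole
  manifold, so a cutoff extended by zero vanishes on an open complement.\<close>

lemma chart_inv_image_closed:
  assumes "c \<in> A" "compact K" "K \<subseteq> chart_image c"
  shows "closedin M (chart_inv c ` K)"
proof -
  have "compactin (top_of_set (chart_image c)) K"
    using assms by (simp add: compactin_subtopology)
  then have "compactin M (chart_inv c ` K)"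
    using image_compactin chart_inv_continuous[OF assms(1)] by blast
  moreover have "Hausdorff_space M" using mfd by (simp add: smooth_manifold_def)
  ultimately show ?thesis by (metis compactin_imp_closedin)
qed

section \<open>Change of coordinates for vectors and forms\<close>

definition overlap :: "('a, 'e) chart \<Rightarrow> ('a, 'e) chart \<Rightarrow> 'e set" where
  "overlap d c = {x \<in> chart_image d. chart_inv d x \<in> fst c}"

lemma overlapD:
  assumes "x \<in> overlap d c"
  shows "x \<in> chart_image d" "chart_inv d x \<in> fst c" "chart_inv d x \<in> fst d"
  using assms chart_inv_mem[of x d] by (simp_all add: overlap_def)

lemma transition_overlap:
  assumes "c \<in> A" "d \<in> A"
  shows "smooth_on (overlap d c) (transition d c)"
    "x \<in> overlap d c \<Longrightarrow> transition d c x = snd c (chart_inv d x)"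
    "x \<in> overlap d c \<Longrightarrow> transition d c x \<in> chart_image c"
    "x \<in> overlap d c \<Longrightarrow> chart_inv c (transition d c x) = chart_inv d x"
proof -
  have "overlap d c = snd d ` (fst d \<inter> fst c)"
    unfolding overlap_def chart_image_restrict[OF assms(2)] ..
  then show "smooth_on (overlap d c) (transition d c)"
    using mfd assms by (auto simp: smooth_manifold_def)
  show "x \<in> overlap d c \<Longrightarrow> transition d c x = snd c (chart_inv d x)"
    by (simp add: transition_def)
  then show "x \<in> overlap d c \<Longrightarrow> transition d c x \<in> chart_image c"
    "x \<in> overlap d c \<Longrightarrow> chart_inv c (transition d c x) = chart_inv d x"
    using assms by (auto simp: overlap_def chart_image_def)
qed

lemma tangent_vec_transition:
  assumes "c \<in> A" "d \<in> A" "x \<in> overlap d c"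
  shows "tangent_vec A d (chart_inv d x) v c = partial_deriv v (transition d c) x"
  using assms by (simp add: tangent_vec_def charts_at_def overlap_def partial_deriv_def)

lemma coeff_at_tangent:
  assumes "c \<in> A" "p \<in> fst c" "X \<in> tangent_space A p" "Y \<in> tangent_space A p"
  shows "coeff A c g (X c) (Y c) (snd c p) = g p X Y"
  using assms by (simp add: coeff_def tangent_vec_coord charts_at_def)

lemma coeff_change:
  assumes "c \<in> A" "d \<in> A" "x \<in> overlap d c"
  shows "coeff A d g v w x = coeff A c g (partial_deriv v (transition d c) x) (partial_deriv w (transition d c) x) (transition d c x)"
proof -
  let ?p = "chart_inv d x"
  have p: "?p \<in> fst c" "?p \<in> fst d" using overlapD[OF assms(3)] by simp_all
  have "tangent_vec A d ?p u \<in> tangent_space A ?p" for u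
    by (rule tangent_vec_in_tangent_space(1)[OF mfd]) (use assms p in \<open>simp add: charts_at_def\<close>)
  then show ?thesis
    using coeff_at_tangent[OF assms(1) p(1), of "tangent_vec A d ?p v" "tangent_vec A d ?p w" g]
      tangent_vec_transition[OF assms] transition_overlap(2)[OF assms]
    by (simp add: coeff_def)
qed

lemma partial_transition_linear:
  assumes "c \<in> A" "d \<in> A" "x \<in> overlap d c"
  shows "linear (\<lambda>v. partial_deriv v (transition d c) x)"
  using smooth_on_differentiable[OF transition_overlap(1)[OF assms(1,2)] assms(3)]
    partial_deriv_has_derivative has_derivative_linear by blast

lemma partial_transition_inverse:
  assumes "c \<in> A" "d \<in> A" "x \<in> overlap d c"
  shows "partial_deriv (partial_deriv v (transition d c) x) (transition c d) (transition d c x) = v"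
proof -
  let ?p = "chart_inv d x" and ?y = "transition d c x"
  have p: "?p \<in> fst c" "?p \<in> fst d" using overlapD[OF assms(3)] by simp_all
  have y: "?y \<in> overlap c d" "chart_inv c ?y = ?p"
    using transition_overlap(3,4)[OF assms] p by (auto simp: overlap_def)
  have mem: "d \<in> charts_at A ?p" "c \<in> charts_at A ?p" using assms p by (auto simp: charts_at_def)
  note tv = tangent_vec_in_tangent_space[OF mfd mem(1)]
  have "tangent_vec A c ?p (tangent_vec A d ?p v c) d = tangent_vec A d ?p v d"
    using tangent_vec_coord[OF tv(1) mem(2), of v] by simp
  also have "\<dots> = v" by (rule tv(2))
  finally show ?thesis
    using tangent_vec_transition[OF assms(1,2,3), of v] tangent_vec_transition[OF assms(2,1) y(1)] y(2) by simp
qed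

lemma overlap_swap:
  assumes "c \<in> A" "d \<in> A" "x \<in> overlap d c"
  shows "transition d c x \<in> overlap c d" "transition c d (transition d c x) = x"
proof -
  have p: "chart_inv d x \<in> fst d" using overlapD[OF assms(3)] by simp_all
  show y: "transition d c x \<in> overlap c d"
    using transition_overlap(3,4)[OF assms] p by (auto simp: overlap_def)
  show "transition c d (transition d c x) = x"
    using transition_overlap(2)[OF assms(2,1) y] transition_overlap(4)[OF assms] assms(3) by (simp add: overlap_def)
qed

text \<open>The negative vector and the positive hyperplane of the criterion are pulled back along
  the differential of the transition map. Hence the signature at a point may be checked in one
  convenient chart.\<close>

lemma lorentz_form_change_chart:
  assumes "c \<in> A" "d \<in> A" "x \<in> overlap d c"
    and L: "lorentz_form (\<lambda>v w. coeff A c g v w (transition d c x))"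
  shows "lorentz_form (\<lambda>v w. coeff A d g v w x)"
proof -
  let ?b = "\<lambda>v w. coeff A c g v w (transition d c x)"
  let ?L = "\<lambda>v. partial_deriv v (transition d c) x" and ?R = "\<lambda>v. partial_deriv v (transition c d) (transition d c x)"
  note lin = partial_transition_linear[OF assms(1-3)]
  have sb: "symmetric_bilinear ?b" using L by (simp add: lorentz_form_def)
  obtain e0 where e0: "?b e0 e0 = -1" "\<And>w. ?b e0 w = 0 \<Longrightarrow> w \<noteq> 0 \<Longrightarrow> ?b w w > 0"
    using lorentz_formD[OF L] by blast
  have RL: "?R (?L v) = v" for v by (rule partial_transition_inverse[OF assms(1-3)])
  have LR: "?L (?R v) = v" for v
    using partial_transition_inverse[OF assms(2,1) overlap_swap(1)[OF assms(1-3)], of v] overlap_swap(2)[OF assms(1-3)] by simp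
  note eq = coeff_change[OF assms(1-3), of g]
  have b: "bilinear ?b" using sb by (simp add: symmetric_bilinear_def)
  show ?thesis
  proof (rule lorentz_formI)
    have "bilinear (\<lambda>v w. coeff A d g v w x)"
      unfolding eq bilinear_def
      by (auto intro!: linearI simp: linear_add[OF lin] linear_cmul[OF lin] symmetric_bilinear_facts(1-4)[OF sb])
    then show "symmetric_bilinear (\<lambda>v w. coeff A d g v w x)"
      unfolding symmetric_bilinear_def eq using symmetric_bilinear_facts(5)[OF sb] by blast
    show "coeff A d g (?R e0) (?R e0) x < 0" using e0(1) by (simp add: eq LR)
    show "linear (\<lambda>w. ?b e0 (?L w))"
      by (auto intro!: linearI simp: linear_add[OF lin] linear_cmul[OF lin] symmetric_bilinear_facts(2,4)[OF sb])
    show "coeff A d g w w x > 0" if "?b e0 (?L w) = 0" "w \<noteq> 0" for w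
    proof -
      have "?L w \<noteq> 0"
      proof
        assume "?L w = 0"
        then have "w = ?R 0" using RL[of w] by simp
        also have "?R 0 = ?R (?L 0)" using linear_0[OF lin] by simp
        finally show False using RL[of 0] that(2) by simp
      qed
      then show ?thesis using e0(2)[OF that(1)] by (simp add: eq)
    qed
  qed
qed

lemma nonzero_tangent_coord:
  assumes "c \<in> A" "p \<in> fst c" "X \<in> nonzero_tangent A p"
  shows "X \<in> tangent_space A p" "X c \<noteq> 0"
proof -
  show X: "X \<in> tangent_space A p" using assms by (simp add: nonzero_tangent_def)
  have m: "c \<in> charts_at A p" using assms by (simp add: charts_at_def)
  show "X c \<noteq> 0"
  proof
    assume 0: "X c = 0"
    have "X d = 0" for d
    proof (cases "d \<in> charts_at A p")
      case True
      have "snd c p \<in> overlap c d" using assms True by (auto simp: overlap_def charts_at_def chart_image_def)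
      then have "linear (\<lambda>v. partial_deriv v (transition c d) (snd c p))"
        using partial_transition_linear assms(1) True by (auto simp: charts_at_def)
      moreover have "X d = partial_deriv (X c) (transition c d) (snd c p)"
        using X m True unfolding tangent_space_def partial_deriv_def by blast
      ultimately show ?thesis using linear_0 0 by metis
    next
      case False
      then show ?thesis using X unfolding tangent_space_def by blast
    qed
    then show False using assms(3) by (auto simp: nonzero_tangent_def)
  qed
qed

end

section \<open>A partition of unity subordinate to good balls\<close>

lemma symmetric_bilinear_add:
  "symmetric_bilinear a \<Longrightarrow> symmetric_bilinear b \<Longrightarrow> symmetric_bilinear (\<lambda>v w. a v w + b v w)"
  unfolding symmetric_bilinear_def bilinear_def by (auto intro: linear_compose_add)

lemma symmetric_bilinear_cmul:
  "symmetric_bilinear a \<Longrightarrow> symmetric_bilinear (\<lambda>v w. c * a v w)"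
proof -
  have "linear (\<lambda>x. c * f x)" if "linear f" for f :: "'a \<Rightarrow> real"
    using that by (intro linearI) (simp_all add: linear_add linear_cmul algebra_simps)
  then show "symmetric_bilinear a \<Longrightarrow> ?thesis"
    unfolding symmetric_bilinear_def bilinear_def by simp
qed

lemma symmetric_bilinear_diff:
  assumes "symmetric_bilinear a" "symmetric_bilinear b"
  shows "symmetric_bilinear (\<lambda>v w. a v w - b v w)"
  using symmetric_bilinear_add[OF assms(1) symmetric_bilinear_cmul[OF assms(2), of "-1"]] by simp

lemma symmetric_bilinear_zero: "symmetric_bilinear (\<lambda>v w. 0)"
  unfolding symmetric_bilinear_def bilinear_def by (simp add: linear_zero)

lemma symmetric_bilinear_sum:
  "(\<And>i. i \<in> I \<Longrightarrow> symmetric_bilinear (a i)) \<Longrightarrow> symmetric_bilinear (\<lambda>v w. \<Sum>i\<in>I. a i v w)"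
  by (induction I rule: infinite_finite_induct) (auto simp: symmetric_bilinear_zero symmetric_bilinear_add)

lemma symmetric_bilinear_compose:
  assumes b: "symmetric_bilinear b" and L: "linear L"
  shows "symmetric_bilinear (\<lambda>v w. b (L v) (L w))"
proof -
  note f = symmetric_bilinear_facts[OF b]
  have "bilinear (\<lambda>v w. b (L v) (L w))"
    unfolding bilinear_def by (auto intro!: linearI simp: linear_add[OF L] linear_cmul[OF L] f(1-4))
  then show ?thesis unfolding symmetric_bilinear_def using f(5) by blast
qed

locale approx_setup = smooth_mfd M A
  for M :: "'a topology" and A :: "('a, 'e::euclidean_space) chart set" +
  fixes g h :: "('a, 'e) tensor2"
  assumes g_lorentzian: "lorentzian_metric A g" and g_continuous: "continuous_tensor A g"
    and h_riemannian: "riemannian_metric A h" and h_smooth: "smooth_tensor A h"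
begin

lemma g_form: "c \<in> A \<Longrightarrow> x \<in> chart_image c \<Longrightarrow> lorentz_form (\<lambda>v w. coeff A c g v w x)"
  using g_lorentzian by (simp add: lorentzian_metric_def)

lemma h_form: "c \<in> A \<Longrightarrow> x \<in> chart_image c \<Longrightarrow> positive_form (\<lambda>v w. coeff A c h v w x)"
  using h_riemannian by (simp add: riemannian_metric_def)

text \<open>Mollification moves points by at most \<open>r\<close>, which is the room between the
  radii \<open>2 * r\<close> and \<open>3 * r\<close>. The glued metrics will deviate from
  \<open>g\<close> by at most \<open>3 / 2 * k * h\<close> for a suitable ball around each point, so
  \<open>2 * k\<close> is tolerated with room to spare. The bound \<open>1 / 8\<close> serves the
  distance estimate, and \<open>m\<close> converts Euclidean errors of coefficients into multiples
  of \<open>h\<close>.\<close>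

definition good :: "('a, 'e) chart \<Rightarrow> 'e \<Rightarrow> real \<Rightarrow> real \<Rightarrow> real \<Rightarrow> bool" where
  "good c x0 r k m \<longleftrightarrow> c \<in> A \<and> 0 < r \<and> cball x0 (3 * r) \<subseteq> chart_image c \<and> 0 < k \<and> k \<le> 1 / 8 \<and> 0 < m \<and>
     (\<forall>x\<in>ball x0 (2 * r). (\<forall>v. m * (norm v)\<^sup>2 \<le> coeff A c h v v x) \<and>
        (\<forall>b. symmetric_bilinear b \<longrightarrow>
           (\<forall>v. \<bar>b v v - coeff A c g v v x\<bar> \<le> 2 * k * coeff A c h v v x) \<longrightarrow> lorentz_form b)) \<and>
     (C11_tensor A g \<longrightarrow> (\<forall>i\<in>Basis. \<forall>j\<in>Basis. \<forall>v\<in>Basis.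
        \<exists>L. L-lipschitz_on (cball x0 (3 * r)) (partial_deriv v (coeff A c g i j))))"

lemma exists_good:
  assumes p: "p \<in> topspace M"
  shows "\<exists>c x0 r k m. good c x0 r k m \<and> p \<in> chart_inv c ` ball x0 r"
proof -
  obtain c where c: "c \<in> A" "p \<in> fst c" using p mfd unfolding smooth_manifold_def by (metis UN_E)
  let ?S = "chart_image c" and ?x = "snd c p"
  have S: "open ?S" "?x \<in> ?S" using chart_open(2)[OF c(1)] chart_image_mem[OF c(2)] by auto
  obtain U k m where U: "open U" "?x \<in> U" "U \<subseteq> ?S" and km: "k > 0" "m > 0"
    and hm: "\<And>x v. x \<in> U \<Longrightarrow> m * (norm v)\<^sup>2 \<le> coeff A c h v v x"
    and lor: "\<And>x b. x \<in> U \<Longrightarrow> symmetric_bilinear b \<Longrightarrow>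
      (\<And>v. \<bar>b v v - coeff A c g v v x\<bar> \<le> k * coeff A c h v v x) \<Longrightarrow> lorentz_form b"
  proof (rule lorentz_form_stable[of ?S ?x "\<lambda>x v w. coeff A c g v w x" "\<lambda>x v w. coeff A c h v w x"])
    show "continuous_on ?S (\<lambda>x. coeff A c g i j x)" if "i \<in> Basis" "j \<in> Basis" for i j
      using g_continuous c(1) that by (simp add: continuous_tensor_def)
    show "continuous_on ?S (\<lambda>x. coeff A c h i j x)" if "i \<in> Basis" "j \<in> Basis" for i j
      using h_smooth c(1) that by (simp add: smooth_tensor_def smooth_on_continuous)
  qed (use S g_form[OF c(1)] h_form[OF c(1)] in auto)
  \<comment> \<open>Each requirement on the radius holds for all small \<open>r\<close>, so their
    conjunction is obtained through the filter \<open>at_right 0\<close>.\<close>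
  have shrink: "\<forall>\<^sub>F r in at_right 0. cball ?x (3 * r) \<subseteq> V" if V: "open V" "?x \<in> V" for V
  proof -
    obtain e where e: "e > 0" "ball ?x e \<subseteq> V" using V open_contains_ball by blast
    have "cball ?x (3 * r) \<subseteq> V" if "r < e / 3" for r using e(2) that by (auto simp: subset_iff)
    then show ?thesis using e(1) unfolding eventually_at_right_field by (intro exI[of _ "e / 3"]) auto
  qed
  have lip: "\<forall>\<^sub>F r in at_right 0. \<forall>i\<in>Basis. \<forall>j\<in>Basis. \<forall>v\<in>Basis.
      \<exists>L. L-lipschitz_on (cball ?x (3 * r)) (partial_deriv v (coeff A c g i j))" if C11: "C11_tensor A g"
  proof (intro eventually_ball_finite ballI finite_Basis)
    fix i j v :: 'e assume ij: "i \<in> Basis" "j \<in> Basis" "v \<in> Basis"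
    have "locally_lipschitz_on ?S (partial_deriv v (coeff A c g i j))"
      using C11 c(1) ij by (simp add: C11_tensor_def C11_on_def)
    then obtain \<rho> L where \<rho>: "\<rho> > 0" "L-lipschitz_on (ball ?x \<rho> \<inter> ?S) (partial_deriv v (coeff A c g i j))"
      using S(2) unfolding locally_lipschitz_on_def by blast
    have "\<forall>\<^sub>F r in at_right 0. cball ?x (3 * r) \<subseteq> ball ?x \<rho> \<inter> ?S"
      using \<rho>(1) S by (intro shrink) auto
    then show "\<forall>\<^sub>F r in at_right 0. \<exists>L. L-lipschitz_on (cball ?x (3 * r)) (partial_deriv v (coeff A c g i j))"
      by eventually_elim (use \<rho>(2) lipschitz_on_subset in blast)
  qed
  have "\<forall>\<^sub>F r in at_right 0. 0 < r \<and> cball ?x (3 * r) \<subseteq> U \<and> (C11_tensor A g \<longrightarrow> (\<forall>i\<in>Basis. \<forall>j\<in>Basis. \<forall>v\<in>Basis.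
      \<exists>L. L-lipschitz_on (cball ?x (3 * r)) (partial_deriv v (coeff A c g i j))))"
    using lip shrink[OF U(1,2)] by (intro eventually_conj) (auto simp: eventually_at_filter)
  then obtain r where r: "0 < r" "cball ?x (3 * r) \<subseteq> U" "C11_tensor A g \<longrightarrow> (\<forall>i\<in>Basis. \<forall>j\<in>Basis. \<forall>v\<in>Basis.
      \<exists>L. L-lipschitz_on (cball ?x (3 * r)) (partial_deriv v (coeff A c g i j)))"
    using eventually_happens'[OF trivial_limit_at_right_real] by blast
  \<comment> \<open>Halved because \<open>good\<close> tolerates a deviation of twice its
    constant.\<close>
  define k' where "k' = min (k / 2) (1 / 8)"
  have k': "0 < k'" "k' \<le> 1 / 8" "2 * k' \<le> k" using km by (auto simp: k'_def)
  have BU: "ball ?x (2 * r) \<subseteq> U" using r(1,2) by (force simp: subset_iff)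
  have "good c ?x r k' m"
    unfolding good_def
  proof (intro conjI ballI allI impI)
    fix x assume x: "x \<in> ball ?x (2 * r)"
    show "m * (norm v)\<^sup>2 \<le> coeff A c h v v x" for v using hm x BU by blast
    fix b assume b: "symmetric_bilinear b" "\<forall>v. \<bar>b v v - coeff A c g v v x\<bar> \<le> 2 * k' * coeff A c h v v x"
    have "\<bar>b v v - coeff A c g v v x\<bar> \<le> k * coeff A c h v v x" for v
    proof -
      have "0 \<le> m * (norm v)\<^sup>2" using km by simp
      also have "\<dots> \<le> coeff A c h v v x" using hm x BU by blast
      finally have "2 * k' * coeff A c h v v x \<le> k * coeff A c h v v x" using k'(3) by (intro mult_right_mono)
      then show ?thesis using b(2) order_trans by blast
    qed
    then show "lorentz_form b" using lor[OF _ b(1)] x BU by blast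
  next
    fix i j v :: 'e assume "C11_tensor A g" "i \<in> Basis" "j \<in> Basis" "v \<in> Basis"
    then show "\<exists>L. L-lipschitz_on (cball ?x (3 * r)) (partial_deriv v (coeff A c g i j))"
      using r(3) by blast
  qed (use c r U k' km in auto)
  moreover have "p \<in> chart_inv c ` ball ?x r"
    using c r(1) by (intro image_eqI[of _ _ ?x]) auto
  ultimately show ?thesis by blast
qed

text \<open>Second countability yields a countable subcover by the Lindelof property. The
  enumeration may repeat members, so a finite cover is allowed, but an empty one cannot be
  enumerated.\<close>

lemma countable_good_cover:
  assumes ne: "topspace M \<noteq> {}"
  obtains cc :: "nat \<Rightarrow> ('a, 'e) chart" and xx rr kk mm where
    "\<And>i. good (cc i) (xx i) (rr i) (kk i) (mm i)" "topspace M = (\<Union>i. chart_inv (cc i) ` ball (xx i) (rr i))"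
proof -
  let ?\<U> = "{chart_inv c ` ball x0 r | c x0 r. \<exists>k m. good c x0 r k m}"
  have op: "openin M V" if VU: "V \<in> ?\<U>" for V
  proof -
    obtain c x0 r k m where V: "V = chart_inv c ` ball x0 r" and G: "good c x0 r k m" using VU by blast
    have "ball x0 r \<subseteq> cball x0 (3 * r)" using G by (auto simp: good_def)
    then show ?thesis unfolding V using G by (intro chart_inv_image_open) (auto simp: good_def)
  qed
  have un: "\<Union>?\<U> = topspace M"
  proof
    show "\<Union>?\<U> \<subseteq> topspace M" using op openin_subset by blast
    show "topspace M \<subseteq> \<Union>?\<U>"
    proof
      fix p assume "p \<in> topspace M"
      then obtain c x0 r k m where "good c x0 r k m" "p \<in> chart_inv c ` ball x0 r" using exists_good by blast
      then show "p \<in> \<Union>?\<U>" by blast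
    qed
  qed
  have lind: "Lindelof_space M"
    using mfd by (intro second_countable_imp_Lindelof_space) (simp add: smooth_manifold_def)
  have "\<exists>\<V>. countable \<V> \<and> \<V> \<subseteq> ?\<U> \<and> \<Union>\<V> = topspace M"
    by (rule Lindelof_spaceD[OF lind _ un]) (rule op)
  then obtain \<V> where V: "countable \<V>" "\<V> \<subseteq> ?\<U>" "\<Union>\<V> = topspace M" by (elim exE conjE)
  then have ne': "\<V> \<noteq> {}" using ne by (metis Union_empty)
  have "\<exists>c x0 r k m. good c x0 r k m \<and> from_nat_into \<V> n = chart_inv c ` ball x0 r" for n
    using from_nat_into[OF ne', of n] V(2) by blast
  then obtain cc xx rr kk mm where
    "\<And>n. good (cc n) (xx n) (rr n) (kk n) (mm n)" "\<And>n. from_nat_into \<V> n = chart_inv (cc n) ` ball (xx n) (rr n)"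
    by metis
  moreover have "topspace M = (\<Union>n. from_nat_into \<V> n)"
    using V(3) range_from_nat_into[OF ne' V(1)] by simp
  ultimately show ?thesis using that[of cc xx rr kk mm] by simp
qed

end

text \<open>All choices are fixed at once. The cutoff radius \<open>3 / 2 * rr i\<close> lies
  between the radius where the cutoff is 1 and the one where \<open>\<Phi>\<close> is controlled. In
  the accuracy, the square of the dimension offsets the passage from coefficients to forms,
  \<open>mm i\<close> the passage from the Euclidean norm to \<open>h\<close>, and the factor 2
  makes the error half of the later shift.\<close>

locale gluing = approx_setup M A g h
  for M :: "'a topology" and A :: "('a, 'e::euclidean_space) chart set" and g h +
  fixes cc :: "nat \<Rightarrow> ('a, 'e) chart" and xx :: "nat \<Rightarrow> 'e" and rr kk mm :: "nat \<Rightarrow> real"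
    and bb :: "nat \<Rightarrow> 'e \<Rightarrow> real" and \<Phi> :: "nat \<Rightarrow> 'e \<Rightarrow> 'e \<Rightarrow> real \<Rightarrow> 'e \<Rightarrow> real"
  assumes goodness: "good (cc i) (xx i) (rr i) (kk i) (mm i)"
    and cover: "topspace M = (\<Union>i. chart_inv (cc i) ` ball (xx i) (rr i))"
    and bb: "smooth_on UNIV (bb i)" "0 \<le> bb i x" "bb i x \<le> 1"
      "x \<in> cball (xx i) (rr i) \<Longrightarrow> bb i x = 1" "x \<notin> ball (xx i) (3 / 2 * rr i) \<Longrightarrow> bb i x = 0"
    and \<Phi>_smooth: "j \<in> Basis \<Longrightarrow> k \<in> Basis \<Longrightarrow>
      smooth_on ({0<..} \<times> ball (xx i) (2 * rr i)) (\<lambda>(\<epsilon>, x). \<Phi> i j k \<epsilon> x)"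
    and \<Phi>_close: "j \<in> Basis \<Longrightarrow> k \<in> Basis \<Longrightarrow> 0 < \<epsilon> \<Longrightarrow> x \<in> ball (xx i) (2 * rr i) \<Longrightarrow>
      \<bar>\<Phi> i j k \<epsilon> x - coeff A (cc i) g j k x\<bar> \<le> kk i * mm i / (2 * (real DIM('e))\<^sup>2) * flat 0 \<epsilon>"
    and \<Phi>_C1: "C11_tensor A g \<Longrightarrow> j \<in> Basis \<Longrightarrow> k \<in> Basis \<Longrightarrow> x \<in> ball (xx i) (2 * rr i) \<Longrightarrow>
      C1_near (\<Phi> i j k) (coeff A (cc i) g j k) x"
begin

lemma good_facts: "cc i \<in> A" "0 < rr i" "cball (xx i) (3 * rr i) \<subseteq> chart_image (cc i)" "0 < kk i" "kk i \<le> 1 / 8" "0 < mm i"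
  using goodness[of i] by (auto simp: good_def)

lemma ball_in_chart: "ball (xx i) (2 * rr i) \<subseteq> chart_image (cc i)" "cball (xx i) (3 / 2 * rr i) \<subseteq> chart_image (cc i)"
proof -
  have "ball (xx i) (2 * rr i) \<subseteq> cball (xx i) (3 * rr i)" "cball (xx i) (3 / 2 * rr i) \<subseteq> cball (xx i) (3 * rr i)"
    using good_facts(2)[of i] by (auto simp: subset_iff)
  then show "ball (xx i) (2 * rr i) \<subseteq> chart_image (cc i)" "cball (xx i) (3 / 2 * rr i) \<subseteq> chart_image (cc i)"
    using good_facts(3)[of i] by blast+
qed

section \<open>The locally finite partition of unity\<close>

definition W :: "nat \<Rightarrow> 'a set" where "W i = chart_inv (cc i) ` ball (xx i) (rr i)"

definition \<beta> :: "nat \<Rightarrow> 'a \<Rightarrow> real" where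
  "\<beta> i p = (if p \<in> fst (cc i) then bb i (snd (cc i) p) else 0)"

definition \<eta> :: "nat \<Rightarrow> 'a \<Rightarrow> real" where
  "\<eta> i p = \<beta> i p * (\<Prod>l<i. 1 - \<beta> l p)"

text \<open>A point of \<open>W j\<close> sees no weight of index above \<open>j\<close>, so sums up
  to \<open>N p\<close> contain all nonzero weights at a point \<open>p\<close> of the manifold.
  This bound jumps with \<open>p\<close>; on \<open>W j\<close> it may be replaced by the constant
  \<open>Suc j\<close>, which restores smoothness.\<close>

definition N :: "'a \<Rightarrow> nat" where "N p = Suc (LEAST i. p \<in> W i)"

lemma W_open: "openin M (W i)"
proof -
  have "ball (xx i) (rr i) \<subseteq> cball (xx i) (3 * rr i)" using good_facts(2)[of i] by auto
  then show ?thesis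
    unfolding W_def using good_facts(1,3)[of i] by (intro chart_inv_image_open) auto
qed

lemma W_cover: "p \<in> topspace M \<Longrightarrow> \<exists>i. p \<in> W i"
  using cover unfolding W_def by blast

lemma \<beta>_range: "0 \<le> \<beta> i p" "\<beta> i p \<le> 1"
  using bb(2,3) by (auto simp: \<beta>_def)

lemma \<beta>_W:
  assumes "p \<in> W i"
  shows "\<beta> i p = 1"
proof -
  obtain x where x: "x \<in> ball (xx i) (rr i)" "p = chart_inv (cc i) x" using assms unfolding W_def by blast
  have "x \<in> chart_image (cc i)" using x(1) ball_in_chart(1)[of i] good_facts(2)[of i] by (auto simp: subset_iff)
  then show ?thesis using x chart_inv_mem[of x "cc i"] bb(4)[of x i] by (simp add: \<beta>_def)
qed

lemma \<eta>_nonneg: "0 \<le> \<eta> i p"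
  unfolding \<eta>_def using \<beta>_range by (intro mult_nonneg_nonneg prod_nonneg) auto

lemma \<eta>_nonzero:
  assumes "\<eta> i p \<noteq> 0"
  shows "p \<in> fst (cc i)" "snd (cc i) p \<in> ball (xx i) (2 * rr i)"
proof -
  have "\<beta> i p \<noteq> 0" using assms by (auto simp: \<eta>_def)
  then show p: "p \<in> fst (cc i)" and "snd (cc i) p \<in> ball (xx i) (2 * rr i)"
  proof -
    assume "\<beta> i p \<noteq> 0"
    then have "snd (cc i) p \<in> ball (xx i) (3 / 2 * rr i)"
      using bb(5)[of "snd (cc i) p" i] unfolding \<beta>_def by presburger
    then show "snd (cc i) p \<in> ball (xx i) (2 * rr i)"
      using good_facts(2)[of i] unfolding mem_ball by linarith
  qed (auto simp: \<beta>_def split: if_splits)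
qed

lemma \<eta>_zero: "p \<in> W j \<Longrightarrow> j < i \<Longrightarrow> \<eta> i p = 0"
  unfolding \<eta>_def using \<beta>_W[of p j] by (auto intro!: bexI[of _ j])

lemma \<eta>_sum_W:
  assumes "p \<in> W j" "j < n"
  shows "(\<Sum>i<n. \<eta> i p) = 1"
proof -
  have "(\<Sum>i<n. \<eta> i p) = 1 - (\<Prod>l<n. 1 - \<beta> l p)"
    by (induction n) (auto simp: \<eta>_def algebra_simps)
  moreover have "(\<Prod>l<n. 1 - \<beta> l p) = 0"
    using assms \<beta>_W[of p j] by (auto intro!: bexI[of _ j])
  ultimately show ?thesis by simp
qed

lemma N_mem:
  assumes "p \<in> topspace M"
  shows "p \<in> W (N p - 1)" "N p - 1 < N p"
  using LeastI_ex[OF W_cover[OF assms]] by (simp_all add: N_def)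

lemma \<eta>_sum: "p \<in> topspace M \<Longrightarrow> (\<Sum>i<N p. \<eta> i p) = 1"
  using N_mem \<eta>_sum_W by blast

lemma N_sum:
  assumes "p \<in> W j"
  shows "(\<Sum>i<N p. \<eta> i p * f i) = (\<Sum>i<Suc j. \<eta> i p * f i)"
proof (rule sum.mono_neutral_left)
  have p: "p \<in> topspace M" using assms openin_subset[OF W_open] by blast
  show "{..<N p} \<subseteq> {..<Suc j}" using Least_le[of "\<lambda>i. p \<in> W i" j] assms by (auto simp: N_def)
  show "\<forall>i\<in>{..<Suc j} - {..<N p}. \<eta> i p * f i = 0"
    using \<eta>_zero[OF N_mem(1)[OF p]] N_mem(2)[OF p] by auto
qed simp

text \<open>The dichotomy behind the smoothness of everything glued: near a point of another chart,
  either the transition into the ball of radius \<open>2 * rr i\<close> is available, or the cutoff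
  vanishes identically. The cases are exhaustive because the cutoff lives in the smaller closed ball
  of radius \<open>3 / 2 * rr i\<close>.\<close>

lemma nbhd_cases:
  assumes d: "d \<in> A" and x: "x \<in> chart_image d"
  obtains U where "open U" "x \<in> U" "U \<subseteq> overlap d (cc i)" "transition d (cc i) ` U \<subseteq> ball (xx i) (2 * rr i)"
  | U where "open U" "x \<in> U" "U \<subseteq> chart_image d" "\<And>y. y \<in> U \<Longrightarrow> \<beta> i (chart_inv d y) = 0"
proof -
  let ?p = "chart_inv d x" and ?B = "chart_inv (cc i) ` ball (xx i) (2 * rr i)"
    and ?K = "chart_inv (cc i) ` cball (xx i) (3 / 2 * rr i)"
  note B = chart_inv_image[OF good_facts(1) ball_in_chart(1), of i] and K = chart_inv_image[OF good_facts(1) ball_in_chart(2), of i]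
  show thesis
  proof (cases "?p \<in> ?B")
    case True
    let ?U = "{y \<in> chart_image d. chart_inv d y \<in> ?B}"
    have sub: "?U \<subseteq> overlap d (cc i)" unfolding B by (auto simp: overlap_def)
    show thesis
    proof (rule that(1))
      show "open ?U"
        by (rule chart_preimage_open[OF d chart_inv_image_open[OF good_facts(1) _ ball_in_chart(1)]]) simp
      show "transition d (cc i) ` ?U \<subseteq> ball (xx i) (2 * rr i)"
      proof
        fix z assume "z \<in> transition d (cc i) ` ?U"
        then obtain y where y: "y \<in> ?U" "z = transition d (cc i) y" by blast
        then have "z = snd (cc i) (chart_inv d y)" using transition_overlap(2)[OF good_facts(1) d] sub by blast
        then show "z \<in> ball (xx i) (2 * rr i)" using y(1) unfolding B by simp
      qed
    qed (use True x sub in auto)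
  next
    case False
    let ?U = "{y \<in> chart_image d. chart_inv d y \<in> topspace M - ?K}"
    have "?p \<notin> ?K" using False good_facts(2)[of i] unfolding B K by auto
    show thesis
    proof (rule that(2))
      have "closedin M ?K" by (rule chart_inv_image_closed[OF good_facts(1) _ ball_in_chart(2)]) simp
      then show "open ?U" by (intro chart_preimage_open[OF d] openin_diff) auto
      show "x \<in> ?U" using x \<open>?p \<notin> ?K\<close> chart_inv_space[OF d x] by simp
      show "\<beta> i (chart_inv d y) = 0" if "y \<in> ?U" for y
        using that bb(5)[of "snd (cc i) (chart_inv d y)" i] unfolding K by (auto simp: \<beta>_def)
    qed auto
  qed
qed

lemma \<beta>_smooth:
  assumes d: "d \<in> A"
  shows "smooth_on (chart_image d) (\<lambda>x. \<beta> i (chart_inv d x))"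
proof (rule smooth_on_local)
  fix x assume x: "x \<in> chart_image d"
  show "\<exists>U. open U \<and> x \<in> U \<and> smooth_on U (\<lambda>x. \<beta> i (chart_inv d x))"
  proof (rule nbhd_cases[OF d x, of i])
    fix U assume U: "open U" "x \<in> U" "U \<subseteq> overlap d (cc i)"
    have "smooth_on U (\<lambda>y. bb i (transition d (cc i) y))"
      by (rule smooth_on_compose[OF U(1) open_UNIV bb(1) smooth_on_subset[OF transition_overlap(1)[OF good_facts(1) d] U(3)]]) simp
    moreover have "\<beta> i (chart_inv d y) = bb i (transition d (cc i) y)" if "y \<in> U" for y
    proof -
      have "y \<in> overlap d (cc i)" using U(3) that by blast
      then show ?thesis using transition_overlap(2)[OF good_facts(1) d] overlapD(2)[of y d "cc i"] by (simp add: \<beta>_def)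
    qed
    ultimately have "smooth_on U (\<lambda>x. \<beta> i (chart_inv d x))" using smooth_on_cong[OF U(1)] by (metis (no_types, lifting))
    then show ?thesis using U by blast
  next
    fix U assume U: "open U" "x \<in> U" and z: "\<And>y. y \<in> U \<Longrightarrow> \<beta> i (chart_inv d y) = 0"
    have "smooth_on U (\<lambda>x. \<beta> i (chart_inv d x))"
      by (subst smooth_on_cong[OF U(1) z]) (auto simp: smooth_on_const)
    then show ?thesis using U by blast
  qed
qed

lemma \<eta>_smooth: "d \<in> A \<Longrightarrow> smooth_on (chart_image d) (\<lambda>x. \<eta> i (chart_inv d x))"
  unfolding \<eta>_def by (intro smooth_on_mult smooth_on_prod smooth_on_minus smooth_on_const \<beta>_smooth chart_open(2))

end

section \<open>The glued metrics\<close>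

lemma bilinear_double_sum:
  fixes c :: "'e::euclidean_space \<Rightarrow> 'e \<Rightarrow> real"
  shows "bilinear (\<lambda>v w. \<Sum>j\<in>Basis. \<Sum>k\<in>Basis. (v \<bullet> j) * (w \<bullet> k) * c j k)"
  unfolding bilinear_def
  by (auto intro!: linearI simp: inner_add_left distrib_right distrib_left sum.distrib sum_distrib_left mult_ac)

context gluing
begin

text \<open>\<open>\<Phi> i j k\<close> and \<open>\<Phi> i k j\<close> approximate the same function, but are chosen independently.\<close>

definition \<Psi> :: "nat \<Rightarrow> real \<Rightarrow> 'e \<Rightarrow> 'e \<Rightarrow> 'e \<Rightarrow> real" where
  "\<Psi> i \<epsilon> x v w = (\<Sum>j\<in>Basis. \<Sum>k\<in>Basis. (v \<bullet> j) * (w \<bullet> k) * ((\<Phi> i j k \<epsilon> x + \<Phi> i k j \<epsilon> x) / 2))"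

text \<open>The sign \<open>s = 1\<close> adds a multiple of \<open>h\<close> and narrows the cones,
  \<open>s = -1\<close> widens them. Where \<open>p\<close> lies outside a chart, the weight is zero
  and the meaningless coordinates do not matter.\<close>

definition G :: "real \<Rightarrow> real \<Rightarrow> ('a, 'e) tensor2" where
  "G s \<epsilon> p X Y = (\<Sum>i<N p. \<eta> i p * (\<Psi> i \<epsilon> (snd (cc i) p) (X (cc i)) (Y (cc i)) + s * flat 0 \<epsilon> * kk i * h p X Y))"

definition \<kappa> :: "'a \<Rightarrow> real" where "\<kappa> p = (\<Sum>i<N p. \<eta> i p * kk i)"

lemma \<Psi>_form: "symmetric_bilinear (\<Psi> i \<epsilon> x)"
proof -
  let ?c = "\<lambda>j k. (\<Phi> i j k \<epsilon> x + \<Phi> i k j \<epsilon> x) / 2"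
  have "\<Psi> i \<epsilon> x v w = \<Psi> i \<epsilon> x w v" for v w
  proof -
    have "\<Psi> i \<epsilon> x v w = (\<Sum>k\<in>Basis. \<Sum>j\<in>Basis. (v \<bullet> j) * (w \<bullet> k) * ?c j k)"
      unfolding \<Psi>_def by (rule sum.swap)
    also have "\<dots> = \<Psi> i \<epsilon> x w v" unfolding \<Psi>_def by (simp add: add.commute mult_ac)
    finally show ?thesis .
  qed
  moreover have "bilinear (\<Psi> i \<epsilon> x)"
    unfolding \<Psi>_def[abs_def] by (rule bilinear_double_sum)
  ultimately show ?thesis unfolding symmetric_bilinear_def by blast
qed

lemma \<Psi>_Basis:
  assumes "j \<in> Basis" "k \<in> Basis"
  shows "\<Psi> i \<epsilon> x j k = (\<Phi> i j k \<epsilon> x + \<Phi> i k j \<epsilon> x) / 2"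
proof -
  have "\<Psi> i \<epsilon> x j k = (\<Sum>j'\<in>Basis. \<Sum>k'\<in>Basis. if j' = j then (if k' = k then (\<Phi> i j k \<epsilon> x + \<Phi> i k j \<epsilon> x) / 2 else 0) else 0)"
    unfolding \<Psi>_def using assms by (intro sum.cong) (auto simp: inner_Basis)
  also have "\<dots> = (\<Sum>j'\<in>Basis. if j' = j then (\<Sum>k'\<in>Basis. if k' = k then (\<Phi> i j k \<epsilon> x + \<Phi> i k j \<epsilon> x) / 2 else 0) else 0)"
    by (intro sum.cong) auto
  also have "\<dots> = (\<Phi> i j k \<epsilon> x + \<Phi> i k j \<epsilon> x) / 2" using assms by simp
  finally show ?thesis .
qed

text \<open>The constants in \<open>\<Phi>_close\<close> are made for this: the squared dimension
  cancels, and \<open>mm i\<close> times the squared norm is at most \<open>h\<close>.\<close>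

lemma \<Psi>_close:
  assumes \<epsilon>: "0 < \<epsilon>" and x: "x \<in> ball (xx i) (2 * rr i)"
  shows "\<bar>\<Psi> i \<epsilon> x v v - coeff A (cc i) g v v x\<bar> \<le> flat 0 \<epsilon> / 2 * kk i * coeff A (cc i) h v v x"
proof -
  let ?D = "(real DIM('e))\<^sup>2" and ?g = "\<lambda>v w. coeff A (cc i) g v w x"
  have xc: "x \<in> chart_image (cc i)" using ball_in_chart(1) x by blast
  have gf: "symmetric_bilinear ?g" using g_form[OF good_facts(1) xc] by (simp add: lorentz_form_def)
  define d where "d = kk i * mm i / (2 * ?D) * flat 0 \<epsilon>"
  have E: "bilinear (\<lambda>v w. \<Psi> i \<epsilon> x v w - ?g v w)"
    using symmetric_bilinear_diff[OF \<Psi>_form gf] by (simp add: symmetric_bilinear_def)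
  have "\<bar>\<Psi> i \<epsilon> x j k - ?g j k\<bar> \<le> d" if "j \<in> Basis" "k \<in> Basis" for j k
  proof -
    have avg: "\<bar>(a + b) / 2 - c\<bar> \<le> d" if "\<bar>a - c\<bar> \<le> d" "\<bar>b - c\<bar> \<le> d" for a b c :: real
      using that by (simp add: abs_le_iff field_simps)
    show ?thesis
      using \<Phi>_close[OF that \<epsilon> x] \<Phi>_close[OF that(2,1) \<epsilon> x] symmetric_bilinear_facts(5)[OF gf, of k j]
      unfolding \<Psi>_Basis[OF that] d_def[symmetric] by (intro avg) simp_all
  qed
  then have "\<bar>\<Psi> i \<epsilon> x v v - ?g v v\<bar> \<le> d * ?D * (norm v * norm v)"
    using bilinear_form_bound[OF E, of d v v] by blast
  also have "\<dots> = flat 0 \<epsilon> / 2 * kk i * (mm i * (norm v)\<^sup>2)"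
    by (simp add: d_def power2_eq_square)
  also have "\<dots> \<le> flat 0 \<epsilon> / 2 * kk i * coeff A (cc i) h v v x"
    using goodness[of i] x flat_0_props(1)[of \<epsilon>] unfolding good_def by (intro mult_left_mono) auto
  finally show ?thesis .
qed

section \<open>Signature, cones and distance of the glued metrics\<close>

lemma G_estimate:
  assumes p: "p \<in> topspace M" and \<epsilon>: "0 < \<epsilon>" and X: "X \<in> tangent_space A p"
  shows "\<bar>G s \<epsilon> p X X - g p X X - s * flat 0 \<epsilon> * \<kappa> p * h p X X\<bar> \<le> flat 0 \<epsilon> / 2 * \<kappa> p * h p X X"
proof -
  let ?P = "\<lambda>i. \<Psi> i \<epsilon> (snd (cc i) p) (X (cc i)) (X (cc i))"
  \<comment> \<open>Since the weights sum to 1, \<open>g p X X\<close> is its own weighted average.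
    The multiples of \<open>h\<close> cancel, and the claim reduces to \<open>\<Psi>_close\<close>
    in each active chart.\<close>
  have "G s \<epsilon> p X X - g p X X - s * flat 0 \<epsilon> * \<kappa> p * h p X X =
      G s \<epsilon> p X X - (\<Sum>i<N p. \<eta> i p) * g p X X - s * flat 0 \<epsilon> * \<kappa> p * h p X X"
    using \<eta>_sum[OF p] by simp
  also have "\<dots> = (\<Sum>i<N p. \<eta> i p * (?P i - g p X X))"
    by (simp add: G_def \<kappa>_def sum_distrib_left sum_distrib_right sum_subtractf[symmetric] algebra_simps sum.distrib)
  also have "\<bar>\<dots>\<bar> \<le> (\<Sum>i<N p. \<eta> i p * (flat 0 \<epsilon> / 2 * kk i * h p X X))"
  proof (rule order_trans[OF sum_abs sum_mono])
    fix i
    show "\<bar>\<eta> i p * (?P i - g p X X)\<bar> \<le> \<eta> i p * (flat 0 \<epsilon> / 2 * kk i * h p X X)"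
    proof (cases "\<eta> i p = 0")
      case False
      have "\<bar>?P i - g p X X\<bar> \<le> flat 0 \<epsilon> / 2 * kk i * h p X X"
        using \<Psi>_close[OF \<epsilon> \<eta>_nonzero(2)[OF False], of "X (cc i)"]
        by (simp add: coeff_at_tangent[OF good_facts(1) \<eta>_nonzero(1)[OF False] X X])
      from mult_left_mono[OF this \<eta>_nonneg[of i p]] show ?thesis
        unfolding abs_mult abs_of_nonneg[OF \<eta>_nonneg] .
    qed simp
  qed
  also have "\<dots> = flat 0 \<epsilon> / 2 * \<kappa> p * h p X X"
    by (simp add: \<kappa>_def sum_distrib_left sum_distrib_right mult_ac)
  finally show ?thesis .
qed

text \<open>\<open>\<kappa> p\<close> is a weighted mean of the constants of the active balls, so
  the largest of these dominates it. The ball so selected provides the chart in which the signature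
  is tested.\<close>

lemma \<kappa>_active:
  assumes p: "p \<in> topspace M"
  obtains i where "\<eta> i p \<noteq> 0" "\<kappa> p \<le> kk i" "0 < \<kappa> p"
proof -
  let ?I = "{i. i < N p \<and> \<eta> i p \<noteq> 0}"
  have "?I \<noteq> {}"
  proof
    assume "?I = {}"
    then have "(\<Sum>i<N p. \<eta> i p) = 0" by (intro sum.neutral) auto
    then show False using \<eta>_sum[OF p] by simp
  qed
  moreover have fin: "finite ?I" by simp
  ultimately have "Max (kk ` ?I) \<in> kk ` ?I" by (intro Max_in) auto
  then obtain i where i: "i \<in> ?I" "kk i = Max (kk ` ?I)" by force
  have imax: "kk l \<le> kk i" if "l \<in> ?I" for l
    unfolding i(2) using that fin by (intro Max_ge) auto
  have "\<kappa> p \<le> (\<Sum>l<N p. \<eta> l p * kk i)"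
    unfolding \<kappa>_def
  proof (rule sum_mono)
    fix l assume "l \<in> {..<N p}"
    then show "\<eta> l p * kk l \<le> \<eta> l p * kk i"
      using imax[of l] \<eta>_nonneg[of l p] by (cases "\<eta> l p = 0") (auto intro: mult_left_mono)
  qed
  also have "\<dots> = kk i" using \<eta>_sum[OF p] by (simp flip: sum_distrib_right)
  finally have le: "\<kappa> p \<le> kk i" .
  have "0 < \<eta> i p * kk i" using i(1) \<eta>_nonneg[of i p] good_facts(4)[of i] by simp
  also have "\<dots> \<le> \<kappa> p"
    unfolding \<kappa>_def
  proof (rule member_le_sum)
    show "0 \<le> \<eta> l p * kk l" for l by (intro mult_nonneg_nonneg \<eta>_nonneg less_imp_le[OF good_facts(4)])
  qed (use i(1) in auto)
  finally show ?thesis using that[of i] le i(1) by blast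
qed

lemma h_positive:
  assumes p: "p \<in> topspace M" and X: "X \<in> nonzero_tangent A p"
  shows "0 < h p X X"
proof -
  obtain c where c: "c \<in> A" "p \<in> fst c" using p mfd unfolding smooth_manifold_def by (metis UN_E)
  have "0 < coeff A c h (X c) (X c) (snd c p)"
    using h_form[OF c(1) chart_image_mem[OF c(2)]] nonzero_tangent_coord(2)[OF c X] by (simp add: positive_form_def)
  then show ?thesis using coeff_at_tangent[OF c] nonzero_tangent_coord(1)[OF c X] by metis
qed

lemma G_coeff_form:
  assumes d: "d \<in> A" and x: "x \<in> chart_image d"
  shows "symmetric_bilinear (\<lambda>v w. coeff A d (G s \<epsilon>) v w x)"
proof -
  let ?p = "chart_inv d x" let ?t = "\<lambda>i v. tangent_vec A d ?p v (cc i)"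
  have "symmetric_bilinear (\<lambda>v w. \<eta> i ?p * (\<Psi> i \<epsilon> (snd (cc i) ?p) (?t i v) (?t i w) + s * flat 0 \<epsilon> * kk i * coeff A d h v w x))" for i
  proof (cases "\<eta> i ?p = 0")
    case True
    then show ?thesis by (simp add: symmetric_bilinear_zero)
  next
    case False
    then have o: "x \<in> overlap d (cc i)" using \<eta>_nonzero(1)[OF False] x by (simp add: overlap_def)
    have "linear (?t i)"
      unfolding tangent_vec_transition[OF good_facts(1) d o] by (rule partial_transition_linear[OF good_facts(1) d o])
    moreover have "symmetric_bilinear (\<lambda>v w. coeff A d h v w x)" using h_form[OF d x] by (simp add: positive_form_def)
    ultimately show ?thesis
      by (intro symmetric_bilinear_cmul symmetric_bilinear_add symmetric_bilinear_compose[OF \<Psi>_form])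
  qed
  from symmetric_bilinear_sum[OF this, where I = "{..<N ?p}"] show ?thesis
    by (simp add: coeff_def G_def)
qed

text \<open>The shift contributes 1 to the factor and the approximation error at most
  \<open>1 / 2\<close>.\<close>

lemma G_quadratic_close:
  assumes p: "p \<in> topspace M" and \<epsilon>: "0 < \<epsilon>" and X: "X \<in> tangent_space A p" and s: "\<bar>s\<bar> = 1"
    and h: "0 \<le> h p X X"
  shows "\<bar>G s \<epsilon> p X X - g p X X\<bar> \<le> 3 / 2 * flat 0 \<epsilon> * \<kappa> p * h p X X"
proof -
  obtain i where "0 < \<kappa> p" using \<kappa>_active[OF p] by blast
  then have "\<bar>s * flat 0 \<epsilon> * \<kappa> p * h p X X\<bar> = flat 0 \<epsilon> * \<kappa> p * h p X X"
    using s h flat_0_props(1)[of \<epsilon>] by (simp add: abs_mult)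
  then show ?thesis using G_estimate[OF p \<epsilon> X, of s] by linarith
qed

lemma coeff_G_close:
  assumes c: "c \<in> A" "x \<in> chart_image c" and \<epsilon>: "0 < \<epsilon>" and s: "\<bar>s\<bar> = 1"
  shows "\<bar>coeff A c (G s \<epsilon>) v v x - coeff A c g v v x\<bar> \<le> 3 / 2 * flat 0 \<epsilon> * \<kappa> (chart_inv c x) * coeff A c h v v x"
  unfolding coeff_def
proof (rule G_quadratic_close[OF chart_inv_space[OF c] \<epsilon> _ s])
  show "tangent_vec A c (chart_inv c x) v \<in> tangent_space A (chart_inv c x)"
    by (rule tangent_vec_in_tangent_space(1)[OF mfd]) (use c chart_inv_mem in \<open>simp add: charts_at_def\<close>)
  show "0 \<le> h (chart_inv c x) (tangent_vec A c (chart_inv c x) v) (tangent_vec A c (chart_inv c x) v)"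
    using h_form[OF c] symmetric_bilinear_facts(8)[of "\<lambda>v w. coeff A c h v w x" v] unfolding positive_form_def coeff_def
    by (cases "v = 0") (auto intro: less_imp_le)
qed

lemma G_lorentzian:
  assumes \<epsilon>: "0 < \<epsilon>" and s: "\<bar>s\<bar> = 1"
  shows "lorentzian_metric A (G s \<epsilon>)"
  unfolding lorentzian_metric_def
proof (intro ballI)
  fix d x assume d: "d \<in> A" and x: "x \<in> chart_image d"
  let ?p = "chart_inv d x"
  obtain i where i: "\<eta> i ?p \<noteq> 0" "\<kappa> ?p \<le> kk i" "0 < \<kappa> ?p" using \<kappa>_active[OF chart_inv_space[OF d x]] .
  have o: "x \<in> overlap d (cc i)" using \<eta>_nonzero(1)[OF i(1)] x by (simp add: overlap_def)
  let ?y = "transition d (cc i) x"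
  have y: "?y \<in> ball (xx i) (2 * rr i)" "?y \<in> chart_image (cc i)" "chart_inv (cc i) ?y = ?p"
    using transition_overlap(2-4)[OF good_facts(1) d o] \<eta>_nonzero(2)[OF i(1)] by simp_all
  have "lorentz_form (\<lambda>v w. coeff A (cc i) (G s \<epsilon>) v w ?y)"
  proof -
    have "\<bar>coeff A (cc i) (G s \<epsilon>) v v ?y - coeff A (cc i) g v v ?y\<bar> \<le> 2 * kk i * coeff A (cc i) h v v ?y" for v
    proof -
      have hp: "0 \<le> coeff A (cc i) h v v ?y"
      proof -
        have "0 \<le> mm i * (norm v)\<^sup>2" using good_facts(6)[of i] by simp
        then show ?thesis using goodness[of i] y(1) order_trans unfolding good_def by blast
      qed
      \<comment> \<open>The bound \<open>flat 0 \<epsilon> \<le> 1\<close> puts the deviation within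
        the tolerance \<open>2 * kk i\<close> of the selected ball for every positive
        \<epsilon>.\<close>
      have "flat 0 \<epsilon> * \<kappa> ?p \<le> 1 * kk i" using i flat_0_props(1,4)[of \<epsilon>] by (intro mult_mono) auto
      then have "3 / 2 * flat 0 \<epsilon> * \<kappa> ?p \<le> 2 * kk i" using good_facts(4)[of i] by linarith
      then have "3 / 2 * flat 0 \<epsilon> * \<kappa> ?p * coeff A (cc i) h v v ?y \<le> 2 * kk i * coeff A (cc i) h v v ?y"
        using hp by (intro mult_right_mono)
      then show ?thesis using coeff_G_close[OF good_facts(1) y(2) \<epsilon> s, of v] unfolding y(3) by linarith
    qed
    then show ?thesis using goodness[of i] y(1) G_coeff_form[OF good_facts(1) y(2)] unfolding good_def by blast
  qed
  then show "lorentz_form (\<lambda>v w. coeff A d (G s \<epsilon>) v w x)"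
    by (rule lorentz_form_change_chart[OF good_facts(1) d o])
qed

lemma G_cones:
  assumes \<epsilon>: "0 < \<epsilon>"
  shows "strictly_larger_cones M A g (G (-1) \<epsilon>)" "strictly_larger_cones M A (G 1 \<epsilon>) g"
proof -
  have *: "0 < flat 0 \<epsilon> * \<kappa> p * h p X X" "X \<in> tangent_space A p"
    if p: "p \<in> topspace M" and X: "X \<in> nonzero_tangent A p" for p X
  proof -
    obtain i where "0 < \<kappa> p" using \<kappa>_active[OF p] by blast
    then show "0 < flat 0 \<epsilon> * \<kappa> p * h p X X" using h_positive[OF p X] flat_0_props(2)[OF \<epsilon>] by simp
    show "X \<in> tangent_space A p" using X by (simp add: nonzero_tangent_def)
  qed
  have "G (-1) \<epsilon> p X X < 0" if "p \<in> topspace M" "X \<in> nonzero_tangent A p" "g p X X \<le> 0" for p X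
    using G_estimate[OF that(1) \<epsilon> *(2)[OF that(1,2)], of "-1"] *(1)[OF that(1,2)] that(3) by linarith
  then show "strictly_larger_cones M A g (G (-1) \<epsilon>)" unfolding strictly_larger_cones_def by blast
  have "g p X X < 0" if "p \<in> topspace M" "X \<in> nonzero_tangent A p" "G 1 \<epsilon> p X X \<le> 0" for p X
    using G_estimate[OF that(1) \<epsilon> *(2)[OF that(1,2)], of 1] *(1)[OF that(1,2)] that(3) by linarith
  then show "strictly_larger_cones M A (G 1 \<epsilon>) g" unfolding strictly_larger_cones_def by blast
qed

lemma G_dist:
  assumes \<epsilon>: "0 < \<epsilon>" and s: "\<bar>s\<bar> = 1"
  shows "metric_dist M A h (G s \<epsilon>) g \<le> ennreal (flat 0 \<epsilon> / 4)"
  unfolding metric_dist_def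
proof (intro SUP_least ennreal_leI)
  fix p X Y assume p: "p \<in> topspace M" and X: "X \<in> nonzero_tangent A p" and Y: "Y \<in> nonzero_tangent A p"
  obtain c where c: "c \<in> A" "p \<in> fst c" using p mfd unfolding smooth_manifold_def by (metis UN_E)
  let ?x = "snd c p"
  have x: "?x \<in> chart_image c" by (rule chart_image_mem[OF c(2)])
  have px: "chart_inv c ?x = p" using c by simp
  obtain i where i: "\<kappa> p \<le> kk i" "0 < \<kappa> p" using \<kappa>_active[OF p] by blast
  have T: "X \<in> tangent_space A p" "Y \<in> tangent_space A p" using X Y by (auto simp: nonzero_tangent_def)
  let ?E = "\<lambda>v w. coeff A c (G s \<epsilon>) v w ?x - coeff A c g v w ?x" and ?h = "\<lambda>v w. coeff A c h v w ?x"
  have "symmetric_bilinear ?E"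
    using g_form[OF c(1) x] by (intro symmetric_bilinear_diff G_coeff_form[OF c(1) x]) (simp add: lorentz_form_def)
  then have "\<bar>?E (X c) (Y c)\<bar> \<le> 3 / 2 * flat 0 \<epsilon> * \<kappa> p * (sqrt (?h (X c) (X c)) * sqrt (?h (Y c) (Y c)))"
    using coeff_G_close[OF c(1) x \<epsilon> s] unfolding px by (intro polarization_bound h_form[OF c(1) x])
  then have "\<bar>G s \<epsilon> p X Y - g p X Y\<bar> \<le> 3 / 2 * flat 0 \<epsilon> * \<kappa> p * (sqrt (h p X X) * sqrt (h p Y Y))"
    by (simp add: coeff_at_tangent[OF c] T)
  \<comment> \<open>This is where \<open>kk i \<le> 1 / 8\<close> enters: the factor is at most
    \<open>3 / 16\<close>. The two distances then add up to at most half of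
    \<open>flat 0 \<epsilon>\<close>.\<close>
  moreover have "3 / 2 * flat 0 \<epsilon> * \<kappa> p \<le> flat 0 \<epsilon> / 4"
  proof -
    have "flat 0 \<epsilon> * \<kappa> p \<le> flat 0 \<epsilon> * (1 / 8)"
      using i good_facts(5)[of i] flat_0_props(1)[of \<epsilon>] by (intro mult_left_mono) auto
    then show ?thesis using flat_0_props(1)[of \<epsilon>] by linarith
  qed
  moreover have pos: "0 < sqrt (h p X X) * sqrt (h p Y Y)" using h_positive[OF p] X Y by simp
  ultimately have "\<bar>G s \<epsilon> p X Y - g p X Y\<bar> \<le> flat 0 \<epsilon> / 4 * (sqrt (h p X X) * sqrt (h p Y Y))"
    by (meson less_imp_le mult_right_mono order_trans)
  then show "\<bar>G s \<epsilon> p X Y - g p X Y\<bar> / (sqrt (h p X X) * sqrt (h p Y Y)) \<le> flat 0 \<epsilon> / 4"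
    using pos by (simp add: divide_le_eq)
qed

lemma G_dist_sum:
  assumes \<epsilon>: "0 < \<epsilon>"
  shows "metric_dist M A h (G 1 \<epsilon>) g + metric_dist M A h (G (-1) \<epsilon>) g < ennreal \<epsilon>"
proof -
  have "metric_dist M A h (G 1 \<epsilon>) g + metric_dist M A h (G (-1) \<epsilon>) g \<le> ennreal (flat 0 \<epsilon> / 4) + ennreal (flat 0 \<epsilon> / 4)"
    using \<epsilon> by (intro add_mono G_dist) auto
  also have "\<dots> = ennreal (flat 0 \<epsilon> / 2)" using flat_0_props(1)[of \<epsilon>] by (simp flip: ennreal_plus)
  also have "\<dots> < ennreal \<epsilon>" using flat_0_props(1,6)[of \<epsilon>] \<epsilon> by (intro ennreal_lessI) auto
  finally show ?thesis .
qed

end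

section \<open>Smoothness and C1 convergence of the glued metrics\<close>

lemma smooth_on_section:
  fixes F :: "real \<Rightarrow> 'e::euclidean_space \<Rightarrow> real"
  assumes "smooth_on ({0<..} \<times> V) (\<lambda>(\<epsilon>, x). F \<epsilon> x)" "open V" "0 < \<epsilon>"
  shows "smooth_on V (F \<epsilon>)"
proof -
  have "smooth_on V (\<lambda>x. (\<lambda>(\<epsilon>, x). F \<epsilon> x) (\<epsilon>, x))"
    using assms
    by (intro smooth_on_compose[OF assms(2) _ assms(1)] smooth_on_Pair smooth_on_const smooth_on_ident open_Times) auto
  then show ?thesis by simp
qed

lemma smooth_on_snd:
  fixes f :: "'e::euclidean_space \<Rightarrow> real"
  assumes "open U" "smooth_on U f"
  shows "smooth_on ({0<..} \<times> U) (\<lambda>z :: real \<times> 'e. f (snd z))"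
proof -
  have o: "open ({0<..} \<times> U :: (real \<times> 'e) set)" using assms(1) by (intro open_Times) auto
  show ?thesis
    by (rule smooth_on_compose[OF o assms(1,2) smooth_on_bounded_linear[OF bounded_linear_snd o smooth_on_ident]]) auto
qed

text \<open>As a function of the point this is constant, so all derivatives vanish; the bound 1 also
  covers large \<epsilon>. It makes the added multiple of \<open>h\<close> disappear in the
  limit.\<close>

lemma C1_near_flat: "C1_near (\<lambda>\<epsilon> y. flat 0 \<epsilon>) (\<lambda>y. 0) (x :: 'e::euclidean_space)"
  unfolding C1_near_def near_bdd_C.simps partial_deriv_const
proof (intro conjI ballI)
  show "near_smooth (\<lambda>\<epsilon> (y::'e). flat 0 \<epsilon>) x"
    unfolding near_smooth_def by (intro exI[of _ UNIV]) (auto simp: smooth_on_const)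
  show "\<exists>U. open U \<and> x \<in> U \<and> Ck_on (Suc 0) U (\<lambda>y. 0::real)"
    by (intro exI[of _ UNIV] conjI Ck_on_const) auto
  have "filterlim (\<lambda>p. flat 0 (fst p)) (nhds 0) (at_right (0::real) \<times>\<^sub>F nhds x)"
    by (rule filterlim_compose[OF tendsto_mono[OF at_le flat_tendsto_0[of 0]] filterlim_fst]) simp
  then show "near_conv (\<lambda>\<epsilon> (y::'e). flat 0 \<epsilon>) (\<lambda>y. 0) x"
    unfolding near_conv_def split_beta .
  show "near_conv (\<lambda>\<epsilon> (y::'e). 0) (\<lambda>x. 0) x" by (rule near_conv_fixed) simp
  show "near_bdd (\<lambda>\<epsilon> (y::'e). flat 0 \<epsilon>) x"
    by (rule near_bddI[of UNIV _ _ 1]) (auto simp: flat_0_props)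
  show "near_bdd (\<lambda>\<epsilon> (y::'e). 0) x" "near_bdd (\<lambda>\<epsilon> (y::'e). 0) x"
    by (rule near_bdd_fixed, simp)+
qed

context gluing
begin

text \<open>The coefficient in the chart \<open>d\<close> of the \<open>i\<close>-th summand of
  \<open>G\<close>, without its multiple of \<open>h\<close>.\<close>

definition piece :: "nat \<Rightarrow> ('a, 'e) chart \<Rightarrow> 'e \<Rightarrow> 'e \<Rightarrow> real \<Rightarrow> 'e \<Rightarrow> real" where
  "piece i d v w \<epsilon> x = \<eta> i (chart_inv d x) * \<Psi> i \<epsilon> (snd (cc i) (chart_inv d x))
     (tangent_vec A d (chart_inv d x) v (cc i)) (tangent_vec A d (chart_inv d x) w (cc i))"

lemma \<beta>_zero_imp_\<eta>_zero: "\<beta> i p = 0 \<Longrightarrow> \<eta> i p = 0"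
  by (simp add: \<eta>_def)

lemma piece_overlap:
  assumes d: "d \<in> A" and x: "x \<in> overlap d (cc i)"
  shows "piece i d v w \<epsilon> x = \<eta> i (chart_inv d x) * (\<Sum>j\<in>Basis. \<Sum>k\<in>Basis.
     (partial_deriv v (transition d (cc i)) x \<bullet> j) * (partial_deriv w (transition d (cc i)) x \<bullet> k) *
     (1 / 2 * (\<Phi> i j k \<epsilon> (transition d (cc i) x) + \<Phi> i k j \<epsilon> (transition d (cc i) x))))"
  unfolding piece_def \<Psi>_def tangent_vec_transition[OF good_facts(1) d x]
    transition_overlap(2)[OF good_facts(1) d x, symmetric] by simp

lemma piece_smooth:
  assumes d: "d \<in> A" and vw: "v \<in> Basis" "w \<in> Basis"
  shows "smooth_on ({0<..} \<times> chart_image d) (\<lambda>(\<epsilon>, x). piece i d v w \<epsilon> x)"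
proof (rule smooth_on_local)
  fix z :: "real \<times> 'e" assume "z \<in> {0<..} \<times> chart_image d"
  then have z: "0 < fst z" "snd z \<in> chart_image d" by auto
  show "\<exists>U. open U \<and> z \<in> U \<and> smooth_on U (\<lambda>(\<epsilon>, x). piece i d v w \<epsilon> x)"
  proof (rule nbhd_cases[OF d z(2), of i])
    fix U assume U: "open U" "snd z \<in> U" "U \<subseteq> overlap d (cc i)" "transition d (cc i) ` U \<subseteq> ball (xx i) (2 * rr i)"
    let ?\<tau> = "transition d (cc i)" and ?V = "{0<..} \<times> U :: (real \<times> 'e) set"
    have V: "open ?V" using U(1) by (intro open_Times) auto
    have \<tau>: "smooth_on U ?\<tau>" by (rule smooth_on_subset[OF transition_overlap(1)[OF good_facts(1) d] U(3)])
    have Uc: "U \<subseteq> chart_image d" using U(3) overlapD(1) by blast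
    have \<Phi>s: "smooth_on ?V (\<lambda>z. \<Phi> i j k (fst z) (?\<tau> (snd z)))" if jk: "j \<in> Basis" "k \<in> Basis" for j k
    proof -
      have "smooth_on ?V (\<lambda>z. (\<lambda>(\<epsilon>, x). \<Phi> i j k \<epsilon> x) (fst z, ?\<tau> (snd z)))"
      proof (rule smooth_on_compose[OF V _ \<Phi>_smooth[OF jk]])
        show "open ({0<..} \<times> ball (xx i) (2 * rr i) :: (real \<times> 'e) set)" by (intro open_Times) auto
        have "smooth_on ?V (\<lambda>z. ?\<tau> (snd z))"
          by (rule smooth_on_compose_euclidean[OF V U(1) \<tau> smooth_on_bounded_linear[OF bounded_linear_snd V smooth_on_ident]]) auto
        then show "smooth_on ?V (\<lambda>z. (fst z, ?\<tau> (snd z)))"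
          by (intro smooth_on_Pair V smooth_on_bounded_linear[OF bounded_linear_fst V smooth_on_ident])
        show "(\<lambda>z. (fst z, ?\<tau> (snd z))) ` ?V \<subseteq> {0<..} \<times> ball (xx i) (2 * rr i)" using U(4) by auto
      qed
      then show ?thesis by simp
    qed
    have "smooth_on ?V (\<lambda>z. \<eta> i (chart_inv d (snd z)) * (\<Sum>j\<in>Basis. \<Sum>k\<in>Basis.
       (partial_deriv v ?\<tau> (snd z) \<bullet> j) * (partial_deriv w ?\<tau> (snd z) \<bullet> k) *
       (1 / 2 * (\<Phi> i j k (fst z) (?\<tau> (snd z)) + \<Phi> i k j (fst z) (?\<tau> (snd z))))))"
      by (intro smooth_on_mult[OF V] smooth_on_sum[OF V] smooth_on_add[OF V] smooth_on_const[of _ "1 / 2"] \<Phi>s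
         smooth_on_snd[OF U(1), of "\<lambda>x. \<eta> i (chart_inv d x)"] smooth_on_snd[OF U(1), of "\<lambda>x. partial_deriv _ ?\<tau> x \<bullet> _"]
         smooth_on_partial_coord[OF U(1) \<tau>] vw smooth_on_subset[OF \<eta>_smooth[OF d] Uc])
    moreover have "(case z of (\<epsilon>, x) \<Rightarrow> piece i d v w \<epsilon> x) = \<eta> i (chart_inv d (snd z)) * (\<Sum>j\<in>Basis. \<Sum>k\<in>Basis.
       (partial_deriv v ?\<tau> (snd z) \<bullet> j) * (partial_deriv w ?\<tau> (snd z) \<bullet> k) *
       (1 / 2 * (\<Phi> i j k (fst z) (?\<tau> (snd z)) + \<Phi> i k j (fst z) (?\<tau> (snd z)))))" if "z \<in> ?V" for z
    proof -
      have "snd z \<in> overlap d (cc i)" using that U(3) by auto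
      from piece_overlap[OF d this] show ?thesis by (simp only: split_beta)
    qed
    ultimately have "smooth_on ?V (\<lambda>(\<epsilon>, x). piece i d v w \<epsilon> x)" by (subst smooth_on_cong[OF V])
    then show ?thesis using V U(2) z(1) by (intro exI[of _ ?V]) (auto simp: mem_Times_iff)
  next
    fix U assume U: "open U" "snd z \<in> U" and zero: "\<And>y. y \<in> U \<Longrightarrow> \<beta> i (chart_inv d y) = 0"
    let ?V = "{0<..} \<times> U :: (real \<times> 'e) set"
    have V: "open ?V" using U(1) by (intro open_Times) auto
    have "(case z of (\<epsilon>, x) \<Rightarrow> piece i d v w \<epsilon> x) = 0" if "z \<in> ?V" for z
      using that zero by (auto simp: piece_def \<beta>_zero_imp_\<eta>_zero)
    then have "smooth_on ?V (\<lambda>(\<epsilon>, x). piece i d v w \<epsilon> x)" by (subst smooth_on_cong[OF V]) (auto simp: smooth_on_const)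
    then show ?thesis using V U(2) z(1) by (intro exI[of _ ?V]) (auto simp: mem_Times_iff)
  qed
qed

text \<open>On the overlap, the transformation law expresses the piece through the
  \<open>\<Phi> i j k\<close> composed with the transition map. The same law applied to the limits
  reassembles the coefficient of \<open>g\<close> in the chart \<open>d\<close>.\<close>

lemma piece_C1:
  assumes d: "d \<in> A" and vw: "v \<in> Basis" "w \<in> Basis" and x: "x \<in> chart_image d" and C11: "C11_tensor A g"
  shows "C1_near (piece i d v w) (\<lambda>y. \<eta> i (chart_inv d y) * coeff A d g v w y) x"
proof (rule nbhd_cases[OF d x, of i])
  fix U assume U: "open U" "x \<in> U" "U \<subseteq> overlap d (cc i)" "transition d (cc i) ` U \<subseteq> ball (xx i) (2 * rr i)"
  let ?\<tau> = "transition d (cc i)"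
  have \<tau>: "smooth_on U ?\<tau>" by (rule smooth_on_subset[OF transition_overlap(1)[OF good_facts(1) d] U(3)])
  have Uc: "U \<subseteq> chart_image d" using U(3) overlapD(1) by blast
  have \<tau>x: "?\<tau> x \<in> ball (xx i) (2 * rr i)" using U(2,4) by blast
  show ?thesis
  proof (rule C1_near_cong[OF _ U(1,2)])
    show "C1_near (\<lambda>\<epsilon> x. \<eta> i (chart_inv d x) * (\<Sum>j\<in>Basis. \<Sum>k\<in>Basis.
        (partial_deriv v ?\<tau> x \<bullet> j) * (partial_deriv w ?\<tau> x \<bullet> k) * (1 / 2 * (\<Phi> i j k \<epsilon> (?\<tau> x) + \<Phi> i k j \<epsilon> (?\<tau> x)))))
      (\<lambda>x. \<eta> i (chart_inv d x) * (\<Sum>j\<in>Basis. \<Sum>k\<in>Basis.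
        (partial_deriv v ?\<tau> x \<bullet> j) * (partial_deriv w ?\<tau> x \<bullet> k) *
        (1 / 2 * (coeff A (cc i) g j k (?\<tau> x) + coeff A (cc i) g k j (?\<tau> x))))) x"
    proof (rule C1_near_mult, rule C1_near_fixed[OF U(1,2) smooth_on_subset[OF \<eta>_smooth[OF d] Uc]],
        rule C1_near_sum, rule C1_near_sum, rule C1_near_mult)
      fix j k :: 'e assume jk: "j \<in> Basis" "k \<in> Basis"
      show "C1_near (\<lambda>\<epsilon> x. (partial_deriv v ?\<tau> x \<bullet> j) * (partial_deriv w ?\<tau> x \<bullet> k))
          (\<lambda>x. (partial_deriv v ?\<tau> x \<bullet> j) * (partial_deriv w ?\<tau> x \<bullet> k)) x"
        by (intro C1_near_fixed[OF U(1,2)] smooth_on_mult[OF U(1)] smooth_on_partial_coord[OF U(1) \<tau>] vw)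
      have 1: "C1_near (\<lambda>\<epsilon> x. \<Phi> i j k \<epsilon> (?\<tau> x)) (\<lambda>x. coeff A (cc i) g j k (?\<tau> x)) x"
        by (rule C1_near_compose[OF U(1,2) \<tau> \<Phi>_C1[OF C11 jk \<tau>x]])
      have 2: "C1_near (\<lambda>\<epsilon> x. \<Phi> i k j \<epsilon> (?\<tau> x)) (\<lambda>x. coeff A (cc i) g k j (?\<tau> x)) x"
        by (rule C1_near_compose[OF U(1,2) \<tau> \<Phi>_C1[OF C11 jk(2,1) \<tau>x]])
      show "C1_near (\<lambda>\<epsilon> x. 1 / 2 * (\<Phi> i j k \<epsilon> (?\<tau> x) + \<Phi> i k j \<epsilon> (?\<tau> x)))
          (\<lambda>x. 1 / 2 * (coeff A (cc i) g j k (?\<tau> x) + coeff A (cc i) g k j (?\<tau> x))) x"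
        by (rule C1_near_mult[OF C1_near_fixed[OF U(1,2) smooth_on_const] C1_near_add[OF 1 2]])
    qed
    fix y assume y: "y \<in> U"
    then have o: "y \<in> overlap d (cc i)" using U(3) by blast
    show "\<eta> i (chart_inv d y) * (\<Sum>j\<in>Basis. \<Sum>k\<in>Basis.
        (partial_deriv v ?\<tau> y \<bullet> j) * (partial_deriv w ?\<tau> y \<bullet> k) * (1 / 2 * (\<Phi> i j k \<epsilon> (?\<tau> y) + \<Phi> i k j \<epsilon> (?\<tau> y)))) =
      piece i d v w \<epsilon> y" for \<epsilon> by (rule piece_overlap[OF d o, symmetric])
    have sb: "symmetric_bilinear (\<lambda>v w. coeff A (cc i) g v w (?\<tau> y))"
      using g_form[OF good_facts(1) transition_overlap(3)[OF good_facts(1) d o]] by (simp add: lorentz_form_def)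
    have "coeff A d g v w y = (\<Sum>j\<in>Basis. \<Sum>k\<in>Basis. (partial_deriv v ?\<tau> y \<bullet> j) * (partial_deriv w ?\<tau> y \<bullet> k) *
        coeff A (cc i) g j k (?\<tau> y))"
      unfolding coeff_change[OF good_facts(1) d o] by (rule bilinear_expand[OF symmetric_bilinear_facts(10)[OF sb]])
    \<comment> \<open>By symmetry of \<open>g\<close>, averaging over the two index orders does not
      change the limit.\<close>
    moreover have "1 / 2 * (coeff A (cc i) g j k (?\<tau> y) + coeff A (cc i) g k j (?\<tau> y)) = coeff A (cc i) g j k (?\<tau> y)" for j k
      using symmetric_bilinear_facts(5)[OF sb, of j k] by simp
    ultimately show "\<eta> i (chart_inv d y) * (\<Sum>j\<in>Basis. \<Sum>k\<in>Basis.
        (partial_deriv v ?\<tau> y \<bullet> j) * (partial_deriv w ?\<tau> y \<bullet> k) *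
        (1 / 2 * (coeff A (cc i) g j k (?\<tau> y) + coeff A (cc i) g k j (?\<tau> y)))) = \<eta> i (chart_inv d y) * coeff A d g v w y"
      by (simp only:)
  qed
next
  fix U assume U: "open U" "x \<in> U" and zero: "\<And>y. y \<in> U \<Longrightarrow> \<beta> i (chart_inv d y) = 0"
  show ?thesis
    by (rule C1_near_cong[OF C1_near_fixed[OF U smooth_on_const[of _ 0]] U]) (simp_all add: piece_def \<beta>_zero_imp_\<eta>_zero zero)
qed

text \<open>On a neighbourhood mapped into a single \<open>W m\<close>, the varying bound
  \<open>N\<close> can be replaced by \<open>Suc m\<close>, so sums with a fixed number of terms
  remain.\<close>

lemma G_coeff_local:
  assumes d: "d \<in> A" and x: "x \<in> chart_image d"
  obtains U m where "open U" "x \<in> U" "U \<subseteq> chart_image d"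
    "\<And>y s \<epsilon> v w. y \<in> U \<Longrightarrow> coeff A d (G s \<epsilon>) v w y =
      (\<Sum>i<Suc m. piece i d v w \<epsilon> y + flat 0 \<epsilon> * (s * kk i * (\<eta> i (chart_inv d y) * coeff A d h v w y)))"
    "\<And>y. y \<in> U \<Longrightarrow> (\<Sum>i<Suc m. \<eta> i (chart_inv d y)) = 1"
proof -
  obtain m where m: "chart_inv d x \<in> W m" using W_cover[OF chart_inv_space[OF d x]] by blast
  let ?U = "{y \<in> chart_image d. chart_inv d y \<in> W m}"
  show ?thesis
  proof (rule that[of ?U m])
    show "open ?U" by (rule chart_preimage_open[OF d W_open])
    show "(\<Sum>i<Suc m. \<eta> i (chart_inv d y)) = 1" if "y \<in> ?U" for y
      using that by (intro \<eta>_sum_W) auto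
    show "coeff A d (G s \<epsilon>) v w y =
      (\<Sum>i<Suc m. piece i d v w \<epsilon> y + flat 0 \<epsilon> * (s * kk i * (\<eta> i (chart_inv d y) * coeff A d h v w y)))"
      if "y \<in> ?U" for y s \<epsilon> v w
    proof -
      have y: "chart_inv d y \<in> W m" using that by simp
      have "coeff A d (G s \<epsilon>) v w y = (\<Sum>i<N (chart_inv d y). \<eta> i (chart_inv d y) *
          (\<Psi> i \<epsilon> (snd (cc i) (chart_inv d y)) (tangent_vec A d (chart_inv d y) v (cc i)) (tangent_vec A d (chart_inv d y) w (cc i)) +
            s * flat 0 \<epsilon> * kk i * coeff A d h v w y))"
        unfolding coeff_def G_def ..
      also have "\<dots> = (\<Sum>i<Suc m. \<eta> i (chart_inv d y) *
          (\<Psi> i \<epsilon> (snd (cc i) (chart_inv d y)) (tangent_vec A d (chart_inv d y) v (cc i)) (tangent_vec A d (chart_inv d y) w (cc i)) +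
            s * flat 0 \<epsilon> * kk i * coeff A d h v w y))"
        by (rule N_sum[OF y])
      finally show ?thesis unfolding piece_def by (simp only: distrib_left mult_ac)
    qed
  qed (use x m in auto)
qed

lemma G_smooth_family: "smooth_family A (G s)"
  unfolding smooth_family_def
proof (intro ballI smooth_on_local)
  fix d and v w :: 'e and z :: "real \<times> 'e" assume d: "d \<in> A" and vw: "v \<in> Basis" "w \<in> Basis" and "z \<in> {0<..} \<times> chart_image d"
  then have z: "(0::real) < fst z" "snd z \<in> chart_image d" by auto
  obtain U m where U: "open U" "snd z \<in> U" "U \<subseteq> chart_image d"
    "\<And>y s \<epsilon> v w. y \<in> U \<Longrightarrow> coeff A d (G s \<epsilon>) v w y =
      (\<Sum>i<Suc m. piece i d v w \<epsilon> y + flat 0 \<epsilon> * (s * kk i * (\<eta> i (chart_inv d y) * coeff A d h v w y)))"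
  proof (rule G_coeff_local[OF d z(2)], goal_cases)
    case (1 U m)
    show ?case by (rule 1(1)[OF 1(2-5)])
  qed
  let ?V = "{0<..} \<times> U :: (real \<times> 'e) set"
  have V: "open ?V" using U(1) by (intro open_Times) auto
  have "smooth_on ?V (\<lambda>z. \<Sum>i<Suc m. (case z of (\<epsilon>, x) \<Rightarrow> piece i d v w \<epsilon> x) +
      flat 0 (fst z) * (s * kk i * (\<eta> i (chart_inv d (snd z)) * coeff A d h v w (snd z))))"
  proof (rule smooth_on_sum[OF V], rule smooth_on_add[OF V])
    fix i
    show "smooth_on ?V (\<lambda>z. case z of (\<epsilon>, x) \<Rightarrow> piece i d v w \<epsilon> x)"
      by (rule smooth_on_subset[OF piece_smooth[OF d vw]]) (use U(3) in auto)
    have "smooth_on U (\<lambda>x. s * kk i * (\<eta> i (chart_inv d x) * coeff A d h v w x))"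
      using h_smooth d vw U(3) unfolding smooth_tensor_def
      by (intro smooth_on_mult[OF U(1)] smooth_on_const smooth_on_subset[OF \<eta>_smooth[OF d]]) (auto intro: smooth_on_subset)
    then show "smooth_on ?V (\<lambda>z. flat 0 (fst z) * (s * kk i * (\<eta> i (chart_inv d (snd z)) * coeff A d h v w (snd z))))"
      using smooth_on_compose[OF V open_UNIV smooth_flat[of 0] smooth_on_bounded_linear[OF bounded_linear_fst V smooth_on_ident]]
      by (intro smooth_on_mult[OF V] smooth_on_snd[OF U(1), of "\<lambda>x. s * kk _ * (\<eta> _ (chart_inv d x) * coeff A d h v w x)"]) auto
  qed
  moreover have "(case z of (\<epsilon>, x) \<Rightarrow> coeff A d (G s \<epsilon>) v w x) = (\<Sum>i<Suc m. (case z of (\<epsilon>, x) \<Rightarrow> piece i d v w \<epsilon> x) +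
      flat 0 (fst z) * (s * kk i * (\<eta> i (chart_inv d (snd z)) * coeff A d h v w (snd z))))" if "z \<in> ?V" for z
    using U(4)[of "snd z"] that unfolding split_beta by auto
  ultimately have "smooth_on ?V (\<lambda>(\<epsilon>, x). coeff A d (G s \<epsilon>) v w x)" by (subst smooth_on_cong[OF V])
  then show "\<exists>U. open U \<and> z \<in> U \<and> smooth_on U (\<lambda>(\<epsilon>, x). coeff A d (G s \<epsilon>) v w x)"
    using V U(2) z(1) by (intro exI[of _ ?V]) (auto simp: mem_Times_iff)
qed

lemma G_smooth: "0 < \<epsilon> \<Longrightarrow> smooth_tensor A (G s \<epsilon>)"
  unfolding smooth_tensor_def
proof (intro ballI)
  fix c and i j :: 'e assume \<epsilon>: "0 < \<epsilon>" and c: "c \<in> A" and ij: "i \<in> Basis" "j \<in> Basis"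
  have "smooth_on ({0<..} \<times> chart_image c) (\<lambda>(\<epsilon>, x). coeff A c (G s \<epsilon>) i j x)"
    using G_smooth_family[of s] c ij unfolding smooth_family_def by blast
  then show "smooth_on (chart_image c) (coeff A c (G s \<epsilon>) i j)"
    by (rule smooth_on_section[OF _ chart_open(2)[OF c] \<epsilon>])
qed

lemma G_C1_near:
  assumes d: "d \<in> A" and vw: "v \<in> Basis" "w \<in> Basis" and x: "x \<in> chart_image d" and C11: "C11_tensor A g"
  shows "C1_near (\<lambda>\<epsilon>. coeff A d (G s \<epsilon>) v w) (coeff A d g v w) x"
proof -
  obtain U m where U: "open U" "x \<in> U" "U \<subseteq> chart_image d"
    "\<And>y s \<epsilon> v w. y \<in> U \<Longrightarrow> coeff A d (G s \<epsilon>) v w y =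
      (\<Sum>i<Suc m. piece i d v w \<epsilon> y + flat 0 \<epsilon> * (s * kk i * (\<eta> i (chart_inv d y) * coeff A d h v w y)))"
    "\<And>y. y \<in> U \<Longrightarrow> (\<Sum>i<Suc m. \<eta> i (chart_inv d y)) = 1"
  proof (rule G_coeff_local[OF d x], goal_cases)
    case (1 U m)
    show ?case by (rule 1(1)[OF 1(2-6)])
  qed
  show ?thesis
  proof (rule C1_near_cong[OF _ U(1,2)])
    show "C1_near (\<lambda>\<epsilon> y. \<Sum>i<Suc m. piece i d v w \<epsilon> y + flat 0 \<epsilon> * (s * kk i * (\<eta> i (chart_inv d y) * coeff A d h v w y)))
       (\<lambda>y. \<Sum>i<Suc m. \<eta> i (chart_inv d y) * coeff A d g v w y + 0 * (s * kk i * (\<eta> i (chart_inv d y) * coeff A d h v w y))) x"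
    proof (rule C1_near_sum, rule C1_near_add[OF piece_C1[OF d vw x C11]], rule C1_near_mult[OF C1_near_flat])
      fix i
      have "smooth_on U (\<lambda>x. s * kk i * (\<eta> i (chart_inv d x) * coeff A d h v w x))"
        using h_smooth d vw U(3) unfolding smooth_tensor_def
        by (intro smooth_on_mult[OF U(1)] smooth_on_const smooth_on_subset[OF \<eta>_smooth[OF d]]) (auto intro: smooth_on_subset)
      then show "C1_near (\<lambda>\<epsilon> y. s * kk i * (\<eta> i (chart_inv d y) * coeff A d h v w y))
          (\<lambda>y. s * kk i * (\<eta> i (chart_inv d y) * coeff A d h v w y)) x"
        by (rule C1_near_fixed[OF U(1,2)])
    qed
    fix y assume y: "y \<in> U"
    show "(\<Sum>i<Suc m. piece i d v w \<epsilon> y + flat 0 \<epsilon> * (s * kk i * (\<eta> i (chart_inv d y) * coeff A d h v w y))) = coeff A d (G s \<epsilon>) v w y" for \<epsilon>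
      by (rule U(4)[OF y, symmetric])
    \<comment> \<open>The term with factor 0 is the limit of the multiple of \<open>h\<close>; the
      rest is \<open>g\<close> times the sum of the weights, which is 1.\<close>
    show "(\<Sum>i<Suc m. \<eta> i (chart_inv d y) * coeff A d g v w y + 0 * (s * kk i * (\<eta> i (chart_inv d y) * coeff A d h v w y))) = coeff A d g v w y"
      using U(5)[OF y] by (simp only: mult_zero_left add_0_right sum_distrib_right[symmetric] mult_1_left)
  qed
qed

lemma G_C1_convergent:
  assumes C11: "C11_tensor A g"
  shows "C1_convergent A (G s) g"
  unfolding C1_convergent_def
proof (intro ballI allI impI conjI)
  fix c K and i j :: 'e assume c: "c \<in> A" and K: "compact K \<and> K \<subseteq> chart_image c" and ij: "i \<in> Basis" "j \<in> Basis"
  have near: "C1_near (\<lambda>\<epsilon>. coeff A c (G s \<epsilon>) i j) (coeff A c g i j) x" if "x \<in> K" for x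
    using G_C1_near[OF c ij _ C11] K that by blast
  have C1: "Ck_on (Suc 0) (chart_image c) (coeff A c g i j)"
    using C11 c ij unfolding C11_tensor_def C11_on_def One_nat_def by blast
  show "uniform_limit K (\<lambda>\<epsilon>. coeff A c (G s \<epsilon>) i j) (coeff A c g i j) (at_right 0)"
    using K near Ck_on_continuous[OF C1]
    by (intro uniform_limit_compact_near_conv) (auto simp: C1_near_def intro: continuous_on_subset)
  fix k :: 'e assume k: "k \<in> Basis"
  have "continuous_on (chart_image c) (partial_deriv k (coeff A c g i j))" using C1 k by simp
  then show "uniform_limit K (\<lambda>\<epsilon>. partial_deriv k (coeff A c (G s \<epsilon>) i j)) (partial_deriv k (coeff A c g i j)) (at_right 0)"
    using K near k
    by (intro uniform_limit_compact_near_conv) (auto simp: C1_near_def intro: continuous_on_subset)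
qed

lemma G_second_derivs_bounded:
  assumes C11: "C11_tensor A g"
  shows "second_derivs_bounded A (G s)"
  unfolding second_derivs_bounded_def
proof (intro ballI allI impI)
  fix c K assume c: "c \<in> A" and K: "compact K \<and> K \<subseteq> chart_image c"
  let ?D = "\<lambda>(i, j, k, l) \<epsilon>. partial_deriv l (partial_deriv k (coeff A c (G s \<epsilon>) i j))"
  let ?I = "Basis \<times> Basis \<times> Basis \<times> Basis :: ('e \<times> 'e \<times> 'e \<times> 'e) set"
  have "\<exists>C. \<forall>\<epsilon>>0. \<forall>x\<in>K. \<bar>?D q \<epsilon> x\<bar> \<le> C" if "q \<in> ?I" for q
  proof -
    obtain i j k l where q: "q = (i, j, k, l)" "i \<in> Basis" "j \<in> Basis" "k \<in> Basis" "l \<in> Basis" using \<open>q \<in> ?I\<close> by auto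
    have "\<exists>C. \<forall>\<epsilon>>0. \<forall>x\<in>K. \<bar>partial_deriv l (partial_deriv k (coeff A c (G s \<epsilon>) i j)) x\<bar> \<le> C"
    proof (rule compact_near_bdd)
      fix x assume "x \<in> K"
      then have "C1_near (\<lambda>\<epsilon>. coeff A c (G s \<epsilon>) i j) (coeff A c g i j) x"
        using G_C1_near[OF c q(2,3) _ C11] K by blast
      then show "near_bdd (\<lambda>\<epsilon>. partial_deriv l (partial_deriv k (coeff A c (G s \<epsilon>) i j))) x"
        using q unfolding C1_near_def near_bdd_C.simps by blast
    qed (use K in blast)
    then show ?thesis by (simp add: q(1))
  qed
  \<comment> \<open>There are finitely many index quadruples, so the sum of their bounds serves for
    all.\<close>
  then obtain C where C: "\<And>q. q \<in> ?I \<Longrightarrow> \<forall>\<epsilon>>0. \<forall>x\<in>K. \<bar>?D q \<epsilon> x\<bar> \<le> C q" by metis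
  have "\<bar>partial_deriv l (partial_deriv k (coeff A c (G s \<epsilon>) i j)) x\<bar> \<le> (\<Sum>q\<in>?I. \<bar>C q\<bar>)"
    if "0 < \<epsilon>" "x \<in> K" "i \<in> Basis" "j \<in> Basis" "k \<in> Basis" "l \<in> Basis" for \<epsilon> x i j k l
  proof -
    have q: "(i, j, k, l) \<in> ?I" using that by simp
    have "\<bar>partial_deriv l (partial_deriv k (coeff A c (G s \<epsilon>) i j)) x\<bar> \<le> C (i, j, k, l)" using C[OF q] that by simp
    also have "\<dots> \<le> \<bar>C (i, j, k, l)\<bar>" by simp
    also have "\<dots> \<le> (\<Sum>q\<in>?I. \<bar>C q\<bar>)" using q by (intro member_le_sum) auto
    finally show ?thesis .
  qed
  then show "\<exists>C. \<forall>\<epsilon>>0. \<forall>x\<in>K. \<forall>i\<in>Basis. \<forall>j\<in>Basis. \<forall>k\<in>Basis. \<forall>l\<in>Basis.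
      \<bar>partial_deriv l (partial_deriv k (coeff A c (G s \<epsilon>) i j)) x\<bar> \<le> C"
    by blast
qed

end

section \<open>Making the choices and concluding\<close>

context approx_setup
begin

lemma gluing_exists:
  assumes "topspace M \<noteq> {}"
  obtains cc xx rr kk mm bb \<Phi> where "gluing M A g h cc xx rr kk mm bb \<Phi>"
proof -
  obtain cc xx rr kk mm where good: "\<And>i :: nat. good (cc i) (xx i) (rr i) (kk i) (mm i)"
    and cover: "topspace M = (\<Union>i. chart_inv (cc i) ` ball (xx i) (rr i))"
  proof (rule countable_good_cover[OF assms], goal_cases)
    case (1 cc xx rr kk mm)
    show ?case by (rule 1(1)[OF 1(2,3)])
  qed
  have good': "cc i \<in> A" "0 < rr i" "cball (xx i) (3 * rr i) \<subseteq> chart_image (cc i)" "0 < kk i" "0 < mm i" for i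
    using good[of i] by (auto simp: good_def)
  have "\<exists>b. smooth_on UNIV b \<and> (\<forall>x. 0 \<le> b x \<and> b x \<le> 1 \<and> (x \<in> cball (xx i) (rr i) \<longrightarrow> b x = (1::real)) \<and>
      (x \<notin> ball (xx i) (3 / 2 * rr i) \<longrightarrow> b x = 0))" for i
  proof (rule smooth_cutoff[of "rr i" "3 / 2 * rr i" "xx i"], goal_cases)
    case (3 b)
    then show ?case by (intro exI[of _ b]) blast
  qed (use good'(2)[of i] in auto)
  then obtain bb where bb: "\<And>i. smooth_on UNIV (bb i)" "\<And>i x. 0 \<le> bb i x \<and> bb i x \<le> 1 \<and>
      (x \<in> cball (xx i) (rr i) \<longrightarrow> bb i x = (1::real)) \<and> (x \<notin> ball (xx i) (3 / 2 * rr i) \<longrightarrow> bb i x = 0)"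
    by metis
  \<comment> \<open>Guarded by membership in \<open>Basis\<close>, the condition is satisfiable for
    all \<open>j\<close> and \<open>k\<close>, so a total function can be chosen.\<close>
  define P where "P i j k F \<longleftrightarrow> (j \<in> Basis \<longrightarrow> k \<in> Basis \<longrightarrow>
      smooth_on ({0<..} \<times> ball (xx i) (2 * rr i)) (\<lambda>(\<epsilon>, x). F \<epsilon> x) \<and>
      (\<forall>\<epsilon>>0. \<forall>x\<in>ball (xx i) (2 * rr i).
         \<bar>F \<epsilon> x - coeff A (cc i) g j k x\<bar> \<le> kk i * mm i / (2 * (real DIM('e))\<^sup>2) * flat 0 \<epsilon>) \<and>
      (C11_tensor A g \<longrightarrow> (\<forall>x\<in>ball (xx i) (2 * rr i). C1_near F (coeff A (cc i) g j k) x)))" for i j k F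
  have "\<exists>F. P i j k F" for i j k
  proof (cases "j \<in> Basis \<and> k \<in> Basis")
    case jk: True
    have cont: "continuous_on (chart_image (cc i)) (coeff A (cc i) g j k)"
      using g_continuous good'(1) jk by (simp add: continuous_tensor_def)
    have "0 < kk i * mm i / (2 * (real DIM('e))\<^sup>2)" using good'(4,5)[of i] by simp
    note fam = smooth_approximating_family[OF good'(2) chart_open(2)[OF good'(1)] good'(3) cont this]
    show ?thesis
    proof (rule fam, goal_cases)
      case (1 F)
      have "C1_near F (coeff A (cc i) g j k) x" if C11: "C11_tensor A g" and x: "x \<in> ball (xx i) (2 * rr i)" for x
      proof (rule 1(3)[OF _ _ x])
        show "Ck_on (Suc 0) (chart_image (cc i)) (coeff A (cc i) g j k)"
          using C11 jk good'(1) unfolding C11_tensor_def C11_on_def One_nat_def by blast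
        show "\<exists>L. L-lipschitz_on (cball (xx i) (3 * rr i)) (partial_deriv v (coeff A (cc i) g j k))" if "v \<in> Basis" for v
          using good[of i] C11 jk that unfolding good_def by blast
      qed
      then show ?case unfolding P_def using 1(1,2) by (intro exI[of _ F]) blast
    qed
  qed (auto simp: P_def)
  then obtain \<Phi> where "\<And>i j k. P i j k (\<Phi> i j k)" by metis
  note \<Phi> = this[unfolded P_def]
  have "gluing M A g h cc xx rr kk mm bb \<Phi>"
  proof (unfold_locales, goal_cases)
    case (1 i) show ?case by (rule good)
  next
    case 2 show ?case by (rule cover)
  next
    case (3 i) show ?case by (rule bb)
  next
    case (4 i x) then show ?case using bb(2) by blast
  next
    case (5 i x) then show ?case using bb(2) by blast
  next
    case (6 x i) then show ?case using bb(2) by blast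
  next
    case (7 x i) then show ?case using bb(2) by blast
  next
    case (8 j k i) then show ?case using \<Phi> by blast
  next
    case (9 j k \<epsilon> x i) then show ?case using \<Phi> by blast
  next
    case (10 j k x i) then show ?case using \<Phi> by blast
  qed
  then show ?thesis by (rule that)
qed

end

theorem proposition2p5:
  fixes M :: "'a topology"
    and A :: "('a, 'e::euclidean_space) chart set"
    and g h :: "('a, 'e) tensor2"
    and T :: "'a \<Rightarrow> ('a, 'e) tvec"
  assumes "continuous_spacetime M A g T"
    and "riemannian_metric A h" and "smooth_tensor A h"
  shows "\<exists>gcheck ghat :: real \<Rightarrow> ('a, 'e) tensor2.
    (\<forall>\<epsilon>>0.
       lorentzian_metric A (gcheck \<epsilon>) \<and> smooth_tensor A (gcheck \<epsilon>) \<and>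
       lorentzian_metric A (ghat \<epsilon>) \<and> smooth_tensor A (ghat \<epsilon>) \<and>
       strictly_larger_cones M A (gcheck \<epsilon>) g \<and>
       strictly_larger_cones M A g (ghat \<epsilon>) \<and>
       metric_dist M A h (gcheck \<epsilon>) g + metric_dist M A h (ghat \<epsilon>) g < ennreal \<epsilon>) \<and>
    smooth_family A gcheck \<and> smooth_family A ghat \<and>
    (C11_tensor A g \<longrightarrow>
       C1_convergent A gcheck g \<and> C1_convergent A ghat g \<and>
       second_derivs_bounded A gcheck \<and> second_derivs_bounded A ghat)"
proof -
  interpret approx_setup M A g h
    using assms by unfold_locales (auto simp: continuous_spacetime_def)
  show ?thesis
  proof (cases "topspace M = {}")
    case True
    have im: "chart_image c = {}" if "c \<in> A" for c
      using chart_open(3)[OF that] True by (simp add: chart_image_def)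
    have sm: "smooth_on {} f" for f :: "'x::euclidean_space \<Rightarrow> real"
      by (rule smooth_on_local) simp
    \<comment> \<open>On the empty manifold \<open>g\<close> itself serves: all local conditions are
      vacuous and the supremum over no points is 0.\<close>
    have "metric_dist M A h g g = 0"
      by (simp only: metric_dist_def True image_empty Sup_empty bot_ennreal)
    then show ?thesis
      using g_lorentzian
      by (intro exI[of _ "\<lambda>_. g"])
        (simp add: smooth_tensor_def smooth_family_def im sm strictly_larger_cones_def True
          C1_convergent_def second_derivs_bounded_def)
  next
    case False
    then obtain cc xx rr kk mm bb \<Phi> where "gluing M A g h cc xx rr kk mm bb \<Phi>"
      by (rule gluing_exists)
    then interpret gluing M A g h cc xx rr kk mm bb \<Phi> .
    show ?thesis
    \<comment> \<open>The positive shift gives the metrics with narrower cones, the negative shift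
      those with wider cones.\<close>
    proof (rule exI[of _ "G 1"], rule exI[of _ "G (-1)"], intro conjI allI impI)
      fix \<epsilon> :: real assume \<epsilon>: "0 < \<epsilon>"
      show "lorentzian_metric A (G 1 \<epsilon>)" "lorentzian_metric A (G (-1) \<epsilon>)"
        using \<epsilon> by (auto intro: G_lorentzian)
      show "smooth_tensor A (G 1 \<epsilon>)" "smooth_tensor A (G (-1) \<epsilon>)"
        using \<epsilon> by (auto intro: G_smooth)
      show "strictly_larger_cones M A (G 1 \<epsilon>) g" "strictly_larger_cones M A g (G (-1) \<epsilon>)"
        using G_cones[OF \<epsilon>] by auto
      show "metric_dist M A h (G 1 \<epsilon>) g + metric_dist M A h (G (-1) \<epsilon>) g < ennreal \<epsilon>"
        by (rule G_dist_sum[OF \<epsilon>])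
    qed (auto intro: G_smooth_family G_C1_convergent G_second_derivs_bounded)
  qed
qed

end
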